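(* Let $d=1$ and consider a diffusion in random environment on $\mathbb R$ with parameters $\bar K,\nu>1$, $R>0$. For $L>0$ let $$\rho_L(\omega)=\frac{P_{0,\omega}[\tilde T_{-L}<T_L]}{P_{0,\omega}[\tilde T_{-L}>T_L]} .$$ The following conditions are equivalent: (i) There exist $a\in(0,1]$ and $L>R$ such that $\mathbb E[\rho_L^a]<1$. (ii) There exists $L>R$ such that $\mathbb E[\log\rho_L]<0$. (iii) Condition $(T)$ holds relative to $e_1$, i.e. for all $b>0$, $\limsup_{L\to\infty}L^{-1}\log P_0[\tilde T_{-bL}<T_L]<0$. (iv) Condition $(T')$ holds relative to $e_1$, i.e. for all $\gamma\in(0,1)$ and all $b>0$, $\limsup_{L\to\infty}L^{-\gamma}\log P_0[\tilde T_{-bL}<T_L]<0$. (v) $\lim_{t\to\infty}X_t\cdot e_1=\infty$, $P_0$-a.s.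
   Context: **Diffusion in random environment on $\mathbb R$.** $(\Omega,\mathcal A,\mathbb P)$ is a probability space on which acts a jointly measurable group $\{t_x;x\in\mathbb R\}$ of $\mathbb P$-preserving transformations; $\mathbb E$ is the $\mathbb P$-expectation. The real-valued functions $a(x,\omega)\ge 0$ and $b(x,\omega)$ are stationary: $a(x+y,\omega)=a(x,t_y\omega)$, $b(x+y,\omega)=b(x,t_y\omega)$. For all $x,y\in\mathbb R$, $\omega\in\Omega$: $|b(x,\omega)|+|a(x,\omega)|\le\bar K$, $|b(x,\omega)-b(y,\omega)|+|a(x,\omega)-a(y,\omega)|\le\bar K|x-y|$, and $\frac1\nu\le a(x,\omega)\le\nu$. With $\mathcal H_A=\sigma(a(x,\cdot),b(x,\cdot);x\in A)$ for $A\subset\mathbb R$, the $\sigma$-algebras $\mathcal H_A,\mathcal H_B$ are $\mathbb P$-independent whenever the distance $d(A,B)\ge R$. $P_{x,\omega}$ is the law on $C(\mathbb R_+,\mathbb R)$ (canonical process $(X_t)_{t\ge0}$) of the unique solution of the martingale problem started at $x$ for $\mathcal L_\omega=\frac12a(\cdot,\omega)\partial^2+b(\cdot,\omega)\partial$. The annealed law is the semi-direct product $P_x=\mathbb P\times P_{x,\omega}$. $e_1=1$ is the unit vector of $\mathbb R$; for $u\in\mathbb R$, $T_u=\inf\{t\ge0;X_t\ge u\}$ and $\tilde T_u=\inf\{t\ge0;X_t\le u\}$. *)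

theory Defs
  imports "HOL-Probability.Probability"
begin

text \<open>
  \<open>C(\<real>\<^sub>+, \<real>)\<close> with the \<open>\<sigma>\<close>-algebra generated by the coordinates. A path is a function
  on \<open>\<real>\<close> that is continuous on \<open>[0, \<infinity>)\<close> and, as every element of the product space over
  \<open>{0..}\<close>, is \<open>undefined\<close> at negative times. The canonical process is \<open>X\<^sub>t w = w t\<close>.
\<close>

definition path_space :: "(real \<Rightarrow> real) measure" where
  "path_space =
    restrict_space (\<Pi>\<^sub>M t\<in>{0..}. (borel :: real measure)) {w. continuous_on {0..} w}"

definition canonical_filtration :: "real \<Rightarrow> (real \<Rightarrow> real) measure" where
  "canonical_filtration t =
    sigma (space path_space)
      {{w \<in> space path_space. w s \<in> B} | s B. 0 \<le> s \<and> s \<le> t \<and> B \<in> sets borel}"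

text \<open>Both hitting times are \<open>\<infinity>\<close> if the level is never reached.\<close>

definition hit_above :: "real \<Rightarrow> (real \<Rightarrow> real) \<Rightarrow> ereal" where
  "hit_above u w = Inf (ereal ` {t. 0 \<le> t \<and> w t \<ge> u})"

definition hit_below :: "real \<Rightarrow> (real \<Rightarrow> real) \<Rightarrow> ereal" where
  "hit_below u w = Inf (ereal ` {t. 0 \<le> t \<and> w t \<le> u})"

definition martingale ::
    "'a measure \<Rightarrow> (real \<Rightarrow> 'a measure) \<Rightarrow> (real \<Rightarrow> 'a \<Rightarrow> real) \<Rightarrow> bool" where
  "martingale N F Y \<longleftrightarrow>
     (\<forall>t\<ge>0. subalgebra N (F t) \<and> Y t \<in> borel_measurable (F t) \<and> integrable N (Y t)) \<and>
     (\<forall>s t. 0 \<le> s \<and> s \<le> t \<longrightarrow> (AE w in N. real_cond_exp N (F s) (Y t) w = Y s w))"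

definition C2_compact_support :: "(real \<Rightarrow> real) \<Rightarrow> bool" where
  "C2_compact_support f \<longleftrightarrow>
     (\<forall>x. f field_differentiable (at x)) \<and>
     (\<forall>x. deriv f field_differentiable (at x)) \<and>
     continuous_on UNIV (deriv (deriv f)) \<and>
     compact (closure {x. f x \<noteq> 0})"

definition generator ::
    "(real \<Rightarrow> real) \<Rightarrow> (real \<Rightarrow> real) \<Rightarrow> (real \<Rightarrow> real) \<Rightarrow> real \<Rightarrow> real" where
  "generator \<alpha> \<beta> f x = 1/2 * \<alpha> x * deriv (deriv f) x + \<beta> x * deriv f x"

definition solves_martingale_problem ::
    "(real \<Rightarrow> real) \<Rightarrow> (real \<Rightarrow> real) \<Rightarrow> real \<Rightarrow> (real \<Rightarrow> real) measure \<Rightarrow> bool" where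
  "solves_martingale_problem \<alpha> \<beta> x N \<longleftrightarrow>
     prob_space N \<and> sets N = sets path_space \<and>
     (AE w in N. w 0 = x) \<and>
     (\<forall>f. C2_compact_support f \<longrightarrow>
        martingale N canonical_filtration
          (\<lambda>t w. f (w t) - f (w 0) - (LBINT s:{0..t}. generator \<alpha> \<beta> f (w s))))"

text \<open>The \<open>\<sigma>\<close>-algebra \<open>\<H>\<^sub>A\<close> generated by the environment in \<open>A\<close>, as a set of events.\<close>

definition env_events ::
    "'w measure \<Rightarrow> (real \<Rightarrow> 'w \<Rightarrow> real) \<Rightarrow> (real \<Rightarrow> 'w \<Rightarrow> real) \<Rightarrow> real set \<Rightarrow> 'w set set" where
  "env_events M a b A =
    sigma_sets (space M)
      ({a x -` B \<inter> space M | x B. x \<in> A \<and> B \<in> sets borel} \<union>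
       {b x -` B \<inter> space M | x B. x \<in> A \<and> B \<in> sets borel})"

text \<open>
  The environment is \<open>(M, \<tau>, a, b)\<close>, and \<open>P x \<omega>\<close> is the quenched law \<open>P\<^bsub>x,\<omega>\<^esub>\<close>. That
  \<open>P x\<close> is a probability kernel is what makes the semi-direct product \<open>annealed\<close> below
  meaningful. In the independence axiom, \<open>setdist\<close> is \<open>0\<close> if one of the sets is empty, but then
  one of the two \<open>\<sigma>\<close>-algebras is trivial and there is nothing to require.
\<close>

locale diffusion_in_random_environment = prob_space M
  for M :: "'w measure" +
  fixes \<tau> :: "real \<Rightarrow> 'w \<Rightarrow> 'w"
    and a b :: "real \<Rightarrow> 'w \<Rightarrow> real"
    and K \<nu> R :: real
    and P :: "real \<Rightarrow> 'w \<Rightarrow> (real \<Rightarrow> real) measure"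
  assumes K_gt_1: "K > 1" and nu_gt_1: "\<nu> > 1" and R_pos: "R > 0"
    and shift_measurable: "(\<lambda>(x, \<omega>). \<tau> x \<omega>) \<in> borel \<Otimes>\<^sub>M M \<rightarrow>\<^sub>M M"
    and shift_zero: "\<And>\<omega>. \<omega> \<in> space M \<Longrightarrow> \<tau> 0 \<omega> = \<omega>"
    and shift_add: "\<And>x y \<omega>. \<omega> \<in> space M \<Longrightarrow> \<tau> (x + y) \<omega> = \<tau> x (\<tau> y \<omega>)"
    and shift_preserving: "\<And>x. distr M M (\<tau> x) = M"
    and a_measurable: "\<And>x. a x \<in> borel_measurable M"
    and b_measurable: "\<And>x. b x \<in> borel_measurable M"
    and a_stationary: "\<And>x y \<omega>. \<omega> \<in> space M \<Longrightarrow> a (x + y) \<omega> = a x (\<tau> y \<omega>)"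
    and b_stationary: "\<And>x y \<omega>. \<omega> \<in> space M \<Longrightarrow> b (x + y) \<omega> = b x (\<tau> y \<omega>)"
    and coeff_bounded: "\<And>x \<omega>. \<omega> \<in> space M \<Longrightarrow> \<bar>b x \<omega>\<bar> + \<bar>a x \<omega>\<bar> \<le> K"
    and coeff_Lipschitz: "\<And>x y \<omega>. \<omega> \<in> space M \<Longrightarrow>
          \<bar>b x \<omega> - b y \<omega>\<bar> + \<bar>a x \<omega> - a y \<omega>\<bar> \<le> K * \<bar>x - y\<bar>"
    and elliptic: "\<And>x \<omega>. \<omega> \<in> space M \<Longrightarrow> 1 / \<nu> \<le> a x \<omega> \<and> a x \<omega> \<le> \<nu>"
    and finite_range: "\<And>A B. setdist A B \<ge> R \<Longrightarrow>
          indep_set (env_events M a b A) (env_events M a b B)"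
    and quenched_kernel: "\<And>x. P x \<in> M \<rightarrow>\<^sub>M prob_algebra path_space"
    and quenched_solution: "\<And>x \<omega>. \<omega> \<in> space M \<Longrightarrow>
          solves_martingale_problem (\<lambda>y. a y \<omega>) (\<lambda>y. b y \<omega>) x (P x \<omega>)"
    and quenched_unique: "\<And>x \<omega> N. \<omega> \<in> space M \<Longrightarrow>
          solves_martingale_problem (\<lambda>y. a y \<omega>) (\<lambda>y. b y \<omega>) x N \<Longrightarrow> N = P x \<omega>"

text \<open>The semi-direct product of \<open>M\<close> and the kernel \<open>Q\<close>, on \<open>\<Omega> \<times> C(\<real>\<^sub>+, \<real>)\<close>.\<close>

definition annealed ::
    "'w measure \<Rightarrow> ('w \<Rightarrow> (real \<Rightarrow> real) measure) \<Rightarrow> ('w \<times> (real \<Rightarrow> real)) measure" where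
  "annealed M Q = M \<bind> (\<lambda>\<omega>. distr (Q \<omega>) (M \<Otimes>\<^sub>M path_space) (\<lambda>w. (\<omega>, w)))"

definition rho :: "('w \<Rightarrow> (real \<Rightarrow> real) measure) \<Rightarrow> real \<Rightarrow> 'w \<Rightarrow> real" where
  "rho Q L \<omega> =
     measure (Q \<omega>) {w \<in> space (Q \<omega>). hit_below (- L) w < hit_above L w} /
     measure (Q \<omega>) {w \<in> space (Q \<omega>). hit_below (- L) w > hit_above L w}"

definition backtrack_prob :: "('w \<times> (real \<Rightarrow> real)) measure \<Rightarrow> real \<Rightarrow> real \<Rightarrow> real" where
  "backtrack_prob PP c L =
     measure PP {p \<in> space PP. hit_below (- (c * L)) (snd p) < hit_above L (snd p)}"

text \<open>Logarithm of a probability, with \<open>log 0 = -\<infinity>\<close> (whereas \<open>ln 0 = 0\<close>).\<close>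

definition log_prob :: "real \<Rightarrow> ereal" where
  "log_prob p = (if p = 0 then -\<infinity> else ereal (ln p))"

definition condition_T :: "('w \<times> (real \<Rightarrow> real)) measure \<Rightarrow> bool" where
  "condition_T PP \<longleftrightarrow>
     (\<forall>c>0. Limsup at_top (\<lambda>L. ereal (1 / L) * log_prob (backtrack_prob PP c L)) < 0)"

definition condition_T' :: "('w \<times> (real \<Rightarrow> real)) measure \<Rightarrow> bool" where
  "condition_T' PP \<longleftrightarrow>
     (\<forall>\<gamma>. 0 < \<gamma> \<and> \<gamma> < 1 \<longrightarrow> (\<forall>c>0.
        Limsup at_top (\<lambda>L. ereal (L powr (- \<gamma>)) * log_prob (backtrack_prob PP c L)) < 0))"

end

theory Submission
  imports Defs "HOL-Real_Asymp.Real_Asymp"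
begin

text \<open>
  With \<open>V x = \<integral>\<^sub>0\<^sup>x 2 b / a\<close> and \<open>S x = \<integral>\<^sub>0\<^sup>x exp (- V)\<close>, the function \<open>S\<close> is harmonic, so by
  optional stopping \<open>X\<close> hits \<open>- l\<close> before \<open>L\<close> with quenched probability \<open>S L / (S L - S (- l))\<close>.
  By stationarity, \<open>\<rho>\<^sub>L = S L / (- S (- L))\<close> has \<open>E[ln \<rho>\<^sub>L] = - E[V L]\<close>, which turns (ii) into
  \<open>E[V L] > 0\<close>. As (i) and (ii) concern the same bounded variable \<open>ln \<rho>\<^sub>L\<close>, they are equivalent
  because \<open>s \<mapsto> E[\<rho>\<^sub>L\<^sup>s]\<close> is convex with slope \<open>E[ln \<rho>\<^sub>L]\<close> at \<open>0\<close>.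

  If \<open>E[V L] > 0\<close>, the finite range of dependence makes \<open>E[exp (- s V y)]\<close> decay exponentially in
  \<open>y\<close> for some \<open>s\<close>; this bounds the annealed exit probabilities, which is \<open>(T)\<close>, and shows
  \<open>S \<infinity> < \<infinity>\<close> and \<open>S (- \<infinity>) = - \<infinity>\<close>, which is transience to \<open>+ \<infinity>\<close>. Conversely, under \<open>(T')\<close> the
  probability that \<open>\<rho>\<^sub>L \<ge> 1\<close> is \<open>o (1 / L)\<close> while \<open>ln \<rho>\<^sub>L = O (L)\<close>, so \<open>E[ln \<rho>\<^sub>L] < 0\<close> for large \<open>L\<close>; and
  transience forces \<open>S \<infinity> < \<infinity>\<close>, in which case \<open>V L\<close> exceeds the centred coboundary
  \<open>ln S \<infinity> \<circ> \<tau>\<^sub>L - ln S \<infinity>\<close>.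
\<close>

subsection \<open>Path space and optional stopping\<close>

text \<open>Each quenched law is known only as a solution of the martingale problem; no strong
  Markov property is derived. A restart at level \<open>y\<close> is replaced by comparing two
  stopping times of one path: the first passage to \<open>y\<close> and the first visit to
  \<open>C\<close> from then on. Hence \<open>reached\<close> carries a level besides the set. One
  optional stopping identity then yields both the exit probabilities (\<open>y = 0\<close>) and the
  return probabilities from high levels that transience needs.

  Only a small fractional moment of \<open>exp (- V y)\<close> is controlled. A ruin probability is
  at most \<open>1\<close>, hence below a sum of \<open>s\<close>-th powers; almost sure statements
  use \<open>exp (- V n) \<le> exp (- s * V n)\<close> once \<open>V n > 0\<close>.

  Ellipticity and boundedness give \<open>V\<close> a deterministic Lipschitz constant, so integrals
  of \<open>exp (- V)\<close> reduce to sums over integers, and for fixed \<open>L\<close> the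
  logarithm of \<open>S L\<close> is bounded: the means that cancel by stationarity are finite. The
  exception is \<open>ln S \<infinity>\<close>, which has to be truncated.\<close>

definition reached :: "real \<Rightarrow> real set \<Rightarrow> (real \<Rightarrow> real) \<Rightarrow> real \<Rightarrow> bool" where
  "reached y C w s \<longleftrightarrow> 0 \<le> s \<and> w s \<in> C \<and> (\<exists>r. 0 \<le> r \<and> r \<le> s \<and> y \<le> w r)"

text \<open>Inserting \<open>t\<close> truncates the first visit at \<open>t\<close>, so for
  \<open>0 \<le> t\<close> this is a bounded stopping time. With \<open>C = UNIV\<close> it is the
  first passage to level \<open>y\<close>, cut off at \<open>t\<close>.\<close>

definition visit_time :: "real \<Rightarrow> real set \<Rightarrow> real \<Rightarrow> (real \<Rightarrow> real) \<Rightarrow> real" where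
  "visit_time y C t w = Inf (insert t {s. s \<le> t \<and> reached y C w s})"

lemma space_path_space: "space path_space = {w \<in> extensional {0..}. continuous_on {0..} w}"
  by (auto simp: path_space_def space_restrict_space space_PiM PiE_def)

lemma path_continuous: "w \<in> space path_space \<Longrightarrow> continuous_on {0..} w"
  by (simp add: space_path_space)

lemma space_canonical_filtration [simp]: "space (canonical_filtration t) = space path_space"
  unfolding canonical_filtration_def by (rule space_measure_of) auto

lemma sets_canonical_filtration:
  "sets (canonical_filtration t) = sigma_sets (space path_space)
     {{w \<in> space path_space. w s \<in> B} | s B. 0 \<le> s \<and> s \<le> t \<and> B \<in> sets borel}"
  unfolding canonical_filtration_def by (rule sets_measure_of) auto

lemma coordinate_measurable:
  assumes "0 \<le> s" "s \<le> t"
  shows "(\<lambda>w. w s) \<in> borel_measurable (canonical_filtration t)"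
proof (rule measurableI)
  fix B :: "real set" assume B: "B \<in> sets borel"
  have "(\<lambda>w. w s) -` B \<inter> space (canonical_filtration t) = {w \<in> space path_space. w s \<in> B}"
    by auto
  also have "\<dots> \<in> sets (canonical_filtration t)"
    unfolding sets_canonical_filtration using assms B by (intro sigma_sets.Basic) auto
  finally show "(\<lambda>w. w s) -` B \<inter> space (canonical_filtration t) \<in> sets (canonical_filtration t)" .
qed simp

lemma coordinate_measurable_path_space [measurable]:
  assumes "0 \<le> s"
  shows "(\<lambda>w. w s) \<in> borel_measurable path_space"
  unfolding path_space_def
  by (rule measurable_restrict_space1, rule measurable_component_singleton) (use assms in simp)

lemma sets_canonical_filtration_subset: "sets (canonical_filtration t) \<subseteq> sets path_space"
  unfolding sets_canonical_filtration
proof (rule sets.sigma_sets_subset, safe)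
  fix s :: real and B :: "real set" assume s: "0 \<le> s" and B: "B \<in> sets borel"
  have "(\<lambda>w. w s) -` B \<inter> space path_space \<in> sets path_space"
    by (rule measurable_sets[OF coordinate_measurable_path_space[OF s] B])
  also have "(\<lambda>w. w s) -` B \<inter> space path_space = {w \<in> space path_space. w s \<in> B}" by auto
  finally show "{w \<in> space path_space. w s \<in> B} \<in> sets path_space" .
qed

lemma sets_canonical_filtration_mono:
  "s \<le> t \<Longrightarrow> sets (canonical_filtration s) \<subseteq> sets (canonical_filtration t)"
  unfolding sets_canonical_filtration by (rule sigma_sets_mono') force

lemma compact_triangle: "compact {p::real \<times> real. 0 \<le> fst p \<and> fst p \<le> snd p \<and> snd p \<le> q}"
  (is "compact ?T")
proof -
  have "closed ?T" by (intro closed_Collect_conj closed_Collect_le continuous_intros)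
  moreover have "?T \<subseteq> {0..q} \<times> {0..q}" by auto
  then have "bounded ?T"
    by (rule bounded_subset[OF compact_imp_bounded[OF compact_Times[OF compact_Icc compact_Icc]]])
  ultimately show ?thesis by (simp only: compact_eq_bounded_closed)
qed

text \<open>The event asks for a pair \<open>r \<le> s \<le> q\<close> from an uncountable set. On
  the compact triangle \<open>T\<close> of such pairs the continuous function \<open>H w\<close>
  attains its infimum, so a witness exists iff a countable dense set has points where
  \<open>H w\<close> is below any given positive number. Points of \<open>T\<close> involve only
  times up to \<open>q\<close>, so the event lies in the filtration at \<open>q\<close>
  itself.\<close>

lemma reached_by_sets:
  assumes C: "closed C" "C \<noteq> {}"
  shows "{w \<in> space path_space. \<exists>s\<le>q. reached y C w s} \<in> sets (canonical_filtration q)"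
proof -
  define T where "T = {p::real \<times> real. 0 \<le> fst p \<and> fst p \<le> snd p \<and> snd p \<le> q}"
  have T: "compact T" unfolding T_def by (rule compact_triangle)
  obtain D where D: "countable D" "D \<subseteq> T" "T \<subseteq> closure D"
    by (rule separable[of T])
  \<comment> \<open>\<open>H w p \<le> 0\<close> says exactly that the pair \<open>p\<close> is a
    witness. This uses \<open>C \<noteq> {}\<close>, since \<open>infdist\<close> to the empty set
    is \<open>0\<close>.\<close>
  define H where "H w p = max (y - w (fst p)) (infdist (w (snd p)) C)" for w :: "real \<Rightarrow> real" and p
  have cont: "continuous_on T (H w)" if "w \<in> space path_space" for w
  proof -
    have c: "continuous_on T (\<lambda>p. w (fst p))" "continuous_on T (\<lambda>p. w (snd p))"
      by (rule continuous_on_compose2[OF path_continuous[OF that]];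
          auto simp: T_def intro!: continuous_intros)+
    then show ?thesis unfolding H_def by (intro continuous_intros)
  qed
  have iff: "(\<exists>s\<le>q. reached y C w s) \<longleftrightarrow> (\<forall>n. \<exists>p\<in>D. H w p < inverse (real (Suc n)))"
    if w: "w \<in> space path_space" for w
  proof
    assume "\<exists>s\<le>q. reached y C w s"
    then obtain s r where sr: "0 \<le> r" "r \<le> s" "s \<le> q" "y \<le> w r" "w s \<in> C"
      by (auto simp: reached_def)
    then have p: "(r, s) \<in> T" "H w (r, s) \<le> 0" by (auto simp: T_def H_def)
    show "\<forall>n. \<exists>p\<in>D. H w p < inverse (real (Suc n))"
    proof
      fix n
      have "0 < inverse (real (Suc n))" by simp
      then obtain d where d: "d > 0"
        "\<And>p'. p' \<in> T \<Longrightarrow> dist p' (r, s) < d \<Longrightarrow> dist (H w p') (H w (r, s)) < inverse (real (Suc n))"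
        using cont[OF w] p(1) unfolding continuous_on_iff by meson
      from p(1) D(3) obtain p' where p': "p' \<in> D" "dist p' (r, s) < d"
        using d(1) by (meson closure_approachable subsetD)
      with d(2)[of p'] D(2) p(2) have "H w p' < inverse (real (Suc n))"
        by (auto simp: dist_real_def)
      with p' show "\<exists>p\<in>D. H w p < inverse (real (Suc n))" by blast
    qed
  next
    assume *: "\<forall>n. \<exists>p\<in>D. H w p < inverse (real (Suc n))"
    then have "T \<noteq> {}" using D by blast
    from continuous_attains_inf[OF T this cont[OF w]] obtain p where
      p: "p \<in> T" "\<And>p'. p' \<in> T \<Longrightarrow> H w p \<le> H w p'" by blast
    have "H w p \<le> 0"
    proof (rule ccontr)
      assume "\<not> H w p \<le> 0"
      then obtain n where "inverse (real (Suc n)) < H w p"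
        using reals_Archimedean[of "H w p"] by auto
      moreover obtain p' where "p' \<in> D" "H w p' < inverse (real (Suc n))" using * by blast
      ultimately show False using p(2)[of p'] D(2) by force
    qed
    then have "y \<le> w (fst p)" "infdist (w (snd p)) C \<le> 0" by (auto simp: H_def)
    moreover from this have "w (snd p) \<in> C"
      using in_closed_iff_infdist_zero[OF C] infdist_nonneg[of "w (snd p)" C] by force
    ultimately show "\<exists>s\<le>q. reached y C w s"
      using p(1) unfolding reached_def T_def mem_Collect_eq
      by (meson order_trans)
  qed
  have "{w \<in> space path_space. \<exists>s\<le>q. reached y C w s} =
      {w \<in> space (canonical_filtration q). \<forall>n. \<exists>p\<in>D. H w p < inverse (real (Suc n))}"
    using iff by auto
  also have "\<dots> \<in> sets (canonical_filtration q)"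
  proof -
    have [measurable]: "(\<lambda>w. H w p) \<in> borel_measurable (canonical_filtration q)" if "p \<in> D" for p
    proof -
      have "p \<in> T" using that D by auto
      then have [measurable]: "(\<lambda>w. w (fst p)) \<in> borel_measurable (canonical_filtration q)"
         "(\<lambda>w. w (snd p)) \<in> borel_measurable (canonical_filtration q)"
        by (auto simp: T_def intro!: coordinate_measurable)
      have [measurable]: "(\<lambda>x. infdist x C) \<in> borel_measurable borel"
        by (intro borel_measurable_continuous_onI continuous_intros)
      show ?thesis unfolding H_def by measurable
    qed
    have "{w \<in> space (canonical_filtration q). H w p < inverse (real (Suc n))}
        \<in> sets (canonical_filtration q)" if "p \<in> D" for p n
      using that by measurable
    then have "{w \<in> space (canonical_filtration q). \<exists>p\<in>D. H w p < inverse (real (Suc n))}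
        \<in> sets (canonical_filtration q)" for n
      by (rule sets.sets_Collect_countable_Ex'[OF _ D(1)])
    then show ?thesis by (rule sets.sets_Collect_countable_All)
  qed
  finally show ?thesis .
qed

text \<open>The set is the projection to the second coordinate of a compact set of pairs
  \<open>(r, s)\<close>. Its closedness makes the infimum in \<open>visit_time\<close>
  attained.\<close>

lemma compact_reached:
  assumes C: "closed C" and w: "w \<in> space path_space"
  shows "compact {s. s \<le> t \<and> reached y C w s}"
proof -
  define T where "T = {p::real \<times> real. 0 \<le> fst p \<and> fst p \<le> snd p \<and> snd p \<le> t}"
  have T: "compact T" unfolding T_def by (rule compact_triangle)
  then have "closed T" by (rule compact_imp_closed)
  have c: "continuous_on T (\<lambda>p. w (fst p))" "continuous_on T (\<lambda>p. w (snd p))"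
    by (rule continuous_on_compose2[OF path_continuous[OF w]];
        auto simp: T_def intro!: continuous_intros)+
  have "closed (T \<inter> (\<lambda>p. w (fst p)) -` {y..})" "closed (T \<inter> (\<lambda>p. w (snd p)) -` C)"
    using \<open>closed T\<close> c C by (auto intro!: continuous_closed_preimage)
  then have "closed ((T \<inter> (\<lambda>p. w (fst p)) -` {y..}) \<inter> (T \<inter> (\<lambda>p. w (snd p)) -` C))"
    by blast
  then have "compact (T \<inter> ((T \<inter> (\<lambda>p. w (fst p)) -` {y..}) \<inter> (T \<inter> (\<lambda>p. w (snd p)) -` C)))"
    by (rule compact_Int_closed[OF T])
  then have "compact (snd ` (T \<inter> ((T \<inter> (\<lambda>p. w (fst p)) -` {y..}) \<inter> (T \<inter> (\<lambda>p. w (snd p)) -` C))))"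
    by (intro compact_continuous_image continuous_intros)
  also have "snd ` (T \<inter> ((T \<inter> (\<lambda>p. w (fst p)) -` {y..}) \<inter> (T \<inter> (\<lambda>p. w (snd p)) -` C))) =
      {s. s \<le> t \<and> reached y C w s}"
  proof (intro equalityI subsetI)
    fix s assume "s \<in> {s. s \<le> t \<and> reached y C w s}"
    then obtain r where "0 \<le> r" "r \<le> s" "s \<le> t" "y \<le> w r" "w s \<in> C"
      by (auto simp: reached_def)
    then show "s \<in> snd ` (T \<inter> ((T \<inter> (\<lambda>p. w (fst p)) -` {y..}) \<inter> (T \<inter> (\<lambda>p. w (snd p)) -` C)))"
      by (intro image_eqI[of _ _ "(r, s)"]) (auto simp: T_def)
  qed (auto simp: T_def reached_def)
  finally show ?thesis .
qed

lemma visit_time_nonneg: "0 \<le> t \<Longrightarrow> 0 \<le> visit_time y C t w"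
  unfolding visit_time_def by (rule cInf_greatest) (auto simp: reached_def)

lemma bdd_below_reached: "bdd_below (insert t {s. s \<le> t \<and> reached y C w s})"
  by (auto simp: reached_def intro!: bdd_belowI[of _ 0])

lemma visit_time_le: "visit_time y C t w \<le> t"
  unfolding visit_time_def by (rule cInf_lower[OF _ bdd_below_reached]) auto

lemma visit_time_lower: "s \<le> t \<Longrightarrow> reached y C w s \<Longrightarrow> visit_time y C t w \<le> s"
  unfolding visit_time_def by (rule cInf_lower[OF _ bdd_below_reached]) auto

lemma visit_time_eq:
  assumes "\<And>s. s \<le> t \<Longrightarrow> \<not> reached y C w s"
  shows "visit_time y C t w = t"
proof -
  have "{s. s \<le> t \<and> reached y C w s} = {}" using assms by blast
  then show ?thesis unfolding visit_time_def by (simp only: cInf_singleton)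
qed

lemma visit_time_reached:
  assumes "closed C" "w \<in> space path_space" "s \<le> t" "reached y C w s"
  shows "reached y C w (visit_time y C t w)"
proof -
  let ?A = "{s. s \<le> t \<and> reached y C w s}"
  have ne: "?A \<noteq> {}" and bdd: "bdd_below ?A"
    using assms by (auto simp: reached_def intro!: bdd_belowI[of _ 0])
  have "closed ?A" using compact_reached[OF assms(1,2)] compact_imp_closed by blast
  then have "Inf ?A \<in> ?A" using ne bdd by (intro closed_contains_Inf)
  moreover have "visit_time y C t w = Inf ?A"
    unfolding visit_time_def using ne bdd \<open>Inf ?A \<in> ?A\<close>
    by (subst cInf_insert) (auto simp: inf_min)
  ultimately show ?thesis by simp
qed

text \<open>For \<open>t \<le> q\<close> the left side would hold because of the truncation alone;
  \<open>q < t\<close> is the range that \<open>optional_stopping\<close> asks for.\<close>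

lemma visit_time_le_iff:
  assumes "closed C" "w \<in> space path_space" "q < t"
  shows "visit_time y C t w \<le> q \<longleftrightarrow> (\<exists>s\<le>q. reached y C w s)"
proof
  assume *: "visit_time y C t w \<le> q"
  have "\<exists>s\<le>t. reached y C w s"
  proof (rule ccontr)
    assume "\<not> ?thesis"
    then have "visit_time y C t w = t" by (intro visit_time_eq) auto
    with * assms(3) show False by simp
  qed
  then show "\<exists>s\<le>q. reached y C w s" using visit_time_reached[OF assms(1,2)] * by blast
next
  assume "\<exists>s\<le>q. reached y C w s"
  then obtain s where "s \<le> q" "reached y C w s" by blast
  with visit_time_lower[of s t y C w] assms(3) show "visit_time y C t w \<le> q" by linarith
qed

lemma visit_time_sets:
  assumes "closed C" "C \<noteq> {}" "q < t"
  shows "{w \<in> space path_space. visit_time y C t w \<le> q} \<in> sets (canonical_filtration q)"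
proof -
  have "{w \<in> space path_space. visit_time y C t w \<le> q} =
      {w \<in> space path_space. \<exists>s\<le>q. reached y C w s}"
    using visit_time_le_iff[OF assms(1) _ assms(3)] by auto
  with reached_by_sets[OF assms(1,2)] show ?thesis by simp
qed

text \<open>\<open>\<theta>\<close> is approximated from above by the first point of the grid \<open>{k t / n}\<close> after it.\<close>

lemma optional_stopping:
  fixes Y :: "real \<Rightarrow> (real \<Rightarrow> real) \<Rightarrow> real"
  assumes N: "prob_space N" "sets N = sets path_space"
    and Y: "martingale N canonical_filtration Y"
    and cont: "\<And>w. w \<in> space path_space \<Longrightarrow> continuous_on {0..t} (\<lambda>s. Y s w)"
    and bound: "\<And>w s. w \<in> space path_space \<Longrightarrow> 0 \<le> s \<Longrightarrow> s \<le> t \<Longrightarrow> \<bar>Y s w\<bar> \<le> B"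
    and t: "0 < t"
    and theta: "\<And>w. w \<in> space path_space \<Longrightarrow> 0 \<le> \<theta> w \<and> \<theta> w \<le> t"
    and stop: "\<And>q. 0 \<le> q \<Longrightarrow> q < t \<Longrightarrow>
        {w \<in> space path_space. \<theta> w \<le> q} \<in> sets (canonical_filtration q)"
  shows "integrable N (\<lambda>w. Y (\<theta> w) w)" "(\<integral>w. Y (\<theta> w) w \<partial>N) = (\<integral>w. Y 0 w \<partial>N)"
proof -
  interpret N: prob_space N by fact
  have sp: "space N = space path_space" by (rule sets_eq_imp_space_eq[OF N(2)])
  have sub: "subalgebra N (canonical_filtration s)" for s
    using sets_canonical_filtration_subset[of s] by (simp add: subalgebra_def sp N(2))
  have Ym: "Y s \<in> borel_measurable (canonical_filtration s)" and Yi: "integrable N (Y s)"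
    if "0 \<le> s" for s using Y that unfolding martingale_def by auto
  have cond: "(\<integral>w\<in>A. Y s w \<partial>N) = (\<integral>w\<in>A. Y r w \<partial>N)"
    if "0 \<le> r" "r \<le> s" "A \<in> sets (canonical_filtration r)" for A r s
  proof -
    interpret finite_measure_subalgebra N "canonical_filtration r"
      using sub by unfold_locales
    have "(\<integral>w\<in>A. Y s w \<partial>N) = (\<integral>w\<in>A. real_cond_exp N (canonical_filtration r) (Y s) w \<partial>N)"
      using that Yi[of s] by (intro real_cond_exp_intA) auto
    also have "\<dots> = (\<integral>w\<in>A. Y r w \<partial>N)"
    proof (rule set_lebesgue_integral_cong_AE)
      show "A \<in> sets N" using that(3) sub by (auto simp: subalgebra_def)
      show "AE x\<in>A in N. real_cond_exp N (canonical_filtration r) (Y s) x = Y r x"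
      proof -
        have "AE x in N. real_cond_exp N (canonical_filtration r) (Y s) x = Y r x"
          using Y that unfolding martingale_def by blast
        then show ?thesis by eventually_elim simp
      qed
    qed (use Yi[of r] that in auto)
    finally show ?thesis .
  qed
  define grid where "grid n k = t * real k / real (Suc n)" for n k
  define \<kappa> where "\<kappa> n w = nat \<lceil>\<theta> w * real (Suc n) / t\<rceil>" for n w
  have kle: "\<kappa> n w \<le> k \<longleftrightarrow> \<theta> w \<le> grid n k" for n k w
    using t by (simp add: \<kappa>_def grid_def nat_le_iff ceiling_le_iff field_simps)
  have kSuc: "\<kappa> n w \<le> Suc n" if "w \<in> space path_space" for n w
    using theta[OF that] kle[of n w "Suc n"] by (simp add: grid_def)
  have ev: "{w \<in> space path_space. \<kappa> n w \<le> k} \<in> sets (canonical_filtration (grid n k))" for n k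
  proof (cases "k < Suc n")
    case True
    then have "real k < real (Suc n)" by (simp only: of_nat_less_iff)
    from mult_strict_left_mono[OF this t] have "grid n k < t"
      unfolding grid_def by (subst pos_divide_less_eq) (rule of_nat_0_less_iff[THEN iffD2], rule zero_less_Suc)
    moreover have "0 \<le> grid n k" using t unfolding grid_def by (intro divide_nonneg_nonneg mult_nonneg_nonneg) auto
    ultimately show ?thesis unfolding kle by (rule stop[rotated])
  next
    \<comment> \<open>\<open>stop\<close> covers only times before \<open>t\<close>; for the last
      grid point \<open>t\<close> and beyond the event is all of path space.\<close>
    case False
    then have "{w \<in> space path_space. \<kappa> n w \<le> k} = space (canonical_filtration (grid n k))"
      using kSuc[THEN le_trans, of _ n k] by (intro equalityI subsetI) auto
    then show ?thesis by (metis sets.top)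
  qed
  have ev_eq: "{w \<in> space path_space. \<kappa> n w = k} \<in> sets (canonical_filtration (grid n k))" for n k
  proof (cases k)
    case 0
    then show ?thesis using ev[of n 0] by simp
  next
    case (Suc j)
    have "{w \<in> space path_space. \<kappa> n w \<le> j} \<in> sets (canonical_filtration (grid n k))"
      using ev[of n j] sets_canonical_filtration_mono[of "grid n j" "grid n k"] t Suc
      by (auto simp: grid_def divide_right_mono)
    moreover have "{w \<in> space path_space. \<kappa> n w = k} =
        {w \<in> space path_space. \<kappa> n w \<le> k} - {w \<in> space path_space. \<kappa> n w \<le> j}"
      using Suc by auto
    ultimately show ?thesis using ev[of n k] by auto
  qed
  define Z where "Z n w = Y (grid n (\<kappa> n w)) w" for n w
  define S where "S n k = {w \<in> space path_space. \<kappa> n w = k}" for n k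
  have SN: "S n k \<in> sets N" for n k
    unfolding S_def using ev_eq[of n k] sub by (auto simp: subalgebra_def)
  have Zsum: "Z n w = (\<Sum>k\<le>Suc n. indicator (S n k) w * Y (grid n k) w)"
    if w: "w \<in> space path_space" for n w
  proof -
    have "(\<Sum>k\<le>Suc n. indicator (S n k) w * Y (grid n k) w) =
        (\<Sum>k\<le>Suc n. if k = \<kappa> n w then Y (grid n k) w else 0)"
      using w by (intro sum.cong) (auto simp: S_def indicator_def)
    also have "\<dots> = Z n w" using kSuc[OF w, of n] by (subst sum.delta) (auto simp: Z_def)
    finally show ?thesis by simp
  qed
  have grid0: "0 \<le> grid n k" for n k using t by (simp add: grid_def)
  have gridt: "grid n k \<le> t" if "k \<le> Suc n" for n k
  proof -
    have "t * real k \<le> t * real (Suc n)" using t that by (intro mult_left_mono) auto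
    then show ?thesis unfolding grid_def by (subst pos_divide_le_eq) auto
  qed
  have Zi: "integrable N (Z n)" for n
  proof -
    have "integrable N (\<lambda>w. \<Sum>k\<le>Suc n. indicator (S n k) w * Y (grid n k) w)"
      using integrable_mult_indicator[OF SN Yi[OF grid0]] by (intro Bochner_Integration.integrable_sum) auto
    then show ?thesis
      by (subst Bochner_Integration.integrable_cong[OF refl Zsum]) (auto simp: sp)
  qed
  have Zint: "(\<integral>w. Z n w \<partial>N) = (\<integral>w. Y 0 w \<partial>N)" for n
  proof -
    have "(\<integral>w. Z n w \<partial>N) = (\<integral>w. (\<Sum>k\<le>Suc n. indicator (S n k) w * Y (grid n k) w) \<partial>N)"
      by (intro Bochner_Integration.integral_cong) (auto simp: sp Zsum)
    also have "\<dots> = (\<Sum>k\<le>Suc n. (\<integral>w. indicator (S n k) w * Y (grid n k) w \<partial>N))"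
      using integrable_mult_indicator[OF SN Yi[OF grid0]] by (intro Bochner_Integration.integral_sum) auto
    \<comment> \<open>The event \<open>\<kappa> n w = k\<close> is known at time
      \<open>grid n k\<close>, so the martingale property replaces \<open>Y (grid n k)\<close> by
      \<open>Y t\<close> on it. The pieces then add up to \<open>Y t\<close>.\<close>
    also have "\<dots> = (\<Sum>k\<le>Suc n. (\<integral>w. indicator (S n k) w * Y t w \<partial>N))"
    proof (intro sum.cong refl)
      fix k assume "k \<in> {..Suc n}"
      then show "(\<integral>w. indicator (S n k) w * Y (grid n k) w \<partial>N) = (\<integral>w. indicator (S n k) w * Y t w \<partial>N)"
        using cond[of "grid n k" t "S n k"] ev_eq[of n k] grid0[of n k] gridt[of k n]
        by (simp add: S_def set_lebesgue_integral_def)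
    qed
    also have "\<dots> = (\<integral>w. (\<Sum>k\<le>Suc n. indicator (S n k) w * Y t w) \<partial>N)"
      using integrable_mult_indicator[OF SN Yi[of t]] t by (intro Bochner_Integration.integral_sum[symmetric]) auto
    also have "\<dots> = (\<integral>w. Y t w \<partial>N)"
    proof (intro Bochner_Integration.integral_cong refl)
      fix w assume "w \<in> space N"
      then have w: "w \<in> space path_space" by (simp add: sp)
      have "(\<Sum>k\<le>Suc n. indicator (S n k) w * Y t w) =
          (\<Sum>k\<le>Suc n. if k = \<kappa> n w then Y t w else 0)"
        using w by (intro sum.cong) (auto simp: S_def indicator_def)
      also have "\<dots> = Y t w" using kSuc[OF w, of n] by (subst sum.delta) auto
      finally show "(\<Sum>k\<le>Suc n. indicator (S n k) w * Y t w) = Y t w" .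
    qed
    also have "\<dots> = (\<integral>w. Y 0 w \<partial>N)"
      using cond[of 0 t "space path_space"] t sets.top[of "canonical_filtration 0"] Yi[of t] Yi[of 0]
      by (simp add: sp[symmetric] set_integral_space)
    finally show ?thesis .
  qed
  have lim: "(\<lambda>n. Z n w) \<longlonglongrightarrow> Y (\<theta> w) w" if w: "w \<in> space path_space" for w
  proof -
    have th: "0 \<le> \<theta> w" "\<theta> w \<le> t" using theta[OF w] by auto
    have "(\<lambda>n. grid n (\<kappa> n w)) \<longlonglongrightarrow> \<theta> w"
    proof (rule tendsto_sandwich)
      show "\<forall>\<^sub>F n in sequentially. \<theta> w \<le> grid n (\<kappa> n w)"
        using kle by (intro always_eventually allI) blast
      show "\<forall>\<^sub>F n in sequentially. grid n (\<kappa> n w) \<le> \<theta> w + t / real (Suc n)"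
      proof (intro always_eventually allI)
        fix n
        have "0 \<le> \<theta> w * real (Suc n) / t" using th t by simp
        then have "real (\<kappa> n w) \<le> \<theta> w * real (Suc n) / t + 1"
          unfolding \<kappa>_def by (simp add: of_nat_nat)
        then have "t * real (\<kappa> n w) / real (Suc n) \<le> t * (\<theta> w * real (Suc n) / t + 1) / real (Suc n)"
          using t by (intro divide_right_mono mult_left_mono) auto
        also have "\<dots> = \<theta> w + t / real (Suc n)"
        proof -
          have "t * (x * m / t + 1) / m = x + t / m" if "m > 0" for x m :: real
            using t that by (simp add: field_simps)
          then show ?thesis by simp
        qed
        finally show "grid n (\<kappa> n w) \<le> \<theta> w + t / real (Suc n)" by (simp add: grid_def)
      qed
      have "(\<lambda>n. \<theta> w + t * inverse (real (Suc n))) \<longlonglongrightarrow> \<theta> w + t * 0"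
        by (intro tendsto_intros LIMSEQ_inverse_real_of_nat)
      then show "(\<lambda>n. \<theta> w + t / real (Suc n)) \<longlonglongrightarrow> \<theta> w" by (simp add: divide_inverse)
    qed simp
    moreover have "grid n (\<kappa> n w) \<in> {0..t}" for n using grid0 gridt[OF kSuc[OF w]] by auto
    ultimately show ?thesis
      unfolding Z_def using cont[OF w] th unfolding continuous_on_sequentially comp_def by auto
  qed
  have Zb: "AE w in N. norm (Z n w) \<le> B" for n
    using bound grid0 gridt kSuc by (auto simp: Z_def sp)
  have AElim: "AE w in N. (\<lambda>n. Z n w) \<longlonglongrightarrow> Y (\<theta> w) w" using lim by (auto simp: sp)
  have meas: "(\<lambda>w. Y (\<theta> w) w) \<in> borel_measurable N"
    by (rule borel_measurable_LIMSEQ_real[of N Z]) (use lim Zi in \<open>auto simp: sp\<close>)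
  show "integrable N (\<lambda>w. Y (\<theta> w) w)"
    by (rule integrable_dominated_convergence[where w="\<lambda>_. B" and s=Z])
       (use meas Zi AElim Zb in auto)
  have "(\<lambda>n. \<integral>w. Z n w \<partial>N) \<longlonglongrightarrow> (\<integral>w. Y (\<theta> w) w \<partial>N)"
    by (rule integral_dominated_convergence[where w="\<lambda>_. B"])
       (use meas Zi AElim Zb in auto)
  then show "(\<integral>w. Y (\<theta> w) w \<partial>N) = (\<integral>w. Y 0 w \<partial>N)"
    unfolding Zint by (simp add: LIMSEQ_const_iff)
qed

subsection \<open>Primitives and compactly supported test functions\<close>

definition primitive :: "(real \<Rightarrow> real) \<Rightarrow> real \<Rightarrow> real" where
  "primitive f y = (LBINT x=0..y. f x)"

lemma primitive_0 [simp]: "primitive f 0 = 0"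
  by (simp add: primitive_def zero_ereal_def[symmetric])

lemma primitive_nonneg_arg: "0 \<le> y \<Longrightarrow> primitive f y = (LBINT x:{0..y}. f x)"
  unfolding primitive_def by (simp add: zero_ereal_def interval_integral_Icc)

lemma primitive_nonpos_arg: "y \<le> 0 \<Longrightarrow> primitive f y = - (LBINT x:{y..0}. f x)"
  unfolding primitive_def
  by (subst interval_integral_endpoints_reverse) (simp add: zero_ereal_def interval_integral_Icc)

lemma DERIV_primitive:
  assumes "continuous_on UNIV f"
  shows "(primitive f has_real_derivative f y) (at y)"
proof -
  \<comment> \<open>The interval must contain \<open>0\<close> and \<open>y\<close>; the margin
    \<open>1\<close> makes \<open>y\<close> an interior point, so that the derivative within the
    interval is the full derivative.\<close>
  let ?a = "min 0 y - 1" and ?b = "max 0 y + 1"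
  have "((\<lambda>u. LBINT x=0..u. f x) has_vector_derivative f y) (at y within {?a..?b})"
    unfolding zero_ereal_def
    by (rule interval_integral_FTC2) (use assms continuous_on_subset in auto)
  then have "(primitive f has_real_derivative f y) (at y within {?a..?b})"
    by (simp add: primitive_def[abs_def] has_real_derivative_iff_has_vector_derivative)
  moreover have "at y within {?a..?b} = at y" by (rule at_within_interior) auto
  ultimately show ?thesis by simp
qed

lemma continuous_on_primitive: "continuous_on UNIV f \<Longrightarrow> continuous_on UNIV (primitive f)"
  using DERIV_primitive DERIV_continuous_on by (metis has_field_derivative_at_within)

text \<open>A truncated cube is twice continuously differentiable; the cases \<open>n = 1\<close>
  and \<open>n = 0\<close> give its two derivatives.\<close>

lemma DERIV_max_power:
  "((\<lambda>x::real. max 0 x ^ (n + 2)) has_real_derivative real (n + 2) * max 0 x ^ (n + 1)) (at x)"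
proof -
  consider "x > 0" | "x < 0" | "x = 0" by linarith
  then show ?thesis
  proof cases
    case 1
    have "((\<lambda>x::real. x ^ (n + 2)) has_real_derivative real (n + 2) * x ^ (n + 1)) (at x)"
      by (rule DERIV_cong[OF DERIV_pow]) simp
    then show ?thesis
      by (rule has_field_derivative_transform_within_open[of _ _ _ "{0<..}", THEN DERIV_cong])
         (use 1 in auto)
  next
    case 2
    have "((\<lambda>x::real. 0) has_real_derivative 0) (at x)" by simp
    then show ?thesis
      by (rule has_field_derivative_transform_within_open[of _ _ _ "{..<0}", THEN DERIV_cong])
         (use 2 in auto)
  next
    case 3
    have "((\<lambda>y::real. max 0 y ^ (n + 1)) \<longlongrightarrow> max 0 0 ^ (n + 1)) (at 0)" by (intro tendsto_intros)
    then have "((\<lambda>y::real. max 0 y ^ (n + 1)) \<longlongrightarrow> 0) (at 0)" by simp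
    then have "((\<lambda>y::real. max 0 y ^ (n + 2) / y) \<longlongrightarrow> 0) (at 0)"
      by (rule Lim_null_comparison[rotated])
         (auto simp: eventually_at_filter max_def abs_mult)
    then show ?thesis using 3 by (simp add: has_field_derivative_iff)
  qed
qed

text \<open>A piecewise polynomial cutoff is smooth enough. With the truncated cube
  \<open>p\<close>, the composition \<open>q x = p (1 - p x)\<close> descends from \<open>1\<close>
  for \<open>x \<le> 0\<close> to \<open>0\<close> for \<open>x \<ge> 1\<close>; the cutoff is the
  product of a reflected copy placed at \<open>u\<close> and a copy placed at
  \<open>v\<close>.\<close>

lemma cutoff_exists:
  fixes u v :: real
  assumes "u \<le> v"
  obtains \<eta> \<eta>' \<eta>'' :: "real \<Rightarrow> real"
  where "\<And>x. (\<eta> has_real_derivative \<eta>' x) (at x)" "\<And>x. (\<eta>' has_real_derivative \<eta>'' x) (at x)"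
    "continuous_on UNIV \<eta>''"
    "\<And>x. u \<le> x \<Longrightarrow> x \<le> v \<Longrightarrow> \<eta> x = 1 \<and> \<eta>' x = 0 \<and> \<eta>'' x = 0"
    "\<And>x. x < u - 1 \<or> x > v + 1 \<Longrightarrow> \<eta> x = 0 \<and> \<eta>' x = 0 \<and> \<eta>'' x = 0"
proof -
  define p p1 p2 where "p = (\<lambda>x::real. max 0 x ^ 3)" and "p1 = (\<lambda>x::real. 3 * max 0 x ^ 2)"
    and "p2 = (\<lambda>x::real. 6 * max 0 x)"
  have p: "(p has_real_derivative p1 x) (at x)" for x
    using DERIV_max_power[of 1 x] by (simp add: p_def p1_def numeral_3_eq_3 numeral_2_eq_2)
  have p1: "(p1 has_real_derivative p2 x) (at x)" for x
    using DERIV_cmult[OF DERIV_max_power[of 0 x], of 3] by (simp add: p1_def p2_def numeral_2_eq_2)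
  have c: "continuous_on A p" "continuous_on A p1" "continuous_on A p2" for A
    unfolding p_def p1_def p2_def by (intro continuous_intros)+
  have P0: "p x = 0" "p1 x = 0" "p2 x = 0" if "x \<le> 0" for x
    using that by (auto simp: p_def p1_def p2_def max_def)
  have P1: "1 - p x \<le> 0" if "x \<ge> 1" for x
    using that by (auto simp: p_def max_def one_le_power)
  have P11: "p 1 = 1" by (simp add: p_def)
  define q q1 q2 where "q = (\<lambda>x. p (1 - p x))" and "q1 = (\<lambda>x. - p1 (1 - p x) * p1 x)"
    and "q2 = (\<lambda>x. p2 (1 - p x) * p1 x * p1 x - p1 (1 - p x) * p2 x)"
  have q: "(q has_real_derivative q1 x) (at x)" for x
    unfolding q_def q1_def
    by (rule DERIV_cong, rule DERIV_chain2[OF p], rule DERIV_diff[OF DERIV_const p]) simp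
  have p1p: "((\<lambda>x. p1 (1 - p x)) has_real_derivative - p2 (1 - p x) * p1 x) (at x)" for x
    by (rule DERIV_cong, rule DERIV_chain2[OF p1], rule DERIV_diff[OF DERIV_const p]) simp
  have q1: "(q1 has_real_derivative q2 x) (at x)" for x
    unfolding q1_def q2_def
    by (rule DERIV_cong, rule DERIV_mult[OF DERIV_minus[OF p1p] p1]) (simp add: algebra_simps)
  have cc: "continuous_on UNIV (\<lambda>x. p2 (1 - p x))" "continuous_on UNIV (\<lambda>x. p1 (1 - p x))"
    by (rule continuous_on_compose2[OF c(3)[of UNIV]] continuous_on_compose2[OF c(2)[of UNIV]],
        intro continuous_intros c, simp)+
  have cq2: "continuous_on UNIV q2"
    unfolding q2_def by (intro continuous_intros cc c)
  have cq: "continuous_on UNIV q" "continuous_on UNIV q1"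
    using q q1 DERIV_continuous_on by (metis has_field_derivative_at_within)+
  have Q0: "q x = 1" "q1 x = 0" "q2 x = 0" if "x \<le> 0" for x
    using P0[OF that] P11 by (auto simp: q_def q1_def q2_def)
  have Q1: "q x = 0" "q1 x = 0" "q2 x = 0" if "x \<ge> 1" for x
    using P0[OF P1[OF that]] by (auto simp: q_def q1_def q2_def)
  define f f1 f2 where "f = (\<lambda>x. q (u - x))" and "f1 = (\<lambda>x. - q1 (u - x))" and "f2 = (\<lambda>x. q2 (u - x))"
  define g g1 g2 where "g = (\<lambda>x. q (x - v))" and "g1 = (\<lambda>x. q1 (x - v))" and "g2 = (\<lambda>x. q2 (x - v))"
  have f: "(f has_real_derivative f1 x) (at x)" for x
    unfolding f_def f1_def
    by (rule DERIV_cong, rule DERIV_chain2[OF q], rule DERIV_diff[OF DERIV_const DERIV_ident]) simp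
  have f1: "(f1 has_real_derivative f2 x) (at x)" for x
    unfolding f1_def f2_def
    by (rule DERIV_cong, rule DERIV_minus, rule DERIV_chain2[OF q1],
        rule DERIV_diff[OF DERIV_const DERIV_ident]) simp
  have g: "(g has_real_derivative g1 x) (at x)" for x
    unfolding g_def g1_def
    by (rule DERIV_cong, rule DERIV_chain2[OF q], rule DERIV_diff[OF DERIV_ident DERIV_const]) simp
  have g1: "(g1 has_real_derivative g2 x) (at x)" for x
    unfolding g1_def g2_def
    by (rule DERIV_cong, rule DERIV_chain2[OF q1], rule DERIV_diff[OF DERIV_ident DERIV_const]) simp
  have cfg: "continuous_on UNIV f" "continuous_on UNIV g" "continuous_on UNIV f1"
      "continuous_on UNIV g1"
    using f f1 g g1 DERIV_continuous_on by (metis has_field_derivative_at_within)+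
  have cfg2: "continuous_on UNIV f2" "continuous_on UNIV g2"
    unfolding f2_def g2_def
    by (rule continuous_on_compose2[OF cq2], intro continuous_intros, simp)+
  show thesis
  proof (rule that[of "\<lambda>x. f x * g x" "\<lambda>x. f1 x * g x + f x * g1 x"
        "\<lambda>x. f2 x * g x + 2 * f1 x * g1 x + f x * g2 x"])
    show "((\<lambda>x. f x * g x) has_real_derivative f1 x * g x + f x * g1 x) (at x)" for x
      by (rule DERIV_cong, rule DERIV_mult[OF f g]) simp
    show "((\<lambda>x. f1 x * g x + f x * g1 x) has_real_derivative
        f2 x * g x + 2 * f1 x * g1 x + f x * g2 x) (at x)" for x
      by (rule DERIV_cong, rule DERIV_add[OF DERIV_mult[OF f1 g] DERIV_mult[OF f g1]]) simp
    show "continuous_on UNIV (\<lambda>x. f2 x * g x + 2 * f1 x * g1 x + f x * g2 x)"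
      by (intro continuous_intros cfg cfg2)
  qed (auto simp: f_def f1_def f2_def g_def g1_def g2_def Q0 Q1)
qed

lemma C2_compact_supportI:
  assumes 1: "\<And>x. (f has_real_derivative f' x) (at x)" and 2: "\<And>x. (f' has_real_derivative f'' x) (at x)"
    and 3: "continuous_on UNIV f''" and 4: "\<And>x. x < A \<or> x > B \<Longrightarrow> f x = 0"
  shows "C2_compact_support f" "deriv f = f'" "deriv (deriv f) = f''"
proof -
  show d: "deriv f = f'" using 1 DERIV_imp_deriv by blast
  show d2: "deriv (deriv f) = f''" unfolding d using 2 DERIV_imp_deriv by blast
  have "{x. f x \<noteq> 0} \<subseteq> {A..B}" using 4 by force
  then have "compact (closure {x. f x \<noteq> 0})"
    using bounded_subset[OF bounded_closed_interval] by (simp add: compact_closure)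
  then show "C2_compact_support f"
    unfolding C2_compact_support_def d2 unfolding d using 1 2 3 by (auto simp: field_differentiable_def)
qed

lemma bounded_of_compact_support:
  fixes f :: "real \<Rightarrow> real"
  assumes "continuous_on UNIV f" "\<And>x. x < A \<or> x > B \<Longrightarrow> f x = 0"
  obtains C where "0 < C" "\<And>x. \<bar>f x\<bar> \<le> C"
proof -
  have "bounded (f ` {A..B})"
    using assms(1) continuous_on_subset by (intro compact_imp_bounded compact_continuous_image) auto
  then obtain C where C: "C > 0" "\<And>x. x \<in> {A..B} \<Longrightarrow> \<bar>f x\<bar> \<le> C"
    by (auto simp: bounded_pos)
  moreover have "\<bar>f x\<bar> \<le> C" for x
    using C assms(2)[of x] by (cases "x \<in> {A..B}") auto
  ultimately show thesis using that by blast
qed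

text \<open>The scale function and exponentials lack compact support, but the stopped paths stay in
  \<open>{u..v}\<close>. The cutoff is \<open>1\<close> with vanishing derivatives on all of
  \<open>{u..v}\<close>, endpoints included, so function and generator are unchanged there. The
  common bound \<open>B\<close> serves the limits in \<open>t\<close>.\<close>

lemma test_function_exists:
  fixes \<alpha> \<beta> \<phi> :: "real \<Rightarrow> real"
  assumes \<alpha>: "continuous_on UNIV \<alpha>" and \<beta>: "continuous_on UNIV \<beta>" and "u \<le> v"
    and 1: "\<And>x. (\<phi> has_real_derivative \<phi>' x) (at x)" and 2: "\<And>x. (\<phi>' has_real_derivative \<phi>'' x) (at x)"
    and 3: "continuous_on UNIV \<phi>''"
  obtains f B where "C2_compact_support f" "continuous_on UNIV f" "continuous_on UNIV (generator \<alpha> \<beta> f)"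
    "0 < B" "\<forall>x. \<bar>f x\<bar> \<le> B" "\<forall>x. \<bar>generator \<alpha> \<beta> f x\<bar> \<le> B"
    "\<forall>x\<in>{u..v}. f x = \<phi> x \<and> generator \<alpha> \<beta> f x = 1/2 * \<alpha> x * \<phi>'' x + \<beta> x * \<phi>' x"
proof -
  obtain \<eta> \<eta>' \<eta>'' where chi: "\<And>x. (\<eta> has_real_derivative \<eta>' x) (at x)" "\<And>x. (\<eta>' has_real_derivative \<eta>'' x) (at x)"
    "continuous_on UNIV \<eta>''"
    "\<And>x. u \<le> x \<Longrightarrow> x \<le> v \<Longrightarrow> \<eta> x = 1 \<and> \<eta>' x = 0 \<and> \<eta>'' x = 0"
    "\<And>x. x < u - 1 \<or> x > v + 1 \<Longrightarrow> \<eta> x = 0 \<and> \<eta>' x = 0 \<and> \<eta>'' x = 0"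
    using cutoff_exists[OF \<open>u \<le> v\<close>] by metis
  define f f' f'' where "f = (\<lambda>x. \<phi> x * \<eta> x)" and "f' = (\<lambda>x. \<phi>' x * \<eta> x + \<phi> x * \<eta>' x)"
    and "f'' = (\<lambda>x. \<phi>'' x * \<eta> x + 2 * \<phi>' x * \<eta>' x + \<phi> x * \<eta>'' x)"
  have f: "(f has_real_derivative f' x) (at x)" for x
    unfolding f_def f'_def by (rule DERIV_cong, rule DERIV_mult[OF 1 chi(1)]) simp
  have f': "(f' has_real_derivative f'' x) (at x)" for x
    unfolding f''_def f'_def
    by (rule DERIV_cong, rule DERIV_add[OF DERIV_mult[OF 2 chi(1)] DERIV_mult[OF 1 chi(2)]]) simp
  have cont: "continuous_on UNIV \<phi>" "continuous_on UNIV \<phi>'" "continuous_on UNIV \<eta>"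
      "continuous_on UNIV \<eta>'" "continuous_on UNIV f" "continuous_on UNIV f'"
    using 1 2 chi(1,2) f f' DERIV_continuous_on by (metis has_field_derivative_at_within)+
  have cf'': "continuous_on UNIV f''" unfolding f''_def by (intro continuous_intros cont 3 chi)
  have z: "f x = 0" "f' x = 0" "f'' x = 0" if "x < u - 1 \<or> x > v + 1" for x
    using chi(5)[OF that] by (auto simp: f_def f'_def f''_def)
  note C = C2_compact_supportI[OF f f' cf'' z(1)]
  have G: "generator \<alpha> \<beta> f x = 1/2 * \<alpha> x * f'' x + \<beta> x * f' x" for x
    unfolding generator_def using C(2,3) by simp
  have cG: "continuous_on UNIV (generator \<alpha> \<beta> f)"
    unfolding G[abs_def] by (intro continuous_intros \<alpha> \<beta> cont cf'')
  obtain B1 where B1: "0 < B1" "\<And>x. \<bar>f x\<bar> \<le> B1"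
    using bounded_of_compact_support[OF cont(5) z(1)] by metis
  have "generator \<alpha> \<beta> f x = 0" if "x < u - 1 \<or> x > v + 1" for x
    using z[OF that] by (simp add: G)
  then obtain B2 where B2: "0 < B2" "\<And>x. \<bar>generator \<alpha> \<beta> f x\<bar> \<le> B2"
    using bounded_of_compact_support[OF cG] by metis
  show thesis
  proof (rule that[OF C(1) cont(5) cG])
    show "0 < max B1 B2" "\<forall>x. \<bar>f x\<bar> \<le> max B1 B2" "\<forall>x. \<bar>generator \<alpha> \<beta> f x\<bar> \<le> max B1 B2"
      using B1 B2 by (auto simp: le_max_iff_disj)
    show "\<forall>x\<in>{u..v}. f x = \<phi> x \<and> generator \<alpha> \<beta> f x = 1/2 * \<alpha> x * \<phi>'' x + \<beta> x * \<phi>' x"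
      using chi(4) unfolding G by (simp add: f_def f'_def f''_def)
  qed
qed

subsection \<open>Visits of a path to closed sets\<close>

text \<open>Imposing \<open>w q < v\<close> from time \<open>0\<close> rather than from the first
  passage to \<open>y\<close> makes no difference for a path that starts at or below
  \<open>y < v\<close>, and it avoids naming a random time.\<close>

definition returns :: "real \<Rightarrow> real \<Rightarrow> real \<Rightarrow> (real \<Rightarrow> real) \<Rightarrow> bool" where
  "returns y u v w \<longleftrightarrow> (\<exists>s. reached y {..u} w s \<and> (\<forall>q. 0 \<le> q \<and> q \<le> s \<longrightarrow> w q < v))"

lemma path_IVT:
  assumes w: "w \<in> space path_space" and "0 \<le> r" "r \<le> s" "w r \<le> y \<and> y \<le> w s \<or> w s \<le> y \<and> y \<le> w r"
  obtains q where "r \<le> q" "q \<le> s" "w q = y"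
proof -
  have c: "continuous_on {r..s} w"
    using path_continuous[OF w] continuous_on_subset assms(2) by fastforce
  from assms(4) show thesis
  proof
    assume "w r \<le> y \<and> y \<le> w s"
    then show ?thesis using IVT'[of w r y s] c assms(3) that by blast
  next
    assume "w s \<le> y \<and> y \<le> w r"
    then show ?thesis using IVT2'[of w s y r] c assms(3) that by blast
  qed
qed

lemma path_bounded:
  assumes w: "w \<in> space path_space"
  obtains B where "\<And>q. 0 \<le> q \<Longrightarrow> q \<le> s \<Longrightarrow> \<bar>w q\<bar> \<le> B"
proof -
  have "continuous_on {0..s} w"
    using path_continuous[OF w] continuous_on_subset by fastforce
  then have "bounded (w ` {0..s})" by (intro compact_imp_bounded compact_continuous_image) auto
  then obtain B where "\<And>x. x \<in> w ` {0..s} \<Longrightarrow> \<bar>x\<bar> \<le> B" by (auto simp: bounded_iff)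
  then have "\<bar>w q\<bar> \<le> B" if "0 \<le> q" "q \<le> s" for q using that by auto
  then show thesis using that by blast
qed

lemma reached_UNIV_iff: "reached y UNIV w s \<longleftrightarrow> 0 \<le> s \<and> (\<exists>r. 0 \<le> r \<and> r \<le> s \<and> y \<le> w r)"
  by (simp add: reached_def)

lemma reached_mono: "reached y C w s \<Longrightarrow> C \<subseteq> D \<Longrightarrow> reached y D w s"
  by (auto simp: reached_def)

lemma visit_time_mono:
  assumes "C \<subseteq> D"
  shows "visit_time y D t w \<le> visit_time y C t w"
  unfolding visit_time_def
  by (rule cInf_superset_mono) (use assms bdd_below_reached reached_mono in auto)

text \<open>\<open>visit_time\<close> only records that the path has been at or above
  \<open>y\<close>; the start at or below \<open>y\<close> and continuity make the value exactly
  \<open>y\<close>.\<close>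

lemma first_visit_value:
  assumes w: "w \<in> space path_space" and "w 0 \<le> y" "reached y UNIV w t"
  shows "w (visit_time y UNIV t w) = y"
proof -
  let ?s = "visit_time y UNIV t w"
  have r: "reached y UNIV w ?s"
    by (rule visit_time_reached[OF closed_UNIV w _ assms(3)]) simp
  then obtain r where r: "0 \<le> r" "r \<le> ?s" "y \<le> w r" by (auto simp: reached_UNIV_iff)
  obtain q where q: "0 \<le> q" "q \<le> r" "w q = y"
    using path_IVT[OF w order_refl r(1), of y] assms(2) r(3) by blast
  have "q \<le> t" using q r visit_time_le[of y UNIV t w] by linarith
  moreover have "reached y UNIV w q" using q by (auto simp: reached_UNIV_iff)
  ultimately have "?s \<le> q" by (rule visit_time_lower)
  with q r show ?thesis by (metis order_antisym order_trans)
qed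

lemma before_first_visit:
  assumes "0 \<le> q" "q < visit_time y UNIV t w"
  shows "w q < y"
proof (rule ccontr)
  assume "\<not> w q < y"
  then have "reached y UNIV w q" using assms(1) by (auto simp: reached_UNIV_iff)
  moreover have "q \<le> t" using assms(2) visit_time_le[of y UNIV t w] by linarith
  ultimately have "visit_time y UNIV t w \<le> q" by (intro visit_time_lower)
  with assms(2) show False by simp
qed

context
  fixes y u v :: real and w :: "real \<Rightarrow> real" and C :: "real set"
  assumes w: "w \<in> space path_space" and w0: "w 0 \<le> y" and uy: "u < y" and yv: "y < v"
    and C_eq: "C = {..u} \<union> {v..}"
begin

lemma closed_C: "closed C" unfolding C_eq by (intro closed_Un closed_atMost closed_atLeast)

lemma after_first_visit:
  assumes "reached y UNIV w t" "visit_time y UNIV t w \<le> s" "s < visit_time y C t w"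
  shows "u < w s \<and> w s < v"
proof -
  have "s \<le> t" using assms(3) visit_time_le[of y C t w] by linarith
  then have "\<not> reached y C w s" using visit_time_lower[of s t y C w] assms(3) by linarith
  moreover have "reached y UNIV w s"
    using visit_time_reached[OF closed_UNIV w order_refl assms(1)] assms(2)
    unfolding reached_UNIV_iff by (meson order_trans)
  ultimately show ?thesis by (auto simp: reached_def C_eq)
qed

text \<open>Strictly before the visit to \<open>C\<close> the path is in the open interval. At the
  visit itself continuity excludes a value beyond \<open>u\<close> or \<open>v\<close>: that
  boundary point would have been attained earlier.\<close>

lemma between_visits:
  assumes "reached y UNIV w t" "visit_time y UNIV t w \<le> s" "s \<le> visit_time y C t w"
  shows "u \<le> w s \<and> w s \<le> v"
proof (cases "s < visit_time y C t w")
  case True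
  with after_first_visit[OF assms(1,2)] show ?thesis by auto
next
  case False
  let ?r = "visit_time y UNIV t w"
  have s: "s = visit_time y C t w" using False assms(3) by simp
  have wr: "w ?r = y" by (rule first_visit_value[OF w w0 assms(1)])
  have r0: "0 \<le> ?r" using assms(1) by (intro visit_time_nonneg) (simp add: reached_def)
  show ?thesis
  proof (rule ccontr)
    assume "\<not> ?thesis"
    then consider "w s < u" | "w s > v" by linarith
    then obtain q where q: "?r \<le> q" "q \<le> s" "w q = u \<or> w q = v" "w s \<noteq> w q"
    proof cases
      case 1
      then show ?thesis using path_IVT[OF w r0 assms(2), of u] uy wr that by (metis less_irrefl less_imp_le)
    next
      case 2
      then show ?thesis using path_IVT[OF w r0 assms(2), of v] yv wr that by (metis less_irrefl less_imp_le)
    qed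
    then have "q < s" by (cases "q = s") auto
    with after_first_visit[OF assms(1) q(1)] s q(3) show False by auto
  qed
qed

text \<open>Paths that have not reached \<open>y\<close> by time \<open>t\<close> contribute nothing
  to \<open>dynkin\<close>, because the two stopping times coincide.\<close>

lemma not_reached_visits:
  assumes "\<not> reached y UNIV w t"
  shows "visit_time y UNIV t w = t" "visit_time y C t w = t"
proof -
  have "\<not> reached y UNIV w s" if "s \<le> t" for s
    using assms that unfolding reached_UNIV_iff by (meson order_trans)
  then show "visit_time y UNIV t w = t" "visit_time y C t w = t"
    using reached_mono[of y C w _ UNIV] by (auto intro!: visit_time_eq)
qed

text \<open>The exit point is \<open>u\<close> or \<open>v\<close> by \<open>between_visits\<close>,
  and which one is decided by \<open>returns\<close>, an event that does not depend on the
  truncation \<open>t\<close>. This lets \<open>t\<close> tend to infinity later.\<close>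

lemma exit_value:
  assumes "reached y C w s" "s \<le> t"
  shows "w (visit_time y C t w) = (if returns y u v w then u else v)"
proof -
  let ?\<theta> = "visit_time y C t w"
  have R: "reached y UNIV w t"
    using assms unfolding reached_def by (auto intro: order_trans)
  have th: "reached y C w ?\<theta>" by (rule visit_time_reached[OF closed_C w assms(2,1)])
  have "u \<le> w ?\<theta> \<and> w ?\<theta> \<le> v"
    by (rule between_visits[OF R]) (auto intro: visit_time_mono)
  with th have or: "w ?\<theta> = u \<or> w ?\<theta> = v" by (auto simp: reached_def C_eq)
  have lt: "w q < v" if "0 \<le> q" "q < ?\<theta>" for q
  proof (cases "q < visit_time y UNIV t w")
    case True
    then show ?thesis using before_first_visit[OF that(1) True] yv by simp
  next
    case False
    then show ?thesis using after_first_visit[OF R _ that(2)] by simp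
  qed
  show ?thesis
  proof (cases "w ?\<theta> = u")
    case True
    then have "reached y {..u} w ?\<theta>" using th unfolding reached_def by simp
    moreover have "w q < v" if "0 \<le> q" "q \<le> ?\<theta>" for q
      using lt[of q] that True uy yv by (cases "q = ?\<theta>") auto
    ultimately have "returns y u v w" unfolding returns_def by blast
    with True show ?thesis by simp
  next
    case False
    with or have v: "w ?\<theta> = v" by simp
    have "\<not> returns y u v w"
    proof
      assume "returns y u v w"
      then obtain q where q: "reached y {..u} w q" "\<And>q'. 0 \<le> q' \<Longrightarrow> q' \<le> q \<Longrightarrow> w q' < v"
        by (auto simp: returns_def)
      have "0 \<le> ?\<theta>" using th by (simp add: reached_def)
      then have "q < ?\<theta>" using q(2)[of ?\<theta>] v by force
      moreover have "reached y C w q" using q(1) by (rule reached_mono) (auto simp: C_eq)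
      ultimately show False
        using visit_time_lower[of q t y C w] visit_time_le[of y C t w] by linarith
    qed
    with v show ?thesis by simp
  qed
qed

end

text \<open>A path stays below \<open>v\<close> a little longer than the time witnessing
  \<open>returns\<close>, so a rational time \<open>q\<close> can be placed there. The event becomes
  a countable union of differences of events covered by \<open>reached_by_sets\<close>.\<close>

lemma returns_sets [measurable]: "Measurable.pred path_space (returns y u v)"
proof -
  have R: "{w \<in> space path_space. \<exists>s\<le>q. reached y C w s} \<in> sets path_space"
    if "closed C" "C \<noteq> {}" for y q C
    using reached_by_sets[OF that] sets_canonical_filtration_subset by blast
  have "returns y u v w \<longleftrightarrow> (\<exists>q\<in>\<rat>. (\<exists>s\<le>q. reached y {..u} w s) \<and>
        \<not> (\<exists>s\<le>q. reached v UNIV w s))" if w: "w \<in> space path_space" for w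
  proof
    assume "returns y u v w"
    then obtain s where s: "reached y {..u} w s" "\<And>q. 0 \<le> q \<Longrightarrow> q \<le> s \<Longrightarrow> w q < v"
      by (auto simp: returns_def)
    have s0: "0 \<le> s" using s(1) by (simp add: reached_def)
    have "0 < v - w s" using s(2)[of s] s0 by simp
    then obtain d where d: "d > 0" "\<And>x. x \<in> {0..} \<Longrightarrow> dist x s < d \<Longrightarrow> dist (w x) (w s) < v - w s"
      using path_continuous[OF w] s0 unfolding continuous_on_iff by (metis atLeast_iff)
    obtain q where q: "q \<in> \<rat>" "s < q" "q < s + d" using Rats_dense_in_real[of s "s + d"] d(1) by auto
    have "w x < v" if "0 \<le> x" "x \<le> q" for x
    proof (cases "x \<le> s")
      case True
      then show ?thesis using s(2) that by simp
    next
      case False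
      then show ?thesis using d(2)[of x] that q by (auto simp: dist_real_def)
    qed
    then have "\<not> (\<exists>s\<le>q. reached v UNIV w s)"
      unfolding reached_UNIV_iff by (meson leD order_trans)
    then show "\<exists>q\<in>\<rat>. (\<exists>s\<le>q. reached y {..u} w s) \<and> \<not> (\<exists>s\<le>q. reached v UNIV w s)"
      using q s(1) by (meson less_imp_le)
  next
    assume "\<exists>q\<in>\<rat>. (\<exists>s\<le>q. reached y {..u} w s) \<and> \<not> (\<exists>s\<le>q. reached v UNIV w s)"
    then obtain q s where "s \<le> q" "reached y {..u} w s" "\<And>s. s \<le> q \<Longrightarrow> \<not> reached v UNIV w s"
      by blast
    then show "returns y u v w"
      unfolding returns_def reached_UNIV_iff by (intro exI[of _ s]) force
  qed
  then have "{w \<in> space path_space. returns y u v w} =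
     {w \<in> space path_space. \<exists>q\<in>\<rat>. (\<exists>s\<le>q. reached y {..u} w s) \<and> \<not> (\<exists>s\<le>q. reached v UNIV w s)}"
    by auto
  also have "\<dots> \<in> sets path_space"
    by (intro sets.sets_Collect_countable_Ex' sets.sets_Collect R countable_rat) auto
  finally show ?thesis by (simp add: pred_def)
qed

lemma ever_reached_sets [measurable]:
  assumes "closed C" "C \<noteq> {}"
  shows "Measurable.pred path_space (\<lambda>w. \<exists>s. reached y C w s)"
proof -
  have "(\<exists>s. reached y C w s) \<longleftrightarrow> (\<exists>n::nat. \<exists>s\<le>real n. reached y C w s)" for w
    by (meson real_arch_simple)
  moreover have "{w \<in> space path_space. \<exists>s\<le>real n. reached y C w s} \<in> sets path_space" for n
    using reached_by_sets[OF assms] sets_canonical_filtration_subset by blast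
  ultimately show ?thesis by (simp add: pred_def sets.sets_Collect_countable_Ex)
qed

section \<open>Hitting times of half-lines and measurability of path events\<close>

lemma closed_infimum:
  fixes A :: "real set"
  assumes "closed A" "A \<subseteq> {0..}" "A \<noteq> {}"
  obtains m where "m \<in> A" "Inf (ereal ` A) = ereal m" "\<And>t. t \<in> A \<Longrightarrow> m \<le> t"
proof -
  have bdd: "bdd_below A" using assms(2) by (intro bdd_belowI[of _ 0]) auto
  have m: "Inf A \<in> A" using assms bdd by (intro closed_contains_Inf)
  have le: "Inf A \<le> t" if "t \<in> A" for t using cInf_lower[OF that bdd] .
  have "Inf (ereal ` A) = ereal (Inf A)"
    by (rule antisym) (use m le in \<open>auto intro: Inf_lower Inf_greatest\<close>)
  with m le show thesis using that by blast
qed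

text \<open>Measurability concerns all paths, including those that do not start at \<open>0\<close>.
  A level \<open>- n\<close> below the start imposes no condition, so the union over
  \<open>n\<close> expresses events without a level; for a path from \<open>0\<close> the level
  \<open>0\<close> already does.\<close>

lemma reached_low_level:
  assumes "w 0 = 0"
  shows "(\<exists>n::nat. reached (- real n) C w s) \<longleftrightarrow> reached 0 C w s"
  using assms unfolding reached_def by force

lemma returns_low_level:
  assumes "w 0 = 0"
  shows "(\<exists>n::nat. returns (- real n) u v w) \<longleftrightarrow> returns 0 u v w"
  unfolding returns_def reached_low_level[of w, OF assms, symmetric] by blast

text \<open>Closedness makes finite hitting times attained, so the comparison of two infima becomes
  one of actual times. The only possible tie is \<open>\<infinity> = \<infinity>\<close>, when
  neither half-line is visited; the extra clause of the second part excludes it.\<close>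

lemma hitting_times_less_iff:
  assumes w: "w \<in> space path_space" and "u < v"
  shows "hit_below u w < hit_above v w \<longleftrightarrow> (\<exists>n::nat. returns (- real n) u v w)"
    and "hit_above v w < hit_below u w \<longleftrightarrow> \<not> (\<exists>n::nat. returns (- real n) u v w) \<and>
      (\<exists>n::nat. \<exists>s. reached (- real n) ({..u} \<union> {v..}) w s)"
proof -
  let ?A = "hit_below u w" and ?B = "hit_above v w"
  let ?U = "\<exists>n::nat. returns (- real n) u v w"
  let ?a = "{t. 0 \<le> t \<and> w t \<le> u}" and ?b = "{t. 0 \<le> t \<and> w t \<ge> v}"
  have "closed ({0..} \<inter> w -` {..u})" "closed ({0..} \<inter> w -` {v..})"
    by (rule continuous_closed_preimage[OF path_continuous[OF w] closed_atLeast], simp)+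
  moreover have "{0..} \<inter> w -` {..u} = ?a" "{0..} \<inter> w -` {v..} = ?b" by auto
  ultimately have cl: "closed ?a" "closed ?b" by auto
  obtain m :: nat where m: "- w 0 \<le> real m" using real_arch_simple by blast
  have r0: "(\<exists>n::nat. reached (- real n) C w s) \<longleftrightarrow> 0 \<le> s \<and> w s \<in> C" for C s
    unfolding reached_def using m by (auto intro!: exI[of _ m] exI[of _ "0::real"])
  have r1: "?U \<longleftrightarrow> (\<exists>s. (0 \<le> s \<and> w s \<in> {..u}) \<and> (\<forall>q. 0 \<le> q \<and> q \<le> s \<longrightarrow> w q < v))"
    unfolding returns_def r0[symmetric] by blast
  have U: "?U \<longleftrightarrow> (\<exists>s\<in>?a. \<forall>t\<in>?b. s < t)"
  proof
    assume ?U
    then obtain s where s: "0 \<le> s" "w s \<le> u" "\<And>q. 0 \<le> q \<Longrightarrow> q \<le> s \<Longrightarrow> w q < v"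
      unfolding r1 by auto
    then have "\<forall>t\<in>?b. s < t" by (auto simp: not_le[symmetric])
    with s show "\<exists>s\<in>?a. \<forall>t\<in>?b. s < t" by blast
  next
    assume "\<exists>s\<in>?a. \<forall>t\<in>?b. s < t"
    then obtain s where "0 \<le> s" "w s \<le> u" "\<And>t. 0 \<le> t \<Longrightarrow> w t \<ge> v \<Longrightarrow> s < t" by auto
    then show ?U unfolding r1 by (intro exI[of _ s]) force
  qed
  have A: "?A = Inf (ereal ` ?a)" and B: "?B = Inf (ereal ` ?b)"
    by (simp_all add: hit_below_def hit_above_def)
  have a0: "?a \<subseteq> {0..}" "?b \<subseteq> {0..}" by auto
  have Ae: "?A = \<infinity>" if "?a = {}" unfolding A that by (simp add: top_ereal_def)
  have Be: "?B = \<infinity>" if "?b = {}" unfolding B that by (simp add: top_ereal_def)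
  have An: "\<exists>m\<in>?a. ?A = ereal m \<and> (\<forall>t\<in>?a. m \<le> t)" if "?a \<noteq> {}"
    unfolding A by (rule closed_infimum[OF cl(1) a0(1) that]) blast
  have Bn: "\<exists>m\<in>?b. ?B = ereal m \<and> (\<forall>t\<in>?b. m \<le> t)" if "?b \<noteq> {}"
    unfolding B by (rule closed_infimum[OF cl(2) a0(2) that]) blast
  show AB: "?A < ?B \<longleftrightarrow> ?U"
  proof (cases "?a = {}")
    case True
    show ?thesis unfolding U Ae[OF True] True by simp
  next
    case False
    from An[OF this] obtain m where m: "m \<in> ?a" "?A = ereal m" "\<forall>t\<in>?a. m \<le> t" by blast
    show ?thesis
    proof (cases "?b = {}")
      case True
      show ?thesis unfolding U Be[OF True] m(2) True using m(1) by auto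
    next
      case False
      from Bn[OF this] obtain n where n: "n \<in> ?b" "?B = ereal n" "\<forall>t\<in>?b. n \<le> t" by blast
      have "m < n \<longleftrightarrow> (\<exists>s\<in>?a. \<forall>t\<in>?b. s < t)"
        using m(1,3) n(1,3) by (meson le_less_trans less_le_trans)
      then show ?thesis unfolding U m(2) n(2) by simp
    qed
  qed
  \<comment> \<open>Equal finite times would put the path in both half-lines at once.\<close>
  have ne: "?A \<noteq> ?B" if ex: "?a \<noteq> {} \<or> ?b \<noteq> {}"
  proof
    assume eq: "?A = ?B"
    from ex have "?A \<noteq> \<infinity> \<or> ?B \<noteq> \<infinity>"
      using An Bn by (metis PInfty_neq_ereal(1))
    then have "?A \<noteq> \<infinity>" "?B \<noteq> \<infinity>" using eq by auto
    then have "?a \<noteq> {}" "?b \<noteq> {}" using Ae Be by blast+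
    then obtain m n where "m \<in> ?a" "?A = ereal m" "n \<in> ?b" "?B = ereal n"
      using An Bn by metis
    with eq assms show False by auto
  qed
  have "(\<exists>n::nat. \<exists>s. reached (- real n) ({..u} \<union> {v..}) w s) \<longleftrightarrow>
      (\<exists>s. 0 \<le> s \<and> w s \<in> {..u} \<union> {v..})"
    unfolding r0[symmetric] by blast
  then have "(\<exists>n::nat. \<exists>s. reached (- real n) ({..u} \<union> {v..}) w s) \<longleftrightarrow> ?a \<noteq> {} \<or> ?b \<noteq> {}"
    by auto
  moreover have "?A = ?B" if "?a = {}" "?b = {}" using Ae[OF that(1)] Be[OF that(2)] by simp
  then have "?A \<noteq> ?B \<longleftrightarrow> ?a \<noteq> {} \<or> ?b \<noteq> {}" using ne by blast
  moreover have "?B < ?A \<longleftrightarrow> \<not> ?A < ?B \<and> ?A \<noteq> ?B" by (auto simp: not_less)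
  ultimately show "?B < ?A \<longleftrightarrow> \<not> ?U \<and>
      (\<exists>n::nat. \<exists>s. reached (- real n) ({..u} \<union> {v..}) w s)"
    using AB by (simp only:)
qed

lemma hitting_times_less_sets [measurable]:
  assumes "u < v"
  shows "Measurable.pred path_space (\<lambda>w. hit_below u w < hit_above v w)"
    and "Measurable.pred path_space (\<lambda>w. hit_above v w < hit_below u w)"
proof -
  have "closed ({..u} \<union> {v..})" "{..u} \<union> {v..} \<noteq> {}" by (auto intro: closed_Un)
  note [measurable] = ever_reached_sets[OF this]
  show "Measurable.pred path_space (\<lambda>w. hit_below u w < hit_above v w)"
    by (subst measurable_cong[OF hitting_times_less_iff(1)[OF _ assms]]) measurable
  show "Measurable.pred path_space (\<lambda>w. hit_above v w < hit_below u w)"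
    by (subst measurable_cong[OF hitting_times_less_iff(2)[OF _ assms]]) measurable
qed

text \<open>By continuity a bound \<open>real n \<le> w t\<close> for all large \<open>t\<close> can
  be tested at rational times, which leaves countably many coordinate events.\<close>

lemma transient_sets [measurable]:
  "Measurable.pred path_space (\<lambda>w. filterlim w at_top at_top)"
proof -
  have "filterlim w at_top at_top \<longleftrightarrow>
      (\<forall>n::nat. \<exists>m::nat. \<forall>q\<in>\<rat> \<inter> {0..}. real m \<le> q \<longrightarrow> real n \<le> w q)"
    if w: "w \<in> space path_space" for w
  proof -
    have "filterlim w at_top at_top \<longleftrightarrow> (\<forall>n::nat. \<forall>\<^sub>F t in at_top. real n \<le> w t)"
      unfolding filterlim_at_top
      by (meson eventually_mono order_trans real_arch_simple)
    also have "\<dots> \<longleftrightarrow> (\<forall>n::nat. \<exists>m::nat. \<forall>q\<in>\<rat> \<inter> {0..}. real m \<le> q \<longrightarrow> real n \<le> w q)"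
    proof (intro iff_allI)
      fix n :: nat
      show "(\<forall>\<^sub>F t in at_top. real n \<le> w t) \<longleftrightarrow>
          (\<exists>m::nat. \<forall>q\<in>\<rat> \<inter> {0..}. real m \<le> q \<longrightarrow> real n \<le> w q)"
      proof
        assume "\<forall>\<^sub>F t in at_top. real n \<le> w t"
        then obtain T where "\<And>t. T \<le> t \<Longrightarrow> real n \<le> w t" by (auto simp: eventually_at_top_linorder)
        then show "\<exists>m::nat. \<forall>q\<in>\<rat> \<inter> {0..}. real m \<le> q \<longrightarrow> real n \<le> w q"
          by (meson order_trans real_arch_simple)
      next
        assume "\<exists>m::nat. \<forall>q\<in>\<rat> \<inter> {0..}. real m \<le> q \<longrightarrow> real n \<le> w q"
        then obtain m :: nat where m: "\<And>q. q \<in> \<rat> \<Longrightarrow> 0 \<le> q \<Longrightarrow> real m \<le> q \<Longrightarrow> real n \<le> w q"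
          by (metis IntI atLeast_iff)
        have "real n \<le> w t" if t: "real m \<le> t" for t
        proof (rule ccontr)
          assume "\<not> real n \<le> w t"
          moreover have "0 \<le> t" using t by (meson of_nat_0_le_iff order_trans)
          ultimately obtain d where d: "d > 0"
            "\<And>x. x \<in> {0..} \<Longrightarrow> dist x t < d \<Longrightarrow> dist (w x) (w t) < real n - w t"
            using path_continuous[OF w] unfolding continuous_on_iff
            by (metis atLeast_iff diff_gt_0_iff_gt not_le)
          obtain q where q: "q \<in> \<rat>" "t < q" "q < t + d" using Rats_dense_in_real[of t "t + d"] d(1) by auto
          have "dist (w q) (w t) < real n - w t" using d(2)[of q] q \<open>0 \<le> t\<close> by (auto simp: dist_real_def)
          moreover have "real n \<le> w q" using m[of q] q t \<open>0 \<le> t\<close> by auto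
          ultimately show False by (auto simp: dist_real_def)
        qed
        then show "\<forall>\<^sub>F t in at_top. real n \<le> w t" by (auto simp: eventually_at_top_linorder)
      qed
    qed
    finally show ?thesis .
  qed
  then have "{w \<in> space path_space. filterlim w at_top at_top} =
      {w \<in> space path_space. \<forall>n::nat. \<exists>m::nat. \<forall>q\<in>\<rat> \<inter> {0..}. real m \<le> q \<longrightarrow> real n \<le> w q}"
    by auto
  also have "\<dots> \<in> sets path_space"
  proof -
    have "{w \<in> space path_space. real m \<le> q \<longrightarrow> real n \<le> w q} \<in> sets path_space"
      if "q \<in> \<rat> \<inter> {0..}" for q m n
    proof -
      have "0 \<le> q" using that by simp
      then have [measurable]: "(\<lambda>w. w q) \<in> borel_measurable path_space" by measurable
      show ?thesis by measurable
    qed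
    moreover have "countable (\<rat> \<inter> {0::real..})" using countable_rat by blast
    ultimately have "{w \<in> space path_space. \<forall>q\<in>\<rat> \<inter> {0..}. real m \<le> q \<longrightarrow> real n \<le> w q}
        \<in> sets path_space" for m n :: nat
      by (rule sets.sets_Collect_countable_All')
    then show ?thesis
      by (intro sets.sets_Collect_countable_All sets.sets_Collect_countable_Ex)
  qed
  finally show ?thesis by (simp add: pred_def)
qed

subsection \<open>Exit probabilities of a one-dimensional diffusion\<close>

definition potential :: "(real \<Rightarrow> real) \<Rightarrow> (real \<Rightarrow> real) \<Rightarrow> real \<Rightarrow> real" where
  "potential \<alpha> \<beta> = primitive (\<lambda>x. 2 * \<beta> x / \<alpha> x)"

definition scale_function :: "(real \<Rightarrow> real) \<Rightarrow> (real \<Rightarrow> real) \<Rightarrow> real \<Rightarrow> real" where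
  "scale_function \<alpha> \<beta> = primitive (\<lambda>y. exp (- potential \<alpha> \<beta> y))"

lemma continuous_along_path:
  fixes G :: "real \<Rightarrow> real"
  assumes "continuous_on UNIV G" "w \<in> space path_space" "0 \<le> a"
  shows "continuous_on {a..b} (\<lambda>s. G (w s))"
proof -
  have "continuous_on {a..b} w"
    using path_continuous[OF assms(2)] continuous_on_subset assms(3) by fastforce
  then show ?thesis using continuous_on_compose2[of UNIV G "{a..b}" w] assms(1) by auto
qed

locale one_dim_diffusion =
  fixes \<alpha> \<beta> :: "real \<Rightarrow> real" and K \<nu> :: real and N :: "(real \<Rightarrow> real) measure"
  assumes cont_\<alpha>: "continuous_on UNIV \<alpha>" and cont_\<beta>: "continuous_on UNIV \<beta>"
    and nu_pos: "0 < \<nu>" and ellip: "\<And>x. 1 / \<nu> \<le> \<alpha> x" and drift_bound: "\<And>x. \<bar>\<beta> x\<bar> \<le> K"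
    and solution: "solves_martingale_problem \<alpha> \<beta> 0 N"
begin

lemma prob_N: "prob_space N" and sets_N: "sets N = sets path_space"
  and start_N: "AE w in N. w 0 = 0"
  using solution by (auto simp: solves_martingale_problem_def)

sublocale N: prob_space N by (rule prob_N)

lemma space_N: "space N = space path_space"
  by (rule sets_eq_imp_space_eq[OF sets_N])

lemma pred_N: "Measurable.pred path_space Q \<Longrightarrow> Measurable.pred N Q"
  by (simp add: measurable_cong_sets[OF sets_N refl])

lemma alpha_pos: "0 < \<alpha> x"
  using ellip[of x] nu_pos by (meson less_le_trans zero_less_divide_1_iff)

lemma K_nonneg: "0 \<le> K"
  using drift_bound[of 0] by linarith

lemma cont_ratio: "continuous_on UNIV (\<lambda>x. 2 * \<beta> x / \<alpha> x)"
  using alpha_pos by (intro continuous_intros cont_\<alpha> cont_\<beta>) (auto simp: less_imp_neq[symmetric])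

lemma DERIV_potential: "(potential \<alpha> \<beta> has_real_derivative 2 * \<beta> x / \<alpha> x) (at x)"
  unfolding potential_def by (rule DERIV_primitive[OF cont_ratio])

lemma cont_exp_potential: "continuous_on UNIV (\<lambda>y. exp (- potential \<alpha> \<beta> y))"
  unfolding potential_def by (intro continuous_intros continuous_on_primitive cont_ratio)

lemma DERIV_scale: "(scale_function \<alpha> \<beta> has_real_derivative exp (- potential \<alpha> \<beta> x)) (at x)"
  unfolding scale_function_def by (rule DERIV_primitive[OF cont_exp_potential])

lemma scale_0 [simp]: "scale_function \<alpha> \<beta> 0 = 0" by (simp add: scale_function_def)

lemma scale_strict_mono: "x < y \<Longrightarrow> scale_function \<alpha> \<beta> x < scale_function \<alpha> \<beta> y"
  using DERIV_pos_imp_increasing DERIV_scale exp_gt_zero by blast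

text \<open>Optional stopping at either time gives the mean of \<open>Y 0\<close>, so the increment
  of \<open>Y\<close> between them has mean \<open>0\<close>. This plays the part of a restart at
  the first passage to \<open>y\<close>.\<close>

lemma dynkin:
  fixes y :: real
  assumes f: "C2_compact_support f" "continuous_on UNIV f" "continuous_on UNIV (generator \<alpha> \<beta> f)"
    and B: "\<forall>x. \<bar>f x\<bar> \<le> B" "\<forall>x. \<bar>generator \<alpha> \<beta> f x\<bar> \<le> B"
    and C: "closed C" "C \<noteq> {}" and t: "0 < t"
  defines "Q \<equiv> \<lambda>w. f (w (visit_time y C t w)) - f (w (visit_time y UNIV t w)) -
      integral {visit_time y UNIV t w..visit_time y C t w} (\<lambda>s. generator \<alpha> \<beta> f (w s))"
  shows "integrable N Q" "(\<integral>w. Q w \<partial>N) = 0"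
proof -
  define G where "G = generator \<alpha> \<beta> f"
  define Y where "Y = (\<lambda>(t::real) w. f (w t) - f (w 0) - (LBINT s:{0..t}. G (w s)))"
  have mart: "martingale N canonical_filtration Y"
    using solution f(1) unfolding solves_martingale_problem_def Y_def G_def by blast
  have contG: "continuous_on {a..b} (\<lambda>s. G (w s))" "continuous_on {a..b} (\<lambda>s. f (w s))"
    if "w \<in> space path_space" "0 \<le> a" for w a b
    unfolding G_def by (rule continuous_along_path[OF f(3) that] continuous_along_path[OF f(2) that])+
  have Y_eq: "Y s w = f (w s) - f (w 0) - integral {0..s} (\<lambda>s. G (w s))"
    if "w \<in> space path_space" for s w
    unfolding Y_def using contG(1)[OF that order_refl]
    by (simp add: set_borel_integral_eq_integral(2)[OF borel_integrable_atLeastAtMost'])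
  have int: "(\<lambda>s. G (w s)) integrable_on {a..b}" if "w \<in> space path_space" "0 \<le> a" for w a b
    using contG(1)[OF that] by (rule integrable_continuous_real)
  have contY: "continuous_on {0..t} (\<lambda>s. Y s w)" if w: "w \<in> space path_space" for w
    unfolding Y_eq[OF w]
    by (intro continuous_intros contG[OF w] indefinite_integral_continuous_1 int[OF w]) auto
  have boundY: "\<bar>Y s w\<bar> \<le> 2 * B + B * t" if w: "w \<in> space path_space" and s: "0 \<le> s" "s \<le> t" for w s
  proof -
    have B0: "0 \<le> B" using spec[OF B(1), of 0] by linarith
    have "norm (integral {0..s} (\<lambda>s. G (w s))) \<le> B * (s - 0)"
      by (rule integral_bound[OF s(1) contG(1)[OF w order_refl]]) (use B in \<open>auto simp: G_def\<close>)
    also have "\<dots> \<le> B * t" using s B0 by (simp add: mult_left_mono)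
    finally show ?thesis unfolding Y_eq[OF w] using spec[OF B(1), of "w s"] spec[OF B(1), of "w 0"] by (auto simp: abs_le_iff)
  qed
  note os = optional_stopping[OF prob_N sets_N mart contY boundY t, of "visit_time y D t" for D]
  have bd: "0 \<le> visit_time y D t w \<and> visit_time y D t w \<le> t" for D w
    using visit_time_nonneg[of t y D w] visit_time_le[of y D t w] t by auto
  have sC: "integrable N (\<lambda>w. Y (visit_time y C t w) w)"
     "(\<integral>w. Y (visit_time y C t w) w \<partial>N) = (\<integral>w. Y 0 w \<partial>N)"
    by (rule os; (use bd visit_time_sets[OF C] in blast))+
  have sU: "integrable N (\<lambda>w. Y (visit_time y UNIV t w) w)"
     "(\<integral>w. Y (visit_time y UNIV t w) w \<partial>N) = (\<integral>w. Y 0 w \<partial>N)"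
    by (rule os; (use bd visit_time_sets[OF closed_UNIV] in blast))+
  have Q_eq: "Y (visit_time y C t w) w - Y (visit_time y UNIV t w) w = Q w"
    if "w \<in> space N" for w
  proof -
    let ?\<sigma> = "visit_time y UNIV t w" and ?\<theta> = "visit_time y C t w"
    have w: "w \<in> space path_space" using that by (simp add: space_N)
    have "integral {0..?\<sigma>} (\<lambda>s. G (w s)) + integral {?\<sigma>..?\<theta>} (\<lambda>s. G (w s)) =
        integral {0..?\<theta>} (\<lambda>s. G (w s))"
      using bd by (intro Henstock_Kurzweil_Integration.integral_combine visit_time_mono int[OF w]) auto
    then show ?thesis unfolding Y_eq[OF w] Q_def G_def by simp
  qed
  show "integrable N Q"
    using Bochner_Integration.integrable_diff[OF sC(1) sU(1)]
    by (subst Bochner_Integration.integrable_cong[OF refl Q_eq[symmetric]])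
  have "(\<integral>w. Q w \<partial>N) = (\<integral>w. Y (visit_time y C t w) w - Y (visit_time y UNIV t w) w \<partial>N)"
    by (rule Bochner_Integration.integral_cong[OF refl Q_eq[symmetric]])
  also have "\<dots> = 0" using sC sU by simp
  finally show "(\<integral>w. Q w \<partial>N) = 0" .
qed

text \<open>The generator applied to \<open>exp (l * x)\<close> is at least some
  \<open>c > 0\<close> on \<open>{u..v}\<close>. By \<open>dynkin\<close> the mean of a function
  bounded by \<open>B\<close> would therefore rise by \<open>c * t\<close> on the event of no exit,
  so \<open>c * t\<close> times the probability of that event is at most \<open>2 * B\<close> for
  every \<open>t\<close>.\<close>

lemma AE_exit:
  assumes u: "u < 0" and v: "0 < v"
  shows "AE w in N. \<exists>s. reached 0 ({..u} \<union> {v..}) w s"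
proof -
  define C where "C = {..u} \<union> {v..}"
  have C: "closed C" "C \<noteq> {}" unfolding C_def by (auto intro: closed_Un)
  \<comment> \<open>\<open>l\<close> makes \<open>1/2 * \<alpha> x * l\<close> at least
    \<open>K + 1\<close>, so that a drift as low as \<open>- K\<close> still leaves
    \<open>1\<close>.\<close>
  define l where "l = 2 * \<nu> * (K + 1)"
  have l: "0 < l" using nu_pos K_nonneg by (simp add: l_def)
  have d: "((\<lambda>x. exp (l * x)) has_real_derivative l * exp (l * x)) (at x)"
    "((\<lambda>x. l * exp (l * x)) has_real_derivative l * l * exp (l * x)) (at x)" for x
    by (auto intro!: derivative_eq_intros)
  have c: "continuous_on UNIV (\<lambda>x. l * l * exp (l * x))" by (intro continuous_intros)
  have uv: "u \<le> v" using u v by simp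
  obtain f B where f: "C2_compact_support f" "continuous_on UNIV f" "continuous_on UNIV (generator \<alpha> \<beta> f)"
    "0 < B" "\<forall>x. \<bar>f x\<bar> \<le> B" "\<forall>x. \<bar>generator \<alpha> \<beta> f x\<bar> \<le> B"
    "\<forall>x\<in>{u..v}. f x = exp (l * x) \<and> generator \<alpha> \<beta> f x =
        1/2 * \<alpha> x * (l * l * exp (l * x)) + \<beta> x * (l * exp (l * x))"
    by (rule test_function_exists[OF cont_\<alpha> cont_\<beta> uv d c])
  define c where "c = l * exp (l * u)"
  have c: "0 < c" using l by (simp add: c_def)
  have Gc: "c \<le> generator \<alpha> \<beta> f x" if "u \<le> x" "x \<le> v" for x
  proof -
    have "K + 1 = 1/2 * (1 / \<nu>) * l" using nu_pos by (simp add: l_def)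
    also have "\<dots> \<le> 1/2 * \<alpha> x * l" using ellip[of x] l by (intro mult_right_mono mult_left_mono) auto
    finally have "1 \<le> 1/2 * \<alpha> x * l + \<beta> x" using drift_bound[of x] by (simp add: abs_le_iff)
    moreover have "0 \<le> l * exp (l * x)" using l by simp
    ultimately have "1 * (l * exp (l * x)) \<le> (1/2 * \<alpha> x * l + \<beta> x) * (l * exp (l * x))"
      by (rule mult_right_mono)
    also have "\<dots> = generator \<alpha> \<beta> f x" using f(7) that by (simp add: algebra_simps)
    finally have "l * exp (l * x) \<le> generator \<alpha> \<beta> f x" by simp
    moreover have "c \<le> l * exp (l * x)" unfolding c_def using l that by (intro mult_left_mono) auto
    ultimately show ?thesis by linarith
  qed
  define E where "E = {w \<in> space N. \<not> (\<exists>s. reached 0 C w s)}"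
  have E: "E \<in> sets N"
    using pred_N[OF ever_reached_sets[OF C]] unfolding E_def by measurable
  have "N.prob E * (c * t) \<le> 2 * B" if t: "0 < t" for t
  proof -
    let ?Q = "\<lambda>w. f (w (visit_time 0 C t w)) - f (w (visit_time 0 UNIV t w)) -
      integral {visit_time 0 UNIV t w..visit_time 0 C t w} (\<lambda>s. generator \<alpha> \<beta> f (w s))"
    note Q = dynkin[OF f(1,2,3,5,6) C t, of 0]
    have "0 = (\<integral>w. ?Q w \<partial>N)" using Q(2) by simp
    also have "\<dots> \<le> (\<integral>w. 2 * B - c * t * indicator E w \<partial>N)"
    proof (rule integral_mono_AE)
      show "integrable N ?Q" by (rule Q(1))
      show "integrable N (\<lambda>w. 2 * B - c * t * indicator E w)" using E by (simp add: N.emeasure_eq_measure)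
      show "AE w in N. ?Q w \<le> 2 * B - c * t * indicator E w"
        using start_N
          AE_space
      proof eventually_elim
        fix w assume w0: "w 0 = 0" and "w \<in> space N"
        then have w: "w \<in> space path_space" by (simp add: space_N)
        let ?\<theta> = "visit_time 0 C t w"
        \<comment> \<open>With start and level both \<open>0\<close>, the first passage is
          immediate.\<close>
        have "reached 0 UNIV w 0" using w0 by (auto simp: reached_def)
        then have "visit_time 0 UNIV t w \<le> 0" using t by (intro visit_time_lower) auto
        then have s0: "visit_time 0 UNIV t w = 0" using visit_time_nonneg[of t 0 UNIV w] t by linarith
        have r: "reached 0 UNIV w t" using w0 t by (auto simp: reached_def)
        have th: "0 \<le> ?\<theta>" using visit_time_nonneg t by (simp add: less_imp_le)
        have "u \<le> w s \<and> w s \<le> v" if "0 \<le> s" "s \<le> ?\<theta>" for s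
          by (rule between_visits[OF w _ u v C_def r]) (use w0 s0 that in auto)
        then have "integral {0..?\<theta>} (\<lambda>s. c) \<le> integral {0..?\<theta>} (\<lambda>s. generator \<alpha> \<beta> f (w s))"
          by (intro integral_le integrable_continuous_real continuous_along_path[OF f(3) w] Gc) auto
        then have int: "c * ?\<theta> \<le> integral {0..?\<theta>} (\<lambda>s. generator \<alpha> \<beta> f (w s))"
          using th by (simp add: mult.commute)
        \<comment> \<open>On \<open>E\<close> the exit never happens, so the visit time is its cap
          \<open>t\<close>.\<close>
        have "c * t * indicator E w \<le> c * ?\<theta>"
        proof (cases "w \<in> E")
          case True
          then have "?\<theta> = t" by (intro visit_time_eq) (auto simp: E_def)
          with True show ?thesis by simp
        qed (use c th in simp)
        with int show "?Q w \<le> 2 * B - c * t * indicator E w"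
          unfolding s0 using spec[OF f(5), of "w ?\<theta>"] spec[OF f(5), of "w 0"] by (auto simp: abs_le_iff)
      qed
    qed
    also have "\<dots> = 2 * B - c * t * N.prob E" using E by (simp add: N.emeasure_eq_measure N.prob_space)
    finally show ?thesis by (simp add: algebra_simps)
  qed
  then have le: "N.prob E \<le> 2 * B / (c * t)" if "0 < t" for t
    using that c by (simp add: pos_le_divide_eq)
  have "((\<lambda>t. 2 * B / (c * t)) \<longlongrightarrow> 0) at_top"
    using c by real_asymp
  then have "N.prob E \<le> 0"
    by (rule tendsto_lowerbound) (use eventually_mono[OF eventually_gt_at_top[of 0] le] in auto)
  then have "N.prob E = 0" by (simp add: measure_le_0_iff)
  then have "AE w in N. w \<notin> E" using E by (simp add: N.prob_eq_0)
  then show ?thesis using AE_space by eventually_elim (auto simp: E_def C_def)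
qed

lemma ever_reached_N [measurable]:
  "closed C \<Longrightarrow> C \<noteq> {} \<Longrightarrow> {w \<in> space N. \<exists>s. reached y C w s} \<in> sets N"
  using pred_N[OF ever_reached_sets[of C y]] by (simp add: pred_def)

lemma returns_N [measurable]: "{w \<in> space N. returns y u v w} \<in> sets N"
  using pred_N[OF returns_sets[of y u v]] by (simp add: pred_def)

text \<open>\<open>S\<close> is harmonic, so \<open>dynkin\<close> for a cutoff of \<open>S\<close>
  has no integral term: the mean change of \<open>S\<close> between the first passage to
  \<open>y\<close> and the exit from the interval is \<open>0\<close>. Letting \<open>t\<close> grow
  gives the identity. The assumption \<open>ex\<close> ensures that the exit takes place, and the
  probability of ever reaching \<open>y\<close> stays as a factor.\<close>

lemma return_probability:
  assumes y: "0 \<le> y" and u: "u < y" and v: "y < v"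
    and ex: "AE w in N. (\<exists>s. reached y UNIV w s) \<longrightarrow> (\<exists>s. reached y ({..u} \<union> {v..}) w s)"
  shows "N.prob {w \<in> space N. returns y u v w} * (scale_function \<alpha> \<beta> v - scale_function \<alpha> \<beta> u) =
    N.prob {w \<in> space N. \<exists>s. reached y UNIV w s} * (scale_function \<alpha> \<beta> v - scale_function \<alpha> \<beta> y)"
proof -
  define S where "S = scale_function \<alpha> \<beta>"
  define C where "C = {..u} \<union> {v..}"
  define H where "H = {w \<in> space N. \<exists>s. reached y UNIV w s}"
  define U where "U = {w \<in> space N. returns y u v w}"
  have C: "closed C" "C \<noteq> {}" unfolding C_def by (auto intro: closed_Un)
  have [measurable]: "H \<in> sets N" "U \<in> sets N"
    unfolding H_def U_def by (auto intro!: ever_reached_N returns_N)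
  let ?g = "\<lambda>x. exp (- potential \<alpha> \<beta> x)"
  have d: "(S has_real_derivative ?g x) (at x)"
    "(?g has_real_derivative - (2 * \<beta> x / \<alpha> x) * ?g x) (at x)" for x
    unfolding S_def using DERIV_scale DERIV_potential by (auto intro!: derivative_eq_intros)
  have c: "continuous_on UNIV (\<lambda>x. - (2 * \<beta> x / \<alpha> x) * ?g x)"
    by (intro continuous_intros cont_exp_potential cont_ratio)
  have uv: "u \<le> v" using u v by simp
  obtain f B where f: "C2_compact_support f" "continuous_on UNIV f" "continuous_on UNIV (generator \<alpha> \<beta> f)"
    "0 < B" "\<forall>x. \<bar>f x\<bar> \<le> B" "\<forall>x. \<bar>generator \<alpha> \<beta> f x\<bar> \<le> B"
    "\<forall>x\<in>{u..v}. f x = S x \<and> generator \<alpha> \<beta> f x =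
        1/2 * \<alpha> x * (- (2 * \<beta> x / \<alpha> x) * ?g x) + \<beta> x * ?g x"
    by (rule test_function_exists[OF cont_\<alpha> cont_\<beta> uv d c])
  have f0: "generator \<alpha> \<beta> f x = 0" if "u \<le> x" "x \<le> v" for x
  proof -
    have "generator \<alpha> \<beta> f x = 1/2 * \<alpha> x * (- (2 * \<beta> x / \<alpha> x) * ?g x) + \<beta> x * ?g x"
      using f(7) that by (metis atLeastAtMost_iff)
    also have "\<dots> = 0" using alpha_pos[of x] by simp
    finally show ?thesis .
  qed
  let ?Q = "\<lambda>t w. f (w (visit_time y C t w)) - f (w (visit_time y UNIV t w)) -
      integral {visit_time y UNIV t w..visit_time y C t w} (\<lambda>s. generator \<alpha> \<beta> f (w s))"
  \<comment> \<open>The limiting change of \<open>S\<close>: it is \<open>S u - S y\<close> on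
    \<open>U\<close>, \<open>S v - S y\<close> on the rest of \<open>H\<close>, and \<open>0\<close>
    off \<open>H\<close>. Here \<open>U\<close> is contained in \<open>H\<close>.\<close>
  define l where "l w = indicator U w * (S u - S v) + indicator H w * (S v - S y)" for w
  have Q: "integrable N (?Q (real (Suc n)))" "(\<integral>w. ?Q (real (Suc n)) w \<partial>N) = 0" for n
    using dynkin[OF f(1,2,3,5,6) C, of "real (Suc n)" y] by auto
  have int0: "integral {visit_time y UNIV t w..visit_time y C t w} (\<lambda>s. generator \<alpha> \<beta> f (w s)) = 0"
    if w: "w \<in> space path_space" "w 0 = 0" for t w
  proof (cases "reached y UNIV w t")
    case True
    have "u \<le> w s \<and> w s \<le> v" if "visit_time y UNIV t w \<le> s" "s \<le> visit_time y C t w" for s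
      by (rule between_visits[OF w(1) _ u v C_def True that]) (use w y in simp)
    then have "integral {visit_time y UNIV t w..visit_time y C t w} (\<lambda>s. generator \<alpha> \<beta> f (w s)) =
        integral {visit_time y UNIV t w..visit_time y C t w} (\<lambda>s. 0)"
      by (intro Henstock_Kurzweil_Integration.integral_cong f0) auto
    then show ?thesis by simp
  next
    case False
    have "w 0 \<le> y" using w y by simp
    from not_reached_visits[OF w(1) this u v C_def False] show ?thesis by simp
  qed
  have "(\<lambda>n. \<integral>w. ?Q (real (Suc n)) w \<partial>N) \<longlonglongrightarrow> (\<integral>w. l w \<partial>N)"
  proof (rule integral_dominated_convergence[where w="\<lambda>_. 2 * B"])
    show "l \<in> borel_measurable N" unfolding l_def by measurable
    show "?Q (real (Suc n)) \<in> borel_measurable N" for n using Q(1)[of n] by (rule borel_measurable_integrable)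
    show "AE w in N. norm (?Q (real (Suc n)) w) \<le> 2 * B" for n
      using start_N AE_space
    proof eventually_elim
      fix w assume w: "w 0 = 0" "w \<in> space N"
      then have "integral {visit_time y UNIV (Suc n) w..visit_time y C (Suc n) w} (\<lambda>s. generator \<alpha> \<beta> f (w s)) = 0"
        by (intro int0) (auto simp: space_N)
      then show "norm (?Q (real (Suc n)) w) \<le> 2 * B"
        using spec[OF f(5), of "w (visit_time y C (Suc n) w)"] spec[OF f(5), of "w (visit_time y UNIV (Suc n) w)"]
        by (auto simp: abs_le_iff)
    qed
    show "AE w in N. (\<lambda>n. ?Q (real (Suc n)) w) \<longlonglongrightarrow> l w"
      using start_N AE_space ex
    proof eventually_elim
      fix w assume w0: "w 0 = 0" and wN: "w \<in> space N"
        and exw: "(\<exists>s. reached y UNIV w s) \<longrightarrow> (\<exists>s. reached y ({..u} \<union> {v..}) w s)"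
      have w: "w \<in> space path_space" using wN by (simp add: space_N)
      have wy: "w 0 \<le> y" using w0 y by simp
      have UH: "w \<in> H" if "w \<in> U"
        using that unfolding U_def H_def returns_def by (auto intro: reached_mono)
      have "\<forall>\<^sub>F n in sequentially. ?Q (real (Suc n)) w = l w"
      \<comment> \<open>Along a path in \<open>H\<close> the sequence is constant once
        \<open>t\<close> exceeds a time of exit; a path outside \<open>H\<close> gives
        \<open>0\<close> throughout.\<close>
      proof (cases "w \<in> H")
        case True
        then obtain s where s: "reached y C w s" using exw by (auto simp: H_def C_def)
        obtain m :: nat where m: "s \<le> real m" using real_arch_simple by blast
        have "?Q (real (Suc n)) w = l w" if "m \<le> n" for n
        proof -
          have st: "s \<le> real (Suc n)" using m that by linarith
          then have r: "reached y UNIV w (real (Suc n))"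
            using s unfolding reached_def by (auto intro: order_trans)
          have "w (visit_time y UNIV (Suc n) w) = y" by (rule first_visit_value[OF w wy r])
          moreover have "w (visit_time y C (Suc n) w) = (if returns y u v w then u else v)"
            by (rule exit_value[OF w wy u v C_def s st])
          ultimately show ?thesis
            using int0[OF w w0] f(7) u v True wN by (auto simp: l_def U_def)
        qed
        then show ?thesis by (auto simp: eventually_sequentially)
      next
        case False
        then have "\<not> reached y UNIV w t" for t using wN by (auto simp: H_def)
        from not_reached_visits[OF w wy u v C_def this] show ?thesis
          using False UH by (cases "w \<in> U") (auto simp: l_def)
      qed
      then show "(\<lambda>n. ?Q (real (Suc n)) w) \<longlonglongrightarrow> l w" by (rule tendsto_eventually)
    qed
  qed simp
  then have "(\<integral>w. l w \<partial>N) = 0" unfolding Q(2) by (simp add: LIMSEQ_const_iff)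
  moreover have "(\<integral>w. l w \<partial>N) = N.prob U * (S u - S v) + N.prob H * (S v - S y)"
    unfolding l_def by (subst Bochner_Integration.integral_add) (auto simp: N.emeasure_eq_measure)
  ultimately show ?thesis unfolding S_def U_def H_def by (simp add: algebra_simps)
qed

lemma return_probability_0:
  assumes "u < 0" "0 < v"
  shows "N.prob {w \<in> space N. returns 0 u v w} * (scale_function \<alpha> \<beta> v - scale_function \<alpha> \<beta> u) = scale_function \<alpha> \<beta> v"
proof -
  have "AE w in N. \<exists>s. reached 0 UNIV w s"
    using start_N by eventually_elim (auto simp: reached_def intro!: exI[of _ "0::real"])
  then have "N.prob {w \<in> space N. \<exists>s. reached 0 UNIV w s} = 1"
    by (subst N.prob_Collect_eq_1) (auto intro!: ever_reached_N)
  moreover have "AE w in N. (\<exists>s. reached 0 UNIV w s) \<longrightarrow> (\<exists>s. reached 0 ({..u} \<union> {v..}) w s)"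
    using AE_exit[OF assms] by eventually_elim simp
  ultimately show ?thesis using return_probability[of 0 u v] assms by simp
qed

lemma exit_probabilities:
  assumes "u < 0" "0 < v"
  shows "N.prob {w \<in> space N. hit_below u w < hit_above v w} =
      scale_function \<alpha> \<beta> v / (scale_function \<alpha> \<beta> v - scale_function \<alpha> \<beta> u)" (is "N.prob ?A = ?p")
    and "N.prob {w \<in> space N. hit_above v w < hit_below u w} =
      - scale_function \<alpha> \<beta> u / (scale_function \<alpha> \<beta> v - scale_function \<alpha> \<beta> u)" (is "N.prob ?B = _")
proof -
  let ?U = "{w \<in> space N. returns 0 u v w}"
  have uv: "u < v" using assms by simp
  have [measurable]: "?A \<in> sets N" "?B \<in> sets N"
    using pred_N[OF hitting_times_less_sets(1)[OF uv]] pred_N[OF hitting_times_less_sets(2)[OF uv]]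
    by (auto simp: pred_def)
  have pos: "scale_function \<alpha> \<beta> v - scale_function \<alpha> \<beta> u > 0" using scale_strict_mono[OF uv] by simp
  have "N.prob ?A = N.prob ?U"
  proof (rule N.finite_measure_eq_AE)
    show "AE w in N. (w \<in> ?A) = (w \<in> ?U)"
      using start_N AE_space
      by eventually_elim (auto simp: space_N hitting_times_less_iff(1)[OF _ uv] returns_low_level)
  qed auto
  also have U: "\<dots> = ?p" using return_probability_0[OF assms] pos by (simp add: field_simps)
  finally show "N.prob ?A = ?p" .
  \<comment> \<open>Up to a null set the path leaves the interval, so the second event is the
    complement of the first.\<close>
  have "N.prob ?B = N.prob (space N - ?U)"
  proof (rule N.finite_measure_eq_AE)
    show "AE w in N. (w \<in> ?B) = (w \<in> space N - ?U)"
      using start_N AE_space AE_exit[OF assms]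
    proof eventually_elim
      fix w assume w: "w 0 = 0" "w \<in> space N" "\<exists>s. reached 0 ({..u} \<union> {v..}) w s"
      then have "\<exists>n::nat. \<exists>s. reached (- real n) ({..u} \<union> {v..}) w s"
        by (intro exI[of _ "0::nat"]) simp
      with w show "(w \<in> ?B) = (w \<in> space N - ?U)"
        by (simp add: space_N hitting_times_less_iff(2)[OF _ uv] returns_low_level)
    qed
  qed auto
  also have "\<dots> = 1 - ?p" using U by (subst N.prob_compl) auto
  also have "\<dots> = - scale_function \<alpha> \<beta> u / (scale_function \<alpha> \<beta> v - scale_function \<alpha> \<beta> u)" using pos by (simp add: field_simps)
  finally show "N.prob ?B = - scale_function \<alpha> \<beta> u / (scale_function \<alpha> \<beta> v - scale_function \<alpha> \<beta> u)" .
qed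

section \<open>Transience criteria in terms of the scale function\<close>

lemma scale_pos: "0 < v \<Longrightarrow> 0 < scale_function \<alpha> \<beta> v" and scale_neg: "u < 0 \<Longrightarrow> scale_function \<alpha> \<beta> u < 0"
  using scale_strict_mono[of 0 v] scale_strict_mono[of u 0] by auto

text \<open>As \<open>S v\<close> grows, the probability \<open>S v / (S v - S u)\<close> of
  reaching \<open>u\<close> before \<open>v\<close> tends to \<open>1\<close>. So almost every path
  falls below every level, whereas a path tending to infinity is bounded below.\<close>

lemma not_transient:
  assumes "\<And>B. \<exists>v>0. B < scale_function \<alpha> \<beta> v"
  shows "AE w in N. \<not> filterlim w at_top at_top"
proof -
  have "AE w in N. \<exists>s. reached 0 {..- real (Suc n)} w s" for n
  proof -
    let ?u = "- real (Suc n)"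
    let ?E = "{w \<in> space N. \<exists>s. reached 0 {..?u} w s}"
    have E: "?E \<in> sets N" by (rule ever_reached_N) auto
    define d where "d = - scale_function \<alpha> \<beta> ?u"
    have d: "0 < d" using scale_neg[of ?u] by (simp add: d_def)
    have "1 \<le> N.prob ?E"
    proof (rule field_le_epsilon)
      fix e :: real assume e: "0 < e"
      obtain v where v: "v > 0" "d / e < scale_function \<alpha> \<beta> v" using assms by blast
      let ?U = "{w \<in> space N. returns 0 ?u v w}"
      have "N.prob ?U * (scale_function \<alpha> \<beta> v + d) = scale_function \<alpha> \<beta> v"
        using return_probability_0[of ?u v] v(1) by (simp add: d_def)
      then have "1 - N.prob ?U = d / (scale_function \<alpha> \<beta> v + d)"
        using scale_pos[OF v(1)] d by (simp add: field_simps)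
      also have "\<dots> \<le> e"
      proof -
        have "d < e * scale_function \<alpha> \<beta> v" using v(2) e by (simp add: field_simps)
        also have "\<dots> \<le> e * (scale_function \<alpha> \<beta> v + d)" using e d by simp
        finally show ?thesis using d scale_pos[OF v(1)] by (simp add: pos_divide_le_eq)
      qed
      finally have "1 - N.prob ?U \<le> e" .
      moreover have "N.prob ?U \<le> N.prob ?E"
        by (rule N.finite_measure_mono) (use E in \<open>auto simp: returns_def\<close>)
      ultimately show "1 \<le> N.prob ?E + e" by simp
    qed
    then have "N.prob ?E = 1" by (rule antisym[OF N.prob_le_1])
    then show ?thesis using E by (simp add: N.prob_Collect_eq_1)
  qed
  then have "AE w in N. \<forall>n. \<exists>s. reached 0 {..- real (Suc n)} w s" by (simp add: AE_all_countable)
  then show ?thesis using AE_space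
  proof eventually_elim
    fix w assume low: "\<forall>n. \<exists>s. reached 0 {..- real (Suc n)} w s" and "w \<in> space N"
    then have w: "w \<in> space path_space" by (simp add: space_N)
    show "\<not> filterlim w at_top at_top"
    proof
      assume "filterlim w at_top at_top"
      then obtain T where T: "\<And>t. T \<le> t \<Longrightarrow> 0 \<le> w t"
        unfolding filterlim_at_top eventually_at_top_linorder by blast
      obtain B where B: "\<And>q. 0 \<le> q \<Longrightarrow> q \<le> T \<Longrightarrow> \<bar>w q\<bar> \<le> B"
        using path_bounded[OF w, of T] by blast
      obtain n where n: "\<bar>B\<bar> < real (Suc n)" using reals_Archimedean2[of "\<bar>B\<bar>"] by (metis less_Suc_eq of_nat_less_iff order.strict_trans)
      obtain s where s: "0 \<le> s" "w s \<le> - real (Suc n)" using low unfolding reached_def by blast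
      show False using T[of s] B[of s] s n by (cases "s \<le> T") auto
    qed
  qed
qed

text \<open>Divergence of \<open>S\<close> at minus infinity makes the path reach every level above.
  Boundedness on the right makes the chance of falling from \<open>y\<close> back to
  \<open>k\<close> tend to \<open>0\<close> as \<open>y\<close> grows, so almost surely each
  \<open>k\<close> has a level \<open>y\<close> from which the path never comes back to
  \<open>k\<close>.\<close>

lemma transient:
  assumes above: "\<And>v. scale_function \<alpha> \<beta> v \<le> B" and below: "\<And>A. \<exists>u<0. scale_function \<alpha> \<beta> u < A"
  shows "AE w in N. filterlim w at_top at_top"
proof -
  define S where "S = scale_function \<alpha> \<beta>"
  have Sm: "S x \<le> S y" if "x \<le> y" for x y
    unfolding S_def using scale_strict_mono[of x y] that by (cases "x = y") auto
  have hit: "AE w in N. \<exists>s. reached 0 {v..} w s" if v: "0 < v" for v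
  proof -
    let ?E = "{w \<in> space N. \<exists>s. reached 0 {v..} w s}"
    have E: "?E \<in> sets N" by (rule ever_reached_N) auto
    have "1 \<le> N.prob ?E"
    proof (rule field_le_epsilon)
      fix e :: real assume e: "0 < e"
      obtain u where u: "u < 0" "S u < - (S v / e)" using below unfolding S_def by blast
      let ?U = "{w \<in> space N. returns 0 u v w}"
      have pv: "0 < S v" unfolding S_def by (rule scale_pos[OF v])
      have nu: "S u < 0" unfolding S_def by (rule scale_neg[OF u(1)])
      have "S v < e * (- S u)" using u(2) e by (simp add: field_simps)
      then have "S v \<le> e * (S v - S u)" using mult_pos_pos[OF e pv] by (simp add: algebra_simps)
      moreover have "N.prob ?U * (S v - S u) = S v"
        unfolding S_def by (rule return_probability_0[OF u(1) v])
      ultimately have "N.prob ?U * (S v - S u) \<le> e * (S v - S u)" by simp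
      then have "N.prob ?U \<le> e" using pv nu by simp
      moreover have "1 \<le> N.prob (?E \<union> ?U)"
      proof -
        have "AE w in N. w \<in> ?E \<union> ?U"
          using AE_exit[OF u(1) v] AE_space
        proof eventually_elim
          fix w assume "\<exists>s. reached 0 ({..u} \<union> {v..}) w s" and w: "w \<in> space N"
          then obtain s where s: "reached 0 ({..u} \<union> {v..}) w s" by blast
          show "w \<in> ?E \<union> ?U"
          proof (cases "w \<in> ?U")
            case False
            have "\<exists>q. 0 \<le> q \<and> v \<le> w q"
            proof (rule ccontr)
              assume *: "\<not> ?thesis"
              then have "reached 0 {..u} w s" using s by (auto simp: reached_def)
              with * have "returns 0 u v w" unfolding returns_def by (meson not_le)
              with False w show False by simp
            qed
            then obtain q where "0 \<le> q" "v \<le> w q" by blast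
            then have "reached 0 {v..} w q" using v unfolding reached_def by (auto intro!: exI[of _ q])
            with w show ?thesis by auto
          qed simp
        qed
        then have "N.prob (?E \<union> ?U) = 1" using E by (subst N.prob_eq_1) auto
        then show ?thesis by simp
      qed
      moreover have "N.prob (?E \<union> ?U) \<le> N.prob ?E + N.prob ?U"
        by (rule measure_Un_le) (use E in auto)
      ultimately show "1 \<le> N.prob ?E + e" by linarith
    qed
    then have "N.prob ?E = 1" by (rule antisym[OF N.prob_le_1])
    then show ?thesis using E by (simp add: N.prob_Collect_eq_1)
  qed
  \<comment> \<open>\<open>I\<close> is the value of the scale function at infinity; by
    monotonicity, integers determine it.\<close>
  have "incseq (\<lambda>n. S (real n))" by (intro incseq_SucI Sm) simp
  then obtain I where I: "(\<lambda>n. S (real n)) \<longlonglongrightarrow> I" "\<And>n. S (real n) \<le> I"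
    using incseq_convergent[of "\<lambda>n. S (real n)" B] above unfolding S_def by metis
  \<comment> \<open>\<open>return_probability\<close> works with a ceiling \<open>n\<close>. The
    denominator \<open>S n - S k\<close> is at least \<open>S (Suc k) - S k\<close>, so the bound is
    uniform in \<open>n\<close>, and the ceiling is removed by letting \<open>n\<close>
    grow.\<close>
  have ret: "N.prob {w \<in> space N. \<exists>s. reached (real y) {..real k} w s} \<le> (I - S y) / (S (Suc k) - S k)"
    if ky: "k < y" for k y :: nat
  proof -
    let ?U = "\<lambda>n. {w \<in> space N. returns y k (real n) w}"
    have D: "0 < S (Suc k) - S k" unfolding S_def using scale_strict_mono[of k "Suc k"] by simp
    have U: "N.prob (?U n) \<le> (I - S y) / (S (Suc k) - S k)" for n
    proof (cases "y < n")
      case True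
      have "AE w in N. (\<exists>s. reached (real y) UNIV w s) \<longrightarrow>
          (\<exists>s. reached (real y) ({..real k} \<union> {real n..}) w s)"
      proof -
        have "0 < real n" using True by simp
        from hit[OF this] show ?thesis
        proof eventually_elim
          fix w assume "\<exists>s. reached 0 {real n..} w s"
          then obtain s where "0 \<le> s" "real n \<le> w s" by (auto simp: reached_def)
          then have "reached y ({..real k} \<union> {real n..}) w s"
            using True unfolding reached_def by (auto intro!: exI[of _ s])
          then show "(\<exists>s. reached (real y) UNIV w s) \<longrightarrow>
            (\<exists>s. reached (real y) ({..real k} \<union> {real n..}) w s)" by blast
        qed
      qed
      from return_probability[OF _ _ _ this] ky True
      have "N.prob (?U n) * (S n - S k) = N.prob {w \<in> space N. \<exists>s. reached y UNIV w s} * (S n - S y)"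
        unfolding S_def by simp
      also have "\<dots> \<le> 1 * (I - S y)"
        using I(2)[of n] Sm[of y n] True N.prob_le_1 by (intro mult_mono) auto
      finally have "N.prob (?U n) * (S n - S k) \<le> I - S y" by simp
      moreover have "N.prob (?U n) * (S (Suc k) - S k) \<le> N.prob (?U n) * (S n - S k)"
        using Sm[of "Suc k" n] ky True by (intro mult_left_mono) auto
      ultimately show ?thesis using D by (simp add: pos_le_divide_eq)
    next
      case False
      \<comment> \<open>For \<open>n \<le> y\<close> reaching \<open>y\<close> already means
        reaching the ceiling.\<close>
      have "\<not> returns y k n w" for w
        using False unfolding returns_def reached_def by fastforce
      then have "?U n = {}" by blast
      then have "N.prob (?U n) = 0" by (simp only: measure_empty)
      also have "0 \<le> (I - S y) / (S (Suc k) - S k)"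
        using D I(2)[of y] by (intro divide_nonneg_pos) auto
      finally show ?thesis .
    qed
    have inc: "incseq ?U"
      unfolding incseq_def returns_def by (auto; meson less_le_trans of_nat_mono)
    \<comment> \<open>Until the time of its return a path is bounded, hence below some
      ceiling.\<close>
    have un: "(\<Union>n. ?U n) = {w \<in> space N. \<exists>s. reached (real y) {..real k} w s}"
    proof (intro equalityI subsetI)
      fix w assume "w \<in> {w \<in> space N. \<exists>s. reached (real y) {..real k} w s}"
      then obtain s where s: "w \<in> space N" "reached (real y) {..real k} w s" by auto
      then obtain b where b: "\<And>q. 0 \<le> q \<Longrightarrow> q \<le> s \<Longrightarrow> \<bar>w q\<bar> \<le> b"
        using path_bounded[of w s] by (auto simp: space_N)
      obtain n where "b < real n" using reals_Archimedean2 by blast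
      then have "returns y k n w" unfolding returns_def using s(2) b by (force simp: abs_le_iff)
      with s show "w \<in> (\<Union>n. ?U n)" by auto
    qed (auto simp: returns_def)
    have "(\<lambda>n. N.prob (?U n)) \<longlonglongrightarrow> N.prob (\<Union>n. ?U n)"
      by (rule N.finite_Lim_measure_incseq) (use inc in auto)
    then show ?thesis unfolding un by (rule LIMSEQ_le_const2) (use U in auto)
  qed
  have "AE w in N. \<exists>y::nat. \<not> (\<exists>s. reached (real y) {..real k} w s)" for k :: nat
  proof -
    let ?B = "\<lambda>y::nat. {w \<in> space N. \<exists>s. reached (real y) {..real k} w s}"
    let ?E = "\<Inter>y. ?B y"
    have Bs: "?B y \<in> sets N" for y by (rule ever_reached_N) auto
    then have E: "?E \<in> sets N" by auto
    have le: "N.prob ?E \<le> (I - S y) / (S (Suc k) - S k)" if "Suc k \<le> y" for y :: nat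
    proof -
      have "N.prob ?E \<le> N.prob (?B y)" by (rule N.finite_measure_mono) (use Bs in auto)
      with ret[of k y] that show ?thesis by linarith
    qed
    have "(\<lambda>y. (I - S (real y)) / (S (Suc k) - S k)) \<longlonglongrightarrow> (I - I) / (S (Suc k) - S k)"
      using scale_strict_mono[of k "Suc k"] by (intro tendsto_intros I) (simp add: S_def)
    then have "N.prob ?E \<le> (I - I) / (S (Suc k) - S k)"
      by (rule LIMSEQ_le_const) (use le in blast)
    then have "N.prob ?E = 0" by (simp add: measure_le_0_iff)
    then have "AE w in N. w \<notin> ?E" using E by (simp add: N.prob_eq_0)
    then show ?thesis using AE_space by eventually_elim auto
  qed
  then have 1: "AE w in N. \<forall>k::nat. \<exists>y::nat. \<not> (\<exists>s. reached (real y) {..real k} w s)"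
    by (simp add: AE_all_countable)
  have "AE w in N. \<forall>y::nat. \<exists>s. reached 0 {real (Suc y)..} w s"
    unfolding AE_all_countable using hit by simp
  with 1 show ?thesis
  proof eventually_elim
    fix w assume 1: "\<forall>k::nat. \<exists>y::nat. \<not> (\<exists>s. reached (real y) {..real k} w s)"
      and 2: "\<forall>y::nat. \<exists>s. reached 0 {real (Suc y)..} w s"
    show "filterlim w at_top at_top"
      unfolding filterlim_at_top
    proof
      fix Z :: real
      obtain k :: nat where k: "Z \<le> real k" using real_arch_simple by blast
      obtain y :: nat where y: "\<And>s. \<not> reached (real y) {..real k} w s" using 1 by blast
      obtain r where r: "0 \<le> r" "real (Suc y) \<le> w r" using 2 unfolding reached_def by blast
      have "Z \<le> w s" if "r \<le> s" for s
        using y[of s] that r k unfolding reached_def by force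
      then show "\<forall>\<^sub>F x in at_top. Z \<le> w x" by (auto simp: eventually_at_top_linorder)
    qed
  qed
qed

end

subsection \<open>The random potential\<close>

text \<open>Joint measurability in \<open>(\<omega>, x)\<close> comes from continuity in
  \<open>x\<close> by rounding \<open>x\<close> down to a grid of mesh \<open>1 / Suc n\<close>. The
  clamp \<open>cl\<close> evaluates \<open>f\<close> only inside \<open>{u..v}\<close>; thus an
  integral over \<open>{u..v}\<close> is measurable for the environment in \<open>{u..v}\<close>
  alone, as independence requires.\<close>

lemma measurable_integral_continuous_parameter:
  fixes f :: "real \<Rightarrow> 'b \<Rightarrow> real"
  assumes f: "\<And>x. x \<in> {u..v} \<Longrightarrow> f x \<in> borel_measurable F"
    and c: "\<And>\<omega>. \<omega> \<in> space F \<Longrightarrow> continuous_on {u..v} (\<lambda>x. f x \<omega>)" and uv: "u \<le> v"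
  shows "(\<lambda>\<omega>. LBINT x:{u..v}. f x \<omega>) \<in> borel_measurable F"
proof -
  define cl where "cl x = max u (min v x)" for x
  have cl: "cl x \<in> {u..v}" for x using uv by (auto simp: cl_def)
  define h where "h n p = f (cl (of_int \<lfloor>real (Suc n) * snd p\<rfloor> / real (Suc n))) (fst p)" for n and p :: "'b \<times> real"
  have "h n \<in> borel_measurable (F \<Otimes>\<^sub>M lborel)" for n
  proof -
    have 1: "(\<lambda>p. f (cl (of_int i / real (Suc n))) (fst p)) \<in> borel_measurable (F \<Otimes>\<^sub>M lborel)" for i :: int
      by (rule measurable_compose[OF measurable_fst f[OF cl]])
    have 2: "(\<lambda>p. \<lfloor>real (Suc n) * snd p\<rfloor>) \<in> F \<Otimes>\<^sub>M lborel \<rightarrow>\<^sub>M count_space UNIV"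
      by measurable
    show ?thesis unfolding h_def by (rule measurable_compose_countable[OF 1 2])
  qed
  moreover have "(\<lambda>n. h n p) \<longlonglongrightarrow> f (cl (snd p)) (fst p)" if "p \<in> space (F \<Otimes>\<^sub>M lborel)" for p
  proof -
    have "fst p \<in> space F" using that by (auto simp: space_pair_measure)
    have "(\<lambda>n. of_int \<lfloor>real (Suc n) * snd p\<rfloor> / real (Suc n)) \<longlonglongrightarrow> snd p"
    proof (rule tendsto_sandwich)
      show "\<forall>\<^sub>F n in sequentially. snd p - inverse (real (Suc n)) \<le> of_int \<lfloor>real (Suc n) * snd p\<rfloor> / real (Suc n)"
      proof (intro always_eventually allI)
        fix n
        have "real (Suc n) * snd p - 1 \<le> of_int \<lfloor>real (Suc n) * snd p\<rfloor>" by linarith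
        then have "(real (Suc n) * snd p - 1) / real (Suc n) \<le> of_int \<lfloor>real (Suc n) * snd p\<rfloor> / real (Suc n)"
          by (rule divide_right_mono) simp
        then show "snd p - inverse (real (Suc n)) \<le> of_int \<lfloor>real (Suc n) * snd p\<rfloor> / real (Suc n)"
          by (simp add: diff_divide_distrib inverse_eq_divide)
      qed
      show "\<forall>\<^sub>F n in sequentially. of_int \<lfloor>real (Suc n) * snd p\<rfloor> / real (Suc n) \<le> snd p"
      proof (intro always_eventually allI)
        fix n
        have "of_int \<lfloor>real (Suc n) * snd p\<rfloor> / real (Suc n) \<le> (real (Suc n) * snd p) / real (Suc n)"
          by (intro divide_right_mono of_int_floor_le) simp
        then show "of_int \<lfloor>real (Suc n) * snd p\<rfloor> / real (Suc n) \<le> snd p" by simp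
      qed
      have "(\<lambda>n. snd p - inverse (real (Suc n))) \<longlonglongrightarrow> snd p - 0"
        by (intro tendsto_intros LIMSEQ_inverse_real_of_nat)
      then show "(\<lambda>n. snd p - inverse (real (Suc n))) \<longlonglongrightarrow> snd p" by simp
    qed simp
    then have "(\<lambda>n. cl (of_int \<lfloor>real (Suc n) * snd p\<rfloor> / real (Suc n))) \<longlonglongrightarrow> cl (snd p)"
      unfolding cl_def by (intro tendsto_intros)
    from continuous_on_tendsto_compose[OF c[OF \<open>fst p \<in> space F\<close>] this cl] cl
    show ?thesis unfolding h_def by simp
  qed
  ultimately have "(\<lambda>p. f (cl (snd p)) (fst p)) \<in> borel_measurable (F \<Otimes>\<^sub>M lborel)"
    by (rule borel_measurable_LIMSEQ_real[rotated])
  then have "(\<lambda>(\<omega>, x). indicator {u..v} x *\<^sub>R f (cl x) \<omega>) \<in> borel_measurable (F \<Otimes>\<^sub>M lborel)"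
    by (simp add: case_prod_beta)
  then have "(\<lambda>\<omega>. \<integral>x. indicator {u..v} x *\<^sub>R f (cl x) \<omega> \<partial>lborel) \<in> borel_measurable F"
    by (rule lborel.borel_measurable_lebesgue_integral)
  moreover have "(\<integral>x. indicator {u..v} x *\<^sub>R f (cl x) \<omega> \<partial>lborel) = (LBINT x:{u..v}. f x \<omega>)" for \<omega>
    unfolding set_lebesgue_integral_def
    by (intro Bochner_Integration.integral_cong) (auto simp: indicator_def cl_def)
  ultimately show ?thesis by simp
qed

lemma primitive_diff:
  assumes "continuous_on UNIV f" "u \<le> v"
  shows "primitive f v - primitive f u = (LBINT x:{u..v}. f x)"
proof -
  have "(LBINT x:{u..v}. f x) = integral {u..v} f"
    by (rule set_borel_integral_eq_integral(2)[OF borel_integrable_atLeastAtMost'])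
       (use assms(1) continuous_on_subset in blast)
  also have "(f has_integral (primitive f v - primitive f u)) {u..v}"
    by (rule fundamental_theorem_of_calculus[OF assms(2)])
       (use DERIV_primitive[OF assms(1)] in \<open>auto simp: has_real_derivative_iff_has_vector_derivative
          intro: has_vector_derivative_at_within\<close>)
  then have "integral {u..v} f = primitive f v - primitive f u" by (rule integral_unique)
  finally show ?thesis by simp
qed

context diffusion_in_random_environment
begin

definition env_pot :: "real \<Rightarrow> 'w \<Rightarrow> real" where
  "env_pot x \<omega> = potential (\<lambda>y. a y \<omega>) (\<lambda>y. b y \<omega>) x"

definition env_scale :: "real \<Rightarrow> 'w \<Rightarrow> real" where
  "env_scale x \<omega> = scale_function (\<lambda>y. a y \<omega>) (\<lambda>y. b y \<omega>) x"

text \<open>Lipschitz constant of the potential: \<open>\<bar>b\<bar> \<le> K\<close> and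
  \<open>1 / a \<le> \<nu>\<close> bound its slope \<open>2 * b / a\<close>.\<close>

definition lip :: real where "lip = 2 * K * \<nu>"

lemma lip_pos: "0 < lip" using K_gt_1 nu_gt_1 by (simp add: lip_def)

lemma quenched:
  assumes w: "\<omega> \<in> space M"
  shows "one_dim_diffusion (\<lambda>y. a y \<omega>) (\<lambda>y. b y \<omega>) K \<nu> (P 0 \<omega>)"
proof
  have "continuous_on UNIV h"
    if "\<And>x y. \<bar>h x - h y\<bar> \<le> K * \<bar>x - y\<bar>" for h :: "real \<Rightarrow> real"
  proof -
    have "K-lipschitz_on UNIV h"
      using that K_gt_1 by (intro lipschitz_onI) (auto simp: dist_real_def)
    then show ?thesis by (rule lipschitz_on_continuous_on)
  qed
  note Lip = this
  show "continuous_on UNIV (\<lambda>y. a y \<omega>)" "continuous_on UNIV (\<lambda>y. b y \<omega>)"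
  proof (rule_tac [!] Lip)
    fix x y
    show "\<bar>a x \<omega> - a y \<omega>\<bar> \<le> K * \<bar>x - y\<bar>" "\<bar>b x \<omega> - b y \<omega>\<bar> \<le> K * \<bar>x - y\<bar>"
      using coeff_Lipschitz[OF w, of x y] by linarith+
  qed
  show "0 < \<nu>" using nu_gt_1 by simp
  show "1 / \<nu> \<le> a x \<omega>" for x using elliptic[OF w] by simp
  show "\<bar>b x \<omega>\<bar> \<le> K" for x using coeff_bounded[OF w, of x] by linarith
  show "solves_martingale_problem (\<lambda>y. a y \<omega>) (\<lambda>y. b y \<omega>) 0 (P 0 \<omega>)"
    by (rule quenched_solution[OF w])
qed

definition slope :: "real \<Rightarrow> 'w \<Rightarrow> real" where "slope x \<omega> = 2 * b x \<omega> / a x \<omega>"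

lemma abs_slope_le: "\<omega> \<in> space M \<Longrightarrow> \<bar>slope x \<omega>\<bar> \<le> lip"
proof -
  assume w: "\<omega> \<in> space M"
  interpret one_dim_diffusion "\<lambda>y. a y \<omega>" "\<lambda>y. b y \<omega>" K \<nu> "P 0 \<omega>" by (rule quenched[OF w])
  have "1 \<le> a x \<omega> * \<nu>" using ellip[of x] nu_pos by (simp add: field_simps)
  have "2 * \<bar>b x \<omega>\<bar> \<le> 2 * K" using drift_bound[of x] by simp
  also have "\<dots> \<le> 2 * K * (a x \<omega> * \<nu>)"
    using \<open>1 \<le> a x \<omega> * \<nu>\<close> K_nonneg by (simp add: mult_le_cancel_left1)
  finally have "2 * \<bar>b x \<omega>\<bar> \<le> lip * a x \<omega>" by (simp add: lip_def algebra_simps)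
  then show ?thesis using alpha_pos[of x] by (simp add: slope_def abs_mult abs_divide pos_divide_le_eq)
qed

lemma slope_shift: "\<omega> \<in> space M \<Longrightarrow> slope x (\<tau> y \<omega>) = slope (x + y) \<omega>"
  by (simp add: slope_def a_stationary b_stationary)

lemma shift_meas [measurable]: "\<tau> x \<in> M \<rightarrow>\<^sub>M M"
proof -
  have "(\<lambda>\<omega>. (x, \<omega>)) \<in> M \<rightarrow>\<^sub>M borel \<Otimes>\<^sub>M M" by measurable
  from measurable_compose[OF this shift_measurable] show ?thesis by simp
qed

lemma shift_space: "\<omega> \<in> space M \<Longrightarrow> \<tau> x \<omega> \<in> space M"
  using measurable_space[OF shift_meas] .

lemma DERIV_env_pot: "\<omega> \<in> space M \<Longrightarrow> ((\<lambda>x. env_pot x \<omega>) has_real_derivative slope x \<omega>) (at x)"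
  using one_dim_diffusion.DERIV_potential[OF quenched] unfolding env_pot_def slope_def .

lemma DERIV_env_scale: "\<omega> \<in> space M \<Longrightarrow> ((\<lambda>x. env_scale x \<omega>) has_real_derivative exp (- env_pot x \<omega>)) (at x)"
  using one_dim_diffusion.DERIV_scale[OF quenched] unfolding env_pot_def env_scale_def .

lemma env_pot_0 [simp]: "env_pot 0 \<omega> = 0" and env_scale_0 [simp]: "env_scale 0 \<omega> = 0"
  by (simp_all add: env_pot_def env_scale_def potential_def scale_function_def)

lemma cont_slope: "\<omega> \<in> space M \<Longrightarrow> continuous_on UNIV (\<lambda>x. slope x \<omega>)"
  unfolding slope_def by (rule one_dim_diffusion.cont_ratio[OF quenched])

lemma cont_env_pot: "\<omega> \<in> space M \<Longrightarrow> continuous_on UNIV (\<lambda>x. env_pot x \<omega>)"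
  by (rule DERIV_continuous_on[OF has_field_derivative_at_within[OF DERIV_env_pot]])

text \<open>Stationarity makes the slope at \<open>x + y\<close> in \<open>\<omega>\<close> the
  slope at \<open>y\<close> in the shifted environment, so both sides have the same derivative in
  \<open>y\<close> and agree at \<open>y = 0\<close>.\<close>

lemma cocycle_env_pot:
  assumes w: "\<omega> \<in> space M"
  shows "env_pot (x + y) \<omega> = env_pot x \<omega> + env_pot y (\<tau> x \<omega>)"
proof -
  let ?D = "\<lambda>y. env_pot (x + y) \<omega> - env_pot y (\<tau> x \<omega>)"
  have "(?D has_real_derivative 0) (at y)" for y
  proof (rule DERIV_cong)
    show "(?D has_real_derivative slope (x + y) \<omega> * (0 + 1) - slope y (\<tau> x \<omega>)) (at y)"
      by (intro DERIV_diff DERIV_env_pot[OF shift_space[OF w]]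
          DERIV_chain2[where f="\<lambda>x. env_pot x \<omega>", OF DERIV_env_pot[OF w]] DERIV_add DERIV_const DERIV_ident)
    show "slope (x + y) \<omega> * (0 + 1) - slope y (\<tau> x \<omega>) = 0" by (simp add: slope_shift[OF w] add.commute)
  qed
  then have "?D y = ?D 0" by (intro DERIV_isconst_all) blast
  then show ?thesis by simp
qed

text \<open>Beyond \<open>x\<close> the density \<open>exp (- env_pot)\<close> factors by
  \<open>cocycle_env_pot\<close>. The case \<open>x = - L\<close>, \<open>y = L\<close> expresses
  the scale function on the left through the one on the right.\<close>

lemma cocycle_env_scale:
  assumes w: "\<omega> \<in> space M"
  shows "env_scale (x + y) \<omega> = env_scale x \<omega> + exp (- env_pot x \<omega>) * env_scale y (\<tau> x \<omega>)"
proof -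
  let ?D = "\<lambda>y. env_scale (x + y) \<omega> - exp (- env_pot x \<omega>) * env_scale y (\<tau> x \<omega>)"
  have "(?D has_real_derivative 0) (at y)" for y
  proof (rule DERIV_cong)
    show "(?D has_real_derivative exp (- env_pot (x + y) \<omega>) * (0 + 1) -
        exp (- env_pot x \<omega>) * exp (- env_pot y (\<tau> x \<omega>))) (at y)"
      by (intro DERIV_diff DERIV_cmult DERIV_env_scale[OF shift_space[OF w]]
          DERIV_chain2[where f="\<lambda>x. env_scale x \<omega>", OF DERIV_env_scale[OF w]] DERIV_add DERIV_const DERIV_ident)
    show "exp (- env_pot (x + y) \<omega>) * (0 + 1) - exp (- env_pot x \<omega>) * exp (- env_pot y (\<tau> x \<omega>)) = 0"
      by (simp add: cocycle_env_pot[OF w] mult_exp_exp)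
  qed
  then have "?D y = ?D 0" by (intro DERIV_isconst_all) blast
  then show ?thesis by simp
qed

lemma env_pot_Lipschitz:
  assumes w: "\<omega> \<in> space M"
  shows "\<bar>env_pot x \<omega> - env_pot y \<omega>\<bar> \<le> lip * \<bar>x - y\<bar>"
proof -
  have "norm (env_pot x \<omega> - env_pot y \<omega>) \<le> lip * norm (x - y)"
    by (rule field_differentiable_bound[of UNIV _ "\<lambda>x. slope x \<omega>"])
       (use DERIV_env_pot[OF w] abs_slope_le[OF w] in auto)
  then show ?thesis by simp
qed

lemma env_pot_bound: "\<omega> \<in> space M \<Longrightarrow> \<bar>env_pot x \<omega>\<bar> \<le> lip * \<bar>x\<bar>"
  using env_pot_Lipschitz[of \<omega> x 0] by simp

lemma env_scale_mean_value:
  assumes w: "\<omega> \<in> space M" and "x < y"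
  obtains z where "x < z" "z < y" "env_scale y \<omega> - env_scale x \<omega> = (y - x) * exp (- env_pot z \<omega>)"
  using MVT2[OF assms(2), of "\<lambda>x. env_scale x \<omega>" "\<lambda>x. exp (- env_pot x \<omega>)"] DERIV_env_scale[OF w] by blast

lemma env_scale_strict_mono: "\<omega> \<in> space M \<Longrightarrow> x < y \<Longrightarrow> env_scale x \<omega> < env_scale y \<omega>"
  unfolding env_scale_def by (rule one_dim_diffusion.scale_strict_mono[OF quenched])

lemma env_scale_pos: "\<omega> \<in> space M \<Longrightarrow> 0 < x \<Longrightarrow> 0 < env_scale x \<omega>"
  and env_scale_neg: "\<omega> \<in> space M \<Longrightarrow> x < 0 \<Longrightarrow> env_scale x \<omega> < 0"
  using env_scale_strict_mono[of \<omega> 0 x] env_scale_strict_mono[of \<omega> x 0] by auto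

text \<open>Crude but deterministic: for fixed \<open>L\<close> the logarithms of these quantities
  are bounded, hence integrable.\<close>

lemma env_scale_bounds:
  assumes w: "\<omega> \<in> space M" and "0 < L"
  shows "L * exp (- lip * L) \<le> env_scale L \<omega>" "env_scale L \<omega> \<le> L * exp (lip * L)"
    "L * exp (- lip * L) \<le> - env_scale (- L) \<omega>" "- env_scale (- L) \<omega> \<le> L * exp (lip * L)"
proof -
  have *: "exp (- lip * L) \<le> exp (- env_pot z \<omega>) \<and> exp (- env_pot z \<omega>) \<le> exp (lip * L)" if "\<bar>z\<bar> \<le> L" for z
  proof -
    have "\<bar>env_pot z \<omega>\<bar> \<le> lip * L"
      using env_pot_bound[OF w, of z] mult_left_mono[OF that, of lip] lip_pos by linarith
    then show ?thesis by (auto simp: abs_le_iff)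
  qed
  obtain z where z: "0 < z" "z < L" "env_scale L \<omega> - env_scale 0 \<omega> = (L - 0) * exp (- env_pot z \<omega>)"
    by (rule env_scale_mean_value[OF w assms(2)])
  then show "L * exp (- lip * L) \<le> env_scale L \<omega>" "env_scale L \<omega> \<le> L * exp (lip * L)"
    using *[of z] assms(2) by auto
  obtain z' where z': "- L < z'" "z' < 0" "env_scale 0 \<omega> - env_scale (- L) \<omega> = (0 - (- L)) * exp (- env_pot z' \<omega>)"
    by (rule env_scale_mean_value[OF w, of "- L" 0]) (use assms(2) in auto)
  then show "L * exp (- lip * L) \<le> - env_scale (- L) \<omega>" "- env_scale (- L) \<omega> \<le> L * exp (lip * L)"
    using *[of z'] assms(2) by auto
qed

lemma slope_measurable: "slope x \<in> borel_measurable M"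
  unfolding slope_def[abs_def]
  by (intro borel_measurable_divide borel_measurable_times borel_measurable_const a_measurable b_measurable)

lemma measurable_primitive:
  assumes "\<And>x. f x \<in> borel_measurable M" "\<And>\<omega>. \<omega> \<in> space M \<Longrightarrow> continuous_on UNIV (\<lambda>x. f x \<omega>)"
  shows "(\<lambda>\<omega>. primitive (\<lambda>x. f x \<omega>) y) \<in> borel_measurable M"
proof -
  have cs: "continuous_on A (\<lambda>x. f x \<omega>)" if "\<omega> \<in> space M" for A \<omega>
    by (rule continuous_on_subset[OF assms(2)[OF that] subset_UNIV])
  show ?thesis
  proof (cases "0 \<le> y")
    case True
    then show ?thesis
      unfolding primitive_nonneg_arg[OF True]
      by (intro measurable_integral_continuous_parameter assms(1) cs)
  next
    case False
    then have "y \<le> 0" by simp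
    then show ?thesis
      unfolding primitive_nonpos_arg[OF \<open>y \<le> 0\<close>]
      by (intro borel_measurable_uminus measurable_integral_continuous_parameter assms(1) cs)
  qed
qed

lemma env_pot_measurable [measurable]: "env_pot x \<in> borel_measurable M"
proof -
  have "env_pot x = (\<lambda>\<omega>. primitive (\<lambda>y. slope y \<omega>) x)"
    by (simp add: env_pot_def potential_def slope_def fun_eq_iff)
  then show ?thesis using measurable_primitive[of slope x, OF slope_measurable cont_slope] by simp
qed

lemma env_scale_measurable [measurable]: "env_scale x \<in> borel_measurable M"
proof -
  have "(\<lambda>\<omega>. exp (- env_pot y \<omega>)) \<in> borel_measurable M" for y by measurable
  moreover have "continuous_on UNIV (\<lambda>y. exp (- env_pot y \<omega>))" if "\<omega> \<in> space M" for \<omega>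
    by (intro continuous_intros cont_env_pot that)
  ultimately show ?thesis
    using measurable_primitive[of "\<lambda>y \<omega>. exp (- env_pot y \<omega>)" x]
    by (simp add: env_scale_def[abs_def] scale_function_def env_pot_def)
qed

lemma integral_shift:
  assumes "f \<in> borel_measurable M"
  shows "(\<integral>\<omega>. f (\<tau> x \<omega>) \<partial>M) = (\<integral>\<omega>. (f \<omega> :: real) \<partial>M)"
  using integral_distr[OF shift_meas[of x] assms] by (simp add: shift_preserving)

lemma AE_shift:
  assumes "AE \<omega> in M. Q \<omega>"
  shows "AE \<omega> in M. Q (\<tau> x \<omega>)"
proof -
  have "AE \<omega> in distr M M (\<tau> x). Q \<omega>" unfolding shift_preserving by (rule assms)
  then show ?thesis by (rule AE_distrD[OF shift_meas])
qed

lemma integrable_bounded: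
  assumes "f \<in> borel_measurable M" "\<And>\<omega>. \<omega> \<in> space M \<Longrightarrow> \<bar>f \<omega> :: real\<bar> \<le> B"
  shows "integrable M f"
  by (rule integrable_const_bound[where B=B]) (use assms in auto)

lemma rho_eq:
  assumes w: "\<omega> \<in> space M" and L: "0 < L"
  shows "rho (P 0) L \<omega> = env_scale L \<omega> / (- env_scale (- L) \<omega>)"
proof -
  interpret one_dim_diffusion "\<lambda>y. a y \<omega>" "\<lambda>y. b y \<omega>" K \<nu> "P 0 \<omega>" by (rule quenched[OF w])
  have "- L < 0" using L by simp
  note e = exit_probabilities[OF this L]
  have "env_scale L \<omega> - env_scale (- L) \<omega> > 0" using env_scale_pos[OF w L] env_scale_neg[OF w, of "- L"] L by simp
  then show ?thesis unfolding rho_def e env_scale_def[symmetric] by simp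
qed

text \<open>Seen from \<open>- L\<close>, the denominator of \<open>rho\<close> is
  \<open>exp (env_pot L) * env_scale L\<close> in the environment shifted by \<open>- L\<close>. So
  \<open>ln (rho (P 0) L)\<close> is a coboundary minus a copy of the potential.\<close>

lemma rho_eq_shift:
  assumes w: "\<omega> \<in> space M" and L: "0 < L"
  shows "ln (rho (P 0) L \<omega>) = ln (env_scale L \<omega>) - ln (env_scale L (\<tau> (- L) \<omega>)) - env_pot L (\<tau> (- L) \<omega>)"
    and "\<bar>ln (rho (P 0) L \<omega>)\<bar> \<le> 2 * lip * L" and "0 < rho (P 0) L \<omega>"
proof -
  have env_pot: "env_pot (- L) \<omega> = - env_pot L (\<tau> (- L) \<omega>)" using cocycle_env_pot[OF w, of "- L" L] by simp
  have "- env_scale (- L) \<omega> = exp (env_pot L (\<tau> (- L) \<omega>)) * env_scale L (\<tau> (- L) \<omega>)"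
    using cocycle_env_scale[OF w, of "- L" L] env_pot by simp
  moreover have "0 < env_scale L \<omega>" "0 < env_scale L (\<tau> (- L) \<omega>)" using env_scale_pos w shift_space L by auto
  ultimately show "ln (rho (P 0) L \<omega>) = ln (env_scale L \<omega>) - ln (env_scale L (\<tau> (- L) \<omega>)) - env_pot L (\<tau> (- L) \<omega>)"
    by (simp add: rho_eq[OF w L] ln_div ln_mult)
  show pos: "0 < rho (P 0) L \<omega>"
    using env_scale_pos[OF w L] env_scale_neg[OF w, of "- L"] L by (simp add: rho_eq[OF w L] field_simps)
  have p: "0 < env_scale L \<omega>" "0 < - env_scale (- L) \<omega>" using env_scale_pos[OF w L] env_scale_neg[OF w, of "- L"] L by auto
  have *: "\<bar>ln x - ln L\<bar> \<le> lip * L" if "L * exp (- lip * L) \<le> x" "x \<le> L * exp (lip * L)" for x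
  proof -
    have "ln (L * exp (- lip * L)) \<le> ln x" "ln x \<le> ln (L * exp (lip * L))"
      using that L less_le_trans[OF _ that(1), of 0] by (auto intro!: ln_mono)
    then show ?thesis using L by (auto simp: ln_mult abs_le_iff)
  qed
  have "ln (rho (P 0) L \<omega>) = ln (env_scale L \<omega>) - ln (- env_scale (- L) \<omega>)"
    unfolding rho_eq[OF w L] using p by (intro ln_divide_pos) auto
  then show "\<bar>ln (rho (P 0) L \<omega>)\<bar> \<le> 2 * lip * L"
    using *[OF env_scale_bounds(1,2)[OF w L]] *[OF env_scale_bounds(3,4)[OF w L]] by linarith
qed

lemma rho_measurable:
  assumes "0 < L" shows "rho (P 0) L \<in> borel_measurable M"
proof -
  have "(\<lambda>\<omega>. env_scale L \<omega> / (- env_scale (- L) \<omega>)) \<in> borel_measurable M" by measurable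
  then show ?thesis by (rule measurable_cong[THEN iffD1, rotated]) (simp add: rho_eq assms)
qed

text \<open>The two \<open>ln (env_scale L)\<close> terms are integrable and have the same mean by
  stationarity, so only the potential survives.\<close>

lemma integral_ln_rho:
  assumes L: "0 < L"
  shows "integrable M (\<lambda>\<omega>. ln (rho (P 0) L \<omega>))" "(\<integral>\<omega>. ln (rho (P 0) L \<omega>) \<partial>M) = - (\<integral>\<omega>. env_pot L \<omega> \<partial>M)"
proof -
  note [measurable] = rho_measurable[OF L]
  show "integrable M (\<lambda>\<omega>. ln (rho (P 0) L \<omega>))"
    by (rule integrable_bounded[where B="2 * lip * L"]) (auto intro: rho_eq_shift(2)[OF _ L])
  have iS: "integrable M (\<lambda>\<omega>. ln (env_scale L \<omega>))"
  proof (rule integrable_bounded)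
    fix \<omega> assume w: "\<omega> \<in> space M"
    have "ln (L * exp (- lip * L)) \<le> ln (env_scale L \<omega>)" "ln (env_scale L \<omega>) \<le> ln (L * exp (lip * L))"
      using env_scale_bounds(1,2)[OF w L] env_scale_pos[OF w L] L by (auto intro!: ln_mono)
    then show "\<bar>ln (env_scale L \<omega>)\<bar> \<le> \<bar>ln L\<bar> + lip * L" using L by (auto simp: ln_mult)
  qed measurable
  have iV: "integrable M (env_pot L)"
    by (rule integrable_bounded) (use env_pot_bound in auto)
  have shift: "integrable M (\<lambda>\<omega>. f (\<tau> (- L) \<omega>))" if "integrable M f" for f :: "'w \<Rightarrow> real"
    using integrable_distr[OF shift_meas[of "- L"], of f] that unfolding shift_preserving by simp
  have "(\<integral>\<omega>. ln (rho (P 0) L \<omega>) \<partial>M) =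
      (\<integral>\<omega>. ln (env_scale L \<omega>) - ln (env_scale L (\<tau> (- L) \<omega>)) - env_pot L (\<tau> (- L) \<omega>) \<partial>M)"
    by (intro Bochner_Integration.integral_cong refl rho_eq_shift(1) L)
  also have "\<dots> = (\<integral>\<omega>. ln (env_scale L \<omega>) \<partial>M) - (\<integral>\<omega>. ln (env_scale L (\<tau> (- L) \<omega>)) \<partial>M) - (\<integral>\<omega>. env_pot L (\<tau> (- L) \<omega>) \<partial>M)"
    using iS shift[OF iS] shift[OF iV] by simp
  also have "\<dots> = - (\<integral>\<omega>. env_pot L \<omega> \<partial>M)"
    using integral_shift[of "\<lambda>\<omega>. ln (env_scale L \<omega>)" "- L"] integral_shift[of "env_pot L" "- L"] by simp
  finally show "(\<integral>\<omega>. ln (rho (P 0) L \<omega>) \<partial>M) = - (\<integral>\<omega>. env_pot L \<omega> \<partial>M)" .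
qed

end

subsection \<open>Exponential moments of the potential\<close>

text \<open>For negative \<open>x = - y\<close> this follows from \<open>exp y \<ge> 1 + y\<close>
  and \<open>(1 - y + y\<^sup>2) * (1 + y) = 1 + y ^ 3\<close>.\<close>

lemma exp_le_quadratic:
  fixes x :: real
  assumes "x \<le> 1"
  shows "exp x \<le> 1 + x + x\<^sup>2"
proof (cases "0 \<le> x")
  case True
  then show ?thesis using exp_bound assms by simp
next
  case False
  define y where "y = - x"
  have y: "0 < y" using False by (simp add: y_def)
  have "exp x = 1 / exp y" by (simp add: y_def exp_minus inverse_eq_divide)
  also have "\<dots> \<le> 1 / (1 + y)"
    using y exp_ge_add_one_self[of y] by (intro divide_left_mono) auto
  also have "\<dots> \<le> 1 - y + y\<^sup>2"
  proof -
    have "(1 - y + y\<^sup>2) * (1 + y) = 1 + y ^ 3" by (simp add: algebra_simps power2_eq_square power3_eq_cube)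
    then have "1 \<le> (1 - y + y\<^sup>2) * (1 + y)" using y by simp
    then show ?thesis using y by (simp add: pos_divide_le_eq)
  qed
  finally show ?thesis by (simp add: y_def)
qed

text \<open>The second-order bound \<open>1 - s * m + s\<^sup>2 * B\<^sup>2\<close> on the moment is
  minimal at the \<open>s\<close> chosen below, with value \<open>1 - s * m / 2\<close>. It is
  applied to the potential and, in passing from (ii) to (i), to \<open>- ln \<rho>\<close>.\<close>

lemma (in prob_space) exponential_moment_less_1:
  fixes X :: "'a \<Rightarrow> real"
  assumes X [measurable]: "X \<in> borel_measurable M" and B: "\<And>\<omega>. \<omega> \<in> space M \<Longrightarrow> \<bar>X \<omega>\<bar> \<le> B" "1 \<le> B"
    and pos: "0 < expectation X"
  obtains s where "0 < s" "s \<le> 1" "expectation (\<lambda>\<omega>. exp (- s * X \<omega>)) < 1"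
proof -
  define m where "m = expectation X"
  have iX: "integrable M X" by (rule integrable_const_bound[where B=B]) (use B in auto)
  have "m \<le> expectation (\<lambda>_. B)" unfolding m_def
    by (rule integral_mono) (use iX B(1) in \<open>auto simp: abs_le_iff\<close>)
  then have mB: "m \<le> B" by (simp add: prob_space)
  \<comment> \<open>\<open>m \<le> B\<close> gives \<open>s * B \<le> 1\<close>, the range of
    \<open>exp_le_quadratic\<close>; \<open>1 \<le> B\<close> then gives
    \<open>s \<le> 1\<close>.\<close>
  define s where "s = m / (2 * B\<^sup>2)"
  have s0: "0 < s" using pos B(2) by (simp add: s_def m_def)
  have sB: "s * B \<le> 1"
    using mB B(2) by (simp add: s_def power2_eq_square)
  have "s * 1 \<le> s * B" using B(2) s0 by (intro mult_left_mono) auto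
  with sB have s1: "s \<le> 1" by linarith
  have le: "exp (- s * X \<omega>) \<le> 1 - s * X \<omega> + s\<^sup>2 * B\<^sup>2" if "\<omega> \<in> space M" for \<omega>
  proof -
    have "\<bar>s * X \<omega>\<bar> \<le> s * B" using B(1)[OF that] s0 by (simp add: abs_mult)
    then have "- s * X \<omega> \<le> 1" "(s * X \<omega>)\<^sup>2 \<le> (s * B)\<^sup>2"
      using sB abs_le_square_iff[of "s * X \<omega>" "s * B"] B(2) s0 by (auto simp: abs_le_iff)
    with exp_le_quadratic[of "- s * X \<omega>"] show ?thesis by (simp add: power_mult_distrib)
  qed
  have ie: "integrable M (\<lambda>\<omega>. exp (- s * X \<omega>))"
  proof (rule integrable_const_bound[where B="exp 1"])
    show "AE \<omega> in M. norm (exp (- s * X \<omega>)) \<le> exp 1"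
    proof (rule AE_I2)
      fix \<omega> assume "\<omega> \<in> space M"
      then have "\<bar>s * X \<omega>\<bar> \<le> s * B" using B(1) s0 by (simp add: abs_mult)
      then show "norm (exp (- s * X \<omega>)) \<le> exp 1" using sB by (auto simp: abs_le_iff)
    qed
  qed measurable
  have "expectation (\<lambda>\<omega>. exp (- s * X \<omega>)) \<le> expectation (\<lambda>\<omega>. 1 - s * X \<omega> + s\<^sup>2 * B\<^sup>2)"
    by (rule integral_mono) (use ie iX le in auto)
  also have "\<dots> = 1 - s * m + s\<^sup>2 * B\<^sup>2" using iX by (simp add: prob_space m_def)
  also have "s\<^sup>2 * B\<^sup>2 = s * m / 2"
    using B(2) by (simp add: s_def power2_eq_square)
  also have "1 - s * m + s * m / 2 < 1" using s0 pos by (simp add: m_def)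
  finally show thesis using that s0 s1 by blast
qed

text \<open>By monotone convergence sum and expectation commute, and a nonnegative series with
  finite mean is finite almost surely.\<close>

lemma (in prob_space) AE_summable_of_expectations:
  fixes f :: "nat \<Rightarrow> 'a \<Rightarrow> real"
  assumes i: "\<And>n. integrable M (f n)" and nn: "\<And>n \<omega>. 0 \<le> f n \<omega>"
    and le: "\<And>n. expectation (f n) \<le> r n" and r: "summable r"
  shows "AE \<omega> in M. summable (\<lambda>n. f n \<omega>)"
proof -
  have [measurable]: "f n \<in> borel_measurable M" for n using i by (rule borel_measurable_integrable)
  have r0: "0 \<le> r n" for n
    by (rule order_trans[OF Bochner_Integration.integral_nonneg le]) (rule nn)
  have "(\<integral>\<^sup>+\<omega>. (\<Sum>n. ennreal (f n \<omega>)) \<partial>M) = (\<Sum>n. \<integral>\<^sup>+\<omega>. ennreal (f n \<omega>) \<partial>M)"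
    by (rule nn_integral_suminf) measurable
  also have "\<dots> \<le> (\<Sum>n. ennreal (r n))"
    using nn_integral_eq_integral[OF i] nn le by (intro suminf_le) (auto intro: ennreal_leI)
  also have "\<dots> = ennreal (suminf r)" by (rule suminf_ennreal2[OF r0 r])
  finally have "(\<integral>\<^sup>+\<omega>. (\<Sum>n. ennreal (f n \<omega>)) \<partial>M) \<noteq> \<infinity>" by (auto simp: top_unique)
  then have "AE \<omega> in M. (\<Sum>n. ennreal (f n \<omega>)) \<noteq> \<infinity>"
    by (intro nn_integral_PInf_AE) measurable
  then show ?thesis by eventually_elim (auto intro: summable_suminf_not_top nn)
qed

section \<open>Independence of separated blocks and decay of fractional moments\<close>

context diffusion_in_random_environment
begin

text \<open>The events \<open>env_events\<close> packaged as a measure, so that measurability of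
  functions can be expressed.\<close>

definition env :: "real set \<Rightarrow> 'w measure" where
  "env A = sigma (space M)
      ({a x -` B \<inter> space M | x B. x \<in> A \<and> B \<in> sets borel} \<union>
       {b x -` B \<inter> space M | x B. x \<in> A \<and> B \<in> sets borel})"

lemma space_env [simp]: "space (env A) = space M"
  unfolding env_def by (rule space_measure_of) auto

lemma sets_env: "sets (env A) = env_events M a b A"
  unfolding env_def env_events_def by (rule sets_measure_of) auto

lemma sets_env_subset: "sets (env A) \<subseteq> sets M"
  unfolding sets_env env_events_def
  by (rule sets.sigma_sets_subset) (auto intro: measurable_sets[OF a_measurable] measurable_sets[OF b_measurable])

lemma env_measurable_coeff:
  assumes "x \<in> A"
  shows "a x \<in> borel_measurable (env A)" "b x \<in> borel_measurable (env A)"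
proof -
  have "f x \<in> borel_measurable (env A)"
    if "\<And>B. B \<in> sets borel \<Longrightarrow> f x -` B \<inter> space M \<in> env_events M a b A" for f :: "real \<Rightarrow> 'w \<Rightarrow> real"
    by (rule measurableI) (use that in \<open>auto simp: sets_env\<close>)
  then show "a x \<in> borel_measurable (env A)" "b x \<in> borel_measurable (env A)"
    unfolding env_events_def using assms by (blast intro: sigma_sets.Basic)+
qed

lemma env_measurable_slope: "x \<in> A \<Longrightarrow> slope x \<in> borel_measurable (env A)"
  unfolding slope_def[abs_def]
  by (intro borel_measurable_divide borel_measurable_times borel_measurable_const env_measurable_coeff)

text \<open>The increment is the integral of the slope over \<open>{u..v}\<close>, so it depends on
  the environment there only, whereas \<open>env_pot v\<close> by itself involves everything between
  \<open>0\<close> and \<open>v\<close>.\<close>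

lemma env_measurable_increment:
  assumes "u \<le> v" "{u..v} \<subseteq> A"
  shows "(\<lambda>\<omega>. env_pot v \<omega> - env_pot u \<omega>) \<in> borel_measurable (env A)"
proof -
  have "(\<lambda>\<omega>. LBINT x:{u..v}. slope x \<omega>) \<in> borel_measurable (env A)"
    by (rule measurable_integral_continuous_parameter)
       (use assms env_measurable_slope continuous_on_subset[OF cont_slope subset_UNIV] in auto)
  then show ?thesis
  proof (rule measurable_cong[THEN iffD1, rotated])
    fix \<omega> assume "\<omega> \<in> space (env A)"
    then have "\<omega> \<in> space M" by simp
    from primitive_diff[OF cont_slope[OF this] assms(1)]
    show "(LBINT x:{u..v}. slope x \<omega>) = env_pot v \<omega> - env_pot u \<omega>"
      by (simp add: env_pot_def potential_def slope_def)
  qed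
qed

lemma env_indep:
  fixes X Y :: "'w \<Rightarrow> real"
  assumes X: "X \<in> borel_measurable (env A)" and Y: "Y \<in> borel_measurable (env B)"
    and AB: "R \<le> setdist A B"
  shows "indep_var borel X borel Y"
proof -
  have sub: "sigma_sets (space M) {Z -` C \<inter> space M | C. C \<in> sets borel} \<subseteq> env_events M a b D"
    if "Z \<in> borel_measurable (env D)" for Z :: "'w \<Rightarrow> real" and D
  proof -
    have "sigma_sets (space (env D)) {Z -` C \<inter> space M | C. C \<in> sets borel} \<subseteq> sets (env D)"
      using measurable_sets[OF that] by (intro sets.sigma_sets_subset) auto
    then show ?thesis by (simp add: sets_env)
  qed
  have rv: "random_variable borel Z" if "Z \<in> borel_measurable (env D)" for Z :: "'w \<Rightarrow> real" and D
    using that sets_env_subset[of D] by (auto simp: measurable_def)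
  have "indep_set (env_events M a b A) (env_events M a b B)" by (rule finite_range[OF AB])
  then show ?thesis
    unfolding indep_var_eq indep_sets2_eq using sub[OF X] sub[OF Y] rv[OF X] rv[OF Y] by blast
qed

definition moment :: "real \<Rightarrow> real \<Rightarrow> real" where
  "moment L s = expectation (\<lambda>\<omega>. exp (- s * env_pot L \<omega>))"

text \<open>Intervals of length \<open>L\<close> separated by gaps of length \<open>L\<close>: for
  \<open>R \<le> L\<close> the blocks with a common \<open>u\<close> are far enough apart to be
  independent. The families \<open>u = 0\<close> and \<open>u = L\<close> interleave and fill
  \<open>{0..2 * real n * L}\<close>.\<close>

definition block :: "real \<Rightarrow> real \<Rightarrow> nat \<Rightarrow> 'w \<Rightarrow> real" where
  "block L u k \<omega> = env_pot (u + (2 * real k + 1) * L) \<omega> - env_pot (u + 2 * real k * L) \<omega>"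

lemma block_shift: "\<omega> \<in> space M \<Longrightarrow> block L u k \<omega> = env_pot L (\<tau> (u + 2 * real k * L) \<omega>)"
  using cocycle_env_pot[of \<omega> "u + 2 * real k * L" L] by (simp add: block_def algebra_simps)

lemma block_bound: "\<omega> \<in> space M \<Longrightarrow> 0 \<le> L \<Longrightarrow> \<bar>block L u k \<omega>\<bar> \<le> lip * L"
  using env_pot_bound[OF shift_space, of \<omega> L] by (simp add: block_shift)

lemma block_measurable [measurable]: "block L u k \<in> borel_measurable M"
  unfolding block_def[abs_def] by measurable

lemma exp_block_bound: "\<omega> \<in> space M \<Longrightarrow> 0 \<le> L \<Longrightarrow> 0 \<le> s \<Longrightarrow> exp (- s * block L u k \<omega>) \<le> exp (s * (lip * L))"
  using block_bound[of \<omega> L u k] mult_left_mono[of "- block L u k \<omega>" "lip * L" s] by (auto simp: abs_le_iff)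

lemma block_product_integrable:
  assumes "0 \<le> L" "0 \<le> s"
  shows "integrable M (\<lambda>\<omega>. \<Prod>k<n. exp (- s * block L u k \<omega>))"
proof (rule integrable_bounded)
  fix \<omega> assume w: "\<omega> \<in> space M"
  have "\<bar>\<Prod>k<n. exp (- s * block L u k \<omega>)\<bar> = (\<Prod>k<n. exp (- s * block L u k \<omega>))"
    by (intro abs_of_nonneg prod_nonneg) auto
  also have "\<dots> \<le> (\<Prod>k<n. exp (s * (lip * L)))"
    by (intro prod_mono) (use exp_block_bound[OF w assms] in auto)
  finally show "\<bar>\<Prod>k<n. exp (- s * block L u k \<omega>)\<bar> \<le> (\<Prod>k<n. exp (s * (lip * L)))" .
qed measurable

text \<open>Induction on \<open>n\<close>: the first \<open>n\<close> blocks and the next one depend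
  on the environment in sets at distance at least \<open>L \<ge> R\<close>, so the expectation
  factors, and stationarity turns the new factor into \<open>moment L s\<close>.\<close>

lemma block_product:
  assumes L: "R \<le> L" and s: "0 \<le> s"
  shows "expectation (\<lambda>\<omega>. \<Prod>k<n. exp (- s * block L u k \<omega>)) = moment L s ^ n"
proof (induction n)
  case 0
  then show ?case by (simp add: prob_space)
next
  case (Suc n)
  have L0: "0 < L" using L R_pos by simp
  \<comment> \<open>The half-line contains all earlier blocks and is nonempty even for
    \<open>n = 0\<close>; \<open>setdist\<close> to an empty set would be \<open>0\<close>.\<close>
  let ?A = "{..u + (2 * real n - 1) * L}" and ?B = "{u + 2 * real n * L..u + (2 * real n + 1) * L}"
  let ?X = "\<lambda>\<omega>. \<Prod>k<n. exp (- s * block L u k \<omega>)" and ?Y = "\<lambda>\<omega>. exp (- s * block L u n \<omega>)"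
  have "block L u k \<in> borel_measurable (env ?A)" if "k < n" for k
    unfolding block_def[abs_def]
  proof (rule env_measurable_increment)
    have "2 * real k + 1 \<le> 2 * real n - 1" using that by linarith
    then have "(2 * real k + 1) * L \<le> (2 * real n - 1) * L" using L0 by (intro mult_right_mono) auto
    then show "{u + 2 * real k * L..u + (2 * real k + 1) * L} \<subseteq> ?A" by auto
  qed (use L0 in \<open>simp add: algebra_simps\<close>)
  then have X: "?X \<in> borel_measurable (env ?A)"
    by (intro borel_measurable_prod measurable_compose[OF _ borel_measurable_exp]
        borel_measurable_times borel_measurable_const) auto
  have "block L u n \<in> borel_measurable (env ?B)"
    unfolding block_def[abs_def] using L0 by (intro env_measurable_increment) (auto simp: algebra_simps)
  then have Y: "?Y \<in> borel_measurable (env ?B)"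
    by (intro measurable_compose[OF _ borel_measurable_exp] borel_measurable_times borel_measurable_const)
  have "L \<le> setdist ?A ?B"
  proof (rule le_setdistI)
    show "?B \<noteq> {}" using L0 by (simp add: algebra_simps)
    show "L \<le> dist x y" if "x \<in> ?A" "y \<in> ?B" for x y
      using that L0 by (auto simp: dist_real_def algebra_simps)
  qed simp
  then have ind: "indep_var borel ?X borel ?Y" using L by (intro env_indep[OF X Y]) simp
  have iX: "integrable M ?X" using L0 s by (intro block_product_integrable) auto
  have iY: "integrable M ?Y"
    by (rule integrable_bounded[where B="exp (s * (lip * L))"])
       (use exp_block_bound L0 s in auto)
  have "expectation (\<lambda>\<omega>. \<Prod>k<Suc n. exp (- s * block L u k \<omega>)) = expectation ?X * expectation ?Y"
    using indep_var_lebesgue_integral[OF ind iX iY] by simp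
  also have "expectation ?Y = expectation (\<lambda>\<omega>. exp (- s * env_pot L (\<tau> (u + 2 * real n * L) \<omega>)))"
    by (intro Bochner_Integration.integral_cong) (auto simp: block_shift)
  also have "\<dots> = moment L s"
    unfolding moment_def by (rule integral_shift) measurable
  finally show ?case using Suc by simp
qed

lemma env_pot_blocks: "env_pot (2 * real n * L) \<omega> = (\<Sum>k<n. block L 0 k \<omega> + block L L k \<omega>)"
  by (induction n) (simp_all add: block_def algebra_simps)

text \<open>Every other block is independent; the two families are decoupled by
  \<open>x y \<le> (x\<^sup>2 + y\<^sup>2) / 2\<close>.\<close>

lemma moment_blocks:
  assumes L: "R \<le> L" and s: "0 \<le> s"
  shows "moment (2 * real n * L) s \<le> moment L (2 * s) ^ n"
proof -
  have L0: "0 < L" using L R_pos by simp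
  let ?X = "\<lambda>u \<omega>. \<Prod>k<n. exp (- (2 * s) * block L u k \<omega>)"
  have i: "integrable M (?X u)" for u using L0 s by (intro block_product_integrable) auto
  have "moment (2 * real n * L) s \<le> expectation (\<lambda>\<omega>. (?X 0 \<omega> + ?X L \<omega>) / 2)"
    unfolding moment_def
  proof (rule integral_mono)
    show "integrable M (\<lambda>\<omega>. exp (- s * env_pot (2 * real n * L) \<omega>))"
    proof (rule integrable_bounded)
      fix \<omega> assume w: "\<omega> \<in> space M"
      have "- s * env_pot (2 * real n * L) \<omega> \<le> s * (lip * \<bar>2 * real n * L\<bar>)"
        using mult_left_mono[of "- env_pot (2 * real n * L) \<omega>" "lip * \<bar>2 * real n * L\<bar>" s] env_pot_bound[OF w, of "2 * real n * L"] s
        by (auto simp: abs_le_iff)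
      then show "\<bar>exp (- s * env_pot (2 * real n * L) \<omega>)\<bar> \<le> exp (s * (lip * \<bar>2 * real n * L\<bar>))" by simp
    qed measurable
    show "integrable M (\<lambda>\<omega>. (?X 0 \<omega> + ?X L \<omega>) / 2)" using i by auto
    show "exp (- s * env_pot (2 * real n * L) \<omega>) \<le> (?X 0 \<omega> + ?X L \<omega>) / 2" for \<omega>
    proof -
      \<comment> \<open>The decoupling squares \<open>x\<close>, which is why the bound involves
        \<open>moment L (2 * s)\<close>.\<close>
      define x where "x u = exp (- s * (\<Sum>k<n. block L u k \<omega>))" for u
      have X: "?X u \<omega> = (x u)\<^sup>2" for u
        by (simp add: x_def exp_sum[symmetric] exp_double[symmetric] sum_distrib_left mult.assoc)
      have "exp (- s * env_pot (2 * real n * L) \<omega>) = x 0 * x L"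
        unfolding x_def mult_exp_exp env_pot_blocks sum.distrib by (simp add: algebra_simps)
      also have "\<dots> \<le> ((x 0)\<^sup>2 + (x L)\<^sup>2) / 2"
        using sum_squares_bound[of "x 0" "x L"] by simp
      finally show ?thesis by (simp only: X)
    qed
  qed
  also have "\<dots> = moment L (2 * s) ^ n"
    using block_product[OF L, of "2 * s"] i s by simp
  finally show ?thesis .
qed

lemma moment_integrable: "integrable M (\<lambda>\<omega>. exp (- s * env_pot y \<omega>))"
proof (rule integrable_bounded)
  fix \<omega> assume w: "\<omega> \<in> space M"
  have "- s * env_pot y \<omega> \<le> \<bar>s\<bar> * (lip * \<bar>y\<bar>)"
    using mult_left_mono[OF env_pot_bound[OF w, of y], of "\<bar>s\<bar>"] abs_ge_self[of "- s * env_pot y \<omega>"] by (simp add: abs_mult)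
  then show "\<bar>exp (- s * env_pot y \<omega>)\<bar> \<le> exp (\<bar>s\<bar> * (lip * \<bar>y\<bar>))" by simp
qed measurable

lemma exponential_decay:
  assumes L: "R \<le> L" and pos: "0 < expectation (env_pot L)"
  obtains s \<delta> C where "0 < s" "s \<le> 1" "0 < \<delta>" "0 < C" "\<And>y. 0 \<le> y \<Longrightarrow> moment y s \<le> C * exp (- \<delta> * y)"
proof -
  have L0: "0 < L" using L R_pos by simp
  obtain s' where s': "0 < s'" "s' \<le> 1" "expectation (\<lambda>\<omega>. exp (- s' * env_pot L \<omega>)) < 1"
  proof (rule exponential_moment_less_1[of "env_pot L" "max 1 (lip * L)"])
    show "\<bar>env_pot L \<omega>\<bar> \<le> max 1 (lip * L)" if "\<omega> \<in> space M" for \<omega> using env_pot_bound[OF that, of L] L0 by simp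
  qed (use pos in auto)
  \<comment> \<open>Half of \<open>s'\<close>, because \<open>moment_blocks\<close> doubles the
    exponent.\<close>
  define s where "s = s' / 2"
  define q where "q = moment L (2 * s)"
  have s: "0 < s" "s \<le> 1" "2 * s = s'" using s' by (auto simp: s_def)
  have q1: "q < 1" using s' s by (simp add: q_def moment_def)
  have q0: "0 < q"
  proof -
    have "exp (- s' * (lip * L)) = expectation (\<lambda>\<omega>. exp (- s' * (lip * L)))" by (simp add: prob_space)
    also have "\<dots> \<le> q" unfolding q_def moment_def s(3)
      by (rule integral_mono) (use moment_integrable env_pot_bound[of _ L] s' L0 in \<open>auto simp: abs_le_iff\<close>)
    finally show ?thesis by (rule less_le_trans[rotated]) simp
  qed
  \<comment> \<open>Each stretch of length \<open>2 * L\<close> contributes a factor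
    \<open>q\<close>. In \<open>C\<close>, the exponential pays for the part of \<open>y\<close>
    beyond the last full stretch, and \<open>1 / q\<close> for rounding the number of stretches
    down.\<close>
  define \<delta> where "\<delta> = - ln q / (2 * L)"
  define C where "C = exp (s * (lip * (2 * L))) / q"
  have d0: "0 < \<delta>" using q0 q1 L0 by (simp add: \<delta>_def divide_neg_pos)
  have C0: "0 < C" using q0 by (simp add: C_def)
  have "moment y s \<le> C * exp (- \<delta> * y)" if y: "0 \<le> y" for y
  proof -
    define n where "n = nat \<lfloor>y / (2 * L)\<rfloor>"
    have "real n \<le> y / (2 * L)" "y / (2 * L) \<le> real n + 1"
      using y L0 unfolding n_def by (auto simp: of_nat_nat) 
    then have n: "2 * real n * L \<le> y" "y \<le> 2 * real n * L + 2 * L" "y / (2 * L) - 1 \<le> real n"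
      using L0 by (auto simp: field_simps)
    have "moment y s \<le> expectation (\<lambda>\<omega>. exp (s * (lip * (2 * L))) * exp (- s * env_pot (2 * real n * L) \<omega>))"
      unfolding moment_def
    proof (rule integral_mono)
      fix \<omega> assume w: "\<omega> \<in> space M"
      have "\<bar>env_pot y \<omega> - env_pot (2 * real n * L) \<omega>\<bar> \<le> lip * \<bar>y - 2 * real n * L\<bar>" by (rule env_pot_Lipschitz[OF w])
      also have "\<dots> \<le> lip * (2 * L)" using n lip_pos by (intro mult_left_mono) auto
      finally have "env_pot (2 * real n * L) \<omega> - env_pot y \<omega> \<le> lip * (2 * L)" by linarith
      then have "s * (env_pot (2 * real n * L) \<omega> - env_pot y \<omega>) \<le> s * (lip * (2 * L))" using s by (intro mult_left_mono) auto
      then show "exp (- s * env_pot y \<omega>) \<le> exp (s * (lip * (2 * L))) * exp (- s * env_pot (2 * real n * L) \<omega>)"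
        by (simp add: mult_exp_exp algebra_simps)
    qed (use moment_integrable in auto)
    also have "\<dots> = exp (s * (lip * (2 * L))) * moment (2 * real n * L) s" by (simp add: moment_def)
    also have "\<dots> \<le> exp (s * (lip * (2 * L))) * q ^ n"
      unfolding q_def using moment_blocks[OF L, of s n] s by (intro mult_left_mono) auto
    also have "q ^ n = exp (real n * ln q)" using q0 by (simp add: exp_of_nat_mult)
    also have "\<dots> \<le> exp ((y / (2 * L) - 1) * ln q)"
      using mult_right_mono_neg[OF n(3), of "ln q"] q0 q1 by simp
    also have "\<dots> = exp (- \<delta> * y) / q"
      using q0 L0 by (simp add: \<delta>_def left_diff_distrib exp_diff)
    finally show ?thesis by (simp add: C_def)
  qed
  with that s d0 C0 show thesis by blast
qed

subsection \<open>Transience\<close>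

text \<open>By the Lipschitz bound, \<open>exp (- env_pot)\<close> on a unit interval is at most
  \<open>exp lip\<close> times its value at the left end.\<close>

lemma env_scale_le_sum:
  assumes w: "\<omega> \<in> space M"
  shows "env_scale (real n) \<omega> \<le> exp lip * (\<Sum>k<n. exp (- env_pot (real k) \<omega>))"
proof (induction n)
  case (Suc n)
  obtain z where z: "real n < z" "z < real (Suc n)"
    "env_scale (real (Suc n)) \<omega> - env_scale (real n) \<omega> = (real (Suc n) - real n) * exp (- env_pot z \<omega>)"
    by (rule env_scale_mean_value[OF w, of "real n" "real (Suc n)"]) auto
  have "\<bar>env_pot z \<omega> - env_pot (real n) \<omega>\<bar> \<le> lip * \<bar>z - real n\<bar>" by (rule env_pot_Lipschitz[OF w])
  also have "\<dots> \<le> lip * 1" using z lip_pos by (intro mult_left_mono) auto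
  finally have "- env_pot z \<omega> \<le> lip + - env_pot (real n) \<omega>" by linarith
  then have "exp (- env_pot z \<omega>) \<le> exp lip * exp (- env_pot (real n) \<omega>)" by (simp only: mult_exp_exp exp_le_cancel_iff)
  with z(3) Suc show ?case by (simp add: algebra_simps)
qed simp

lemma env_pot_neg: "\<omega> \<in> space M \<Longrightarrow> env_pot (- x) \<omega> = - env_pot x (\<tau> (- x) \<omega>)"
  using cocycle_env_pot[of \<omega> "- x" x] by simp

text \<open>Decay of \<open>moment n s\<close> makes the series of
  \<open>exp (- s * env_pot n)\<close> converge almost surely. Hence \<open>env_pot n > 0\<close>
  eventually, and as \<open>s \<le> 1\<close> the series then dominates that of
  \<open>exp (- env_pot n)\<close>. On the left the shift makes \<open>env_pot (- n)\<close> a copy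
  of \<open>- env_pot n\<close>; there the potential is eventually negative at integers, so the
  scale function has slope at least \<open>exp (- lip)\<close>.\<close>

lemma AE_scale_limits:
  assumes L: "R \<le> L" and pos: "0 < expectation (env_pot L)"
  shows "AE \<omega> in M. (\<exists>B. \<forall>x. env_scale x \<omega> \<le> B) \<and> (\<forall>A. \<exists>u<0. env_scale u \<omega> < A)"
proof -
  obtain s \<delta> C where s: "0 < s" "s \<le> 1" "0 < \<delta>" "0 < C" "\<And>y. 0 \<le> y \<Longrightarrow> moment y s \<le> C * exp (- \<delta> * y)"
    using exponential_decay[OF L pos] by blast
  have "summable (\<lambda>n. C * exp (- \<delta>) ^ n)" using s by (intro summable_mult summable_geometric) simp
  then have sum: "summable (\<lambda>n::nat. C * exp (- \<delta> * real n))"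
    by (simp add: exp_of_nat_mult[symmetric] mult.commute)
  have 1: "AE \<omega> in M. summable (\<lambda>n. exp (- s * env_pot (real n) \<omega>))"
    by (rule AE_summable_of_expectations[OF moment_integrable _ _ sum])
       (use s(5) in \<open>auto simp: moment_def\<close>)
  have 2: "AE \<omega> in M. summable (\<lambda>n. exp (- (- s) * env_pot (- real n) \<omega>))"
  proof (rule AE_summable_of_expectations[OF moment_integrable _ _ sum])
    fix n
    have "expectation (\<lambda>\<omega>. exp (- (- s) * env_pot (- real n) \<omega>)) =
        expectation (\<lambda>\<omega>. exp (- s * env_pot (real n) (\<tau> (- real n) \<omega>)))"
      by (intro Bochner_Integration.integral_cong) (auto simp: env_pot_neg)
    also have "\<dots> = moment (real n) s"
      unfolding moment_def by (rule integral_shift) measurable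
    finally show "expectation (\<lambda>\<omega>. exp (- (- s) * env_pot (- real n) \<omega>)) \<le> C * exp (- \<delta> * real n)"
      using s(5)[of "real n"] by simp
  qed simp
  show ?thesis using 1 2 AE_space
  proof eventually_elim
    fix \<omega> assume 1: "summable (\<lambda>n. exp (- s * env_pot (real n) \<omega>))"
      and 2: "summable (\<lambda>n. exp (- (- s) * env_pot (- real n) \<omega>))" and w: "\<omega> \<in> space M"
    have mono: "env_scale x \<omega> \<le> env_scale y \<omega>" if "x \<le> y" for x y
      using env_scale_strict_mono[OF w, of x y] that by (cases "x = y") auto
    have small: "\<forall>\<^sub>F n in sequentially. f n < 0" if "summable (\<lambda>n. exp (s * f n))" for f :: "nat \<Rightarrow> real"
    proof -
      have "\<forall>\<^sub>F n in sequentially. exp (s * f n) < 1"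
        using order_tendstoD(2)[OF summable_LIMSEQ_zero[OF that], of 1] by simp
      then show ?thesis by eventually_elim (use s in \<open>simp add: mult_less_0_iff\<close>)
    qed
    have "summable (\<lambda>n. exp (- env_pot (real n) \<omega>))"
    proof (rule summable_comparison_test_ev[OF _ 1])
      have "\<forall>\<^sub>F n in sequentially. - env_pot (real n) \<omega> < 0" using 1 by (intro small) simp
      then show "\<forall>\<^sub>F n in sequentially. norm (exp (- env_pot (real n) \<omega>)) \<le> exp (- s * env_pot (real n) \<omega>)"
      proof eventually_elim
        case (elim n)
        then show ?case using mult_right_mono[of s 1 "env_pot (real n) \<omega>"] s by simp
      qed
    qed
    then have "env_scale x \<omega> \<le> exp lip * (\<Sum>k. exp (- env_pot (real k) \<omega>))" for x
    proof -
      obtain n :: nat where "x \<le> real n" using real_arch_simple by blast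
      then have "env_scale x \<omega> \<le> env_scale (real n) \<omega>" by (rule mono)
      also have "\<dots> \<le> exp lip * (\<Sum>k<n. exp (- env_pot (real k) \<omega>))" by (rule env_scale_le_sum[OF w])
      also have "\<dots> \<le> exp lip * (\<Sum>k. exp (- env_pot (real k) \<omega>))"
        using \<open>summable (\<lambda>n. exp (- env_pot (real n) \<omega>))\<close> by (intro mult_left_mono sum_le_suminf) auto
      finally show ?thesis .
    qed
    moreover have "\<exists>u<0. env_scale u \<omega> < A" for A
    proof -
      have "\<forall>\<^sub>F n in sequentially. env_pot (- real n) \<omega> < 0" using 2 by (intro small) simp
      then obtain N where N: "\<And>n. N \<le> n \<Longrightarrow> env_pot (- real n) \<omega> < 0"
        by (auto simp: eventually_sequentially)
      have low: "env_scale (- real (N + m)) \<omega> \<le> - real m * exp (- lip)" for m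
      proof (induction m)
        case 0
        then show ?case using mono[of "- real N" 0] by simp
      next
        case (Suc m)
        let ?x = "- real (N + Suc m)" and ?y = "- real (N + m)"
        obtain z where z: "?x < z" "z < ?y" "env_scale ?y \<omega> - env_scale ?x \<omega> = (?y - ?x) * exp (- env_pot z \<omega>)"
          by (rule env_scale_mean_value[OF w, of ?x ?y]) auto
        have "\<bar>env_pot z \<omega> - env_pot ?y \<omega>\<bar> \<le> lip * \<bar>z - ?y\<bar>" by (rule env_pot_Lipschitz[OF w])
        also have "\<dots> \<le> lip * 1" using z lip_pos by (intro mult_left_mono) auto
        finally have "env_pot z \<omega> \<le> lip" using N[of "N + m"] by simp
        then have "exp (- lip) \<le> exp (- env_pot z \<omega>)" by simp
        with z(3) Suc show ?case by (simp add: algebra_simps del: exp_le_cancel_iff)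
      qed
      obtain m :: nat where m: "- A * exp lip < real m" using reals_Archimedean2 by blast
      have "- real (Suc m) * exp (- lip) < A"
      proof -
        have "- A * exp lip < real (Suc m)" using m by simp
        then have "(- A * exp lip) * exp (- lip) < real (Suc m) * exp (- lip)" by (intro mult_strict_right_mono) auto
        moreover have "(- A * exp lip) * exp (- lip) = - A" by (simp add: mult.assoc mult_exp_exp)
        ultimately show ?thesis by linarith
      qed
      with low[of "Suc m"] have "env_scale (- real (N + Suc m)) \<omega> < A" by linarith
      then show ?thesis by (intro exI[of _ "- real (N + Suc m)"]) auto
    qed
    ultimately show "(\<exists>B. \<forall>x. env_scale x \<omega> \<le> B) \<and> (\<forall>A. \<exists>u<0. env_scale u \<omega> < A)" by blast
  qed
qed

lemma transient_if_positive:
  assumes "R \<le> L" "0 < expectation (env_pot L)"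
  shows "AE \<omega> in M. AE w in P 0 \<omega>. filterlim w at_top at_top"
  using AE_scale_limits[OF assms] AE_space
proof eventually_elim
  fix \<omega> assume *: "(\<exists>B. \<forall>x. env_scale x \<omega> \<le> B) \<and> (\<forall>A. \<exists>u<0. env_scale u \<omega> < A)" and w: "\<omega> \<in> space M"
  then obtain B where "\<And>x. env_scale x \<omega> \<le> B" by blast
  with * show "AE w in P 0 \<omega>. filterlim w at_top at_top"
    using one_dim_diffusion.transient[OF quenched[OF w], of B] unfolding env_scale_def by blast
qed

section \<open>Transience forces a positive mean of the potential\<close>

lemma scale_bounded_if_transient:
  assumes w: "\<omega> \<in> space M" and t: "AE w in P 0 \<omega>. filterlim w at_top at_top"
  shows "\<exists>B. \<forall>x. env_scale x \<omega> \<le> B"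
proof (rule ccontr)
  assume "\<not> ?thesis"
  then have unb: "\<exists>x. B < env_scale x \<omega>" for B by (meson not_le)
  interpret Q: one_dim_diffusion "\<lambda>y. a y \<omega>" "\<lambda>y. b y \<omega>" K \<nu> "P 0 \<omega>" by (rule quenched[OF w])
  have "AE w in P 0 \<omega>. \<not> filterlim w at_top at_top"
  proof (rule Q.not_transient)
    fix B :: real
    \<comment> \<open>Exceeding \<open>0\<close> as well forces \<open>x\<close> to be
      positive.\<close>
    obtain x where x: "max B 0 < env_scale x \<omega>" using unb by blast
    have "0 < x"
    proof (rule ccontr)
      assume "\<not> 0 < x"
      then have "env_scale x \<omega> \<le> 0" using env_scale_neg[OF w, of x] by (cases "x = 0") auto
      with x show False by simp
    qed
    with x show "\<exists>v>0. B < scale_function (\<lambda>y. a y \<omega>) (\<lambda>y. b y \<omega>) v"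
      unfolding env_scale_def by (intro exI[of _ x]) auto
  qed
  with t have "AE w in P 0 \<omega>. False" by eventually_elim simp
  then show False by (simp add: Q.N.AE_False)
qed

text \<open>With \<open>I = lim env_scale\<close>, the coboundary \<open>ln I - ln I \<circ> \<tau>\<^sub>m\<close> is bounded, hence centred, and exceeds
  \<open>- env_pot m\<close>.\<close>

lemma positive_if_bounded:
  assumes bdd: "AE \<omega> in M. \<exists>B. \<forall>x. env_scale x \<omega> \<le> B" and m: "0 < (m::nat)"
  shows "0 < expectation (env_pot (real m))"
proof -
  \<comment> \<open>\<open>lim\<close> is unspecified where the sequence diverges; all that is
    claimed about \<open>I\<close> concerns the almost sure event of boundedness.\<close>
  define I where "I \<omega> = lim (\<lambda>n. env_scale (real n) \<omega>)" for \<omega>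
  have [measurable]: "I \<in> borel_measurable M"
    unfolding I_def[abs_def] by measurable
  define \<phi> where "\<phi> \<omega> = ln (I \<omega>)" for \<omega>
  have [measurable]: "\<phi> \<in> borel_measurable M" unfolding \<phi>_def[abs_def] by measurable
  have lim: "(\<lambda>n. env_scale (real n) \<omega>) \<longlonglongrightarrow> I \<omega> \<and> exp (- lip) \<le> I \<omega>"
    if w: "\<omega> \<in> space M" and b: "\<exists>B. \<forall>x. env_scale x \<omega> \<le> B" for \<omega>
  proof -
    have inc: "incseq (\<lambda>n. env_scale (real n) \<omega>)"
      by (intro incseq_SucI less_imp_le env_scale_strict_mono[OF w]) simp
    then obtain l where l: "(\<lambda>n. env_scale (real n) \<omega>) \<longlonglongrightarrow> l" "\<And>n. env_scale (real n) \<omega> \<le> l"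
      using incseq_convergent[OF inc] b by metis
    then have "I \<omega> = l" unfolding I_def by (intro limI)
    moreover have "exp (- lip) \<le> env_scale 1 \<omega>" using env_scale_bounds(1)[OF w, of 1] by simp
    ultimately show ?thesis using l(1) l(2)[of 1] by simp
  qed
  define D where "D \<omega> = \<phi> \<omega> - \<phi> (\<tau> (real m) \<omega>)" for \<omega>
  have [measurable]: "D \<in> borel_measurable M" unfolding D_def[abs_def] by measurable
  define Bd where "Bd = lip * real m + ln (real m * exp (lip * real m) * exp lip + exp (lip * real m)) + 1"
  have good: "AE \<omega> in M. \<omega> \<in> space M \<and> (\<exists>B. \<forall>x. env_scale x \<omega> \<le> B) \<and> (\<exists>B. \<forall>x. env_scale x (\<tau> (real m) \<omega>) \<le> B)"
    using bdd AE_shift[OF bdd, of "real m"] AE_space by eventually_elim simp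
  have key: "AE \<omega> in M. - env_pot (real m) \<omega> < D \<omega> \<and> \<bar>D \<omega>\<bar> \<le> Bd \<and> - lip \<le> \<phi> \<omega> \<and> - lip \<le> \<phi> (\<tau> (real m) \<omega>)"
    using good
  proof eventually_elim
    fix \<omega> assume "\<omega> \<in> space M \<and> (\<exists>B. \<forall>x. env_scale x \<omega> \<le> B) \<and> (\<exists>B. \<forall>x. env_scale x (\<tau> (real m) \<omega>) \<le> B)"
    then have w: "\<omega> \<in> space M" and b: "\<exists>B. \<forall>x. env_scale x \<omega> \<le> B" "\<exists>B. \<forall>x. env_scale x (\<tau> (real m) \<omega>) \<le> B" by auto
    let ?\<omega>' = "\<tau> (real m) \<omega>"
    note l = lim[OF w b(1)] lim[OF shift_space[OF w] b(2)]
    have "(\<lambda>n. env_scale (real (n + m)) \<omega>) \<longlonglongrightarrow> I \<omega>" using l(1) by (intro LIMSEQ_ignore_initial_segment) simp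
    moreover have "env_scale (real (n + m)) \<omega> = env_scale (real m) \<omega> + exp (- env_pot (real m) \<omega>) * env_scale (real n) ?\<omega>'" for n
      using cocycle_env_scale[OF w, of "real m" "real n"] by (simp add: add.commute)
    ultimately have "(\<lambda>n. env_scale (real m) \<omega> + exp (- env_pot (real m) \<omega>) * env_scale (real n) ?\<omega>') \<longlonglongrightarrow> I \<omega>" by simp
    moreover have "(\<lambda>n. env_scale (real m) \<omega> + exp (- env_pot (real m) \<omega>) * env_scale (real n) ?\<omega>') \<longlonglongrightarrow>
        env_scale (real m) \<omega> + exp (- env_pot (real m) \<omega>) * I ?\<omega>'"
      using l(2) by (intro tendsto_intros) auto
    ultimately have I: "I \<omega> = env_scale (real m) \<omega> + exp (- env_pot (real m) \<omega>) * I ?\<omega>'" by (rule LIMSEQ_unique)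
    have I0: "0 < I \<omega>" "0 < I ?\<omega>'"
      using less_le_trans[OF exp_gt_zero conjunct2[OF l(1)]] less_le_trans[OF exp_gt_zero conjunct2[OF l(2)]]
      by auto
    have m0: "0 < real m" using m by simp
    have S0: "0 < env_scale (real m) \<omega>" by (rule env_scale_pos[OF w m0])
    \<comment> \<open>Dividing the cocycle relation for \<open>I\<close> by its shifted value leaves
      \<open>exp (- env_pot m)\<close> plus a positive term, whence the strict lower bound on
      \<open>D\<close>. The bound \<open>exp (- lip) \<le> I\<close> in the shifted environment
      keeps that term below a constant.\<close>
    have D: "D \<omega> = ln (env_scale (real m) \<omega> / I ?\<omega>' + exp (- env_pot (real m) \<omega>))"
    proof -
      have "D \<omega> = ln (I \<omega> / I ?\<omega>')" using I0 by (simp add: D_def \<phi>_def ln_divide_pos)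
      also have "I \<omega> / I ?\<omega>' = env_scale (real m) \<omega> / I ?\<omega>' + exp (- env_pot (real m) \<omega>)"
        using I0(2) by (subst I) (simp add: add_divide_distrib)
      finally show ?thesis .
    qed
    have q0: "0 < env_scale (real m) \<omega> / I ?\<omega>'" using S0 I0 by simp
    have "ln (exp (- env_pot (real m) \<omega>)) < D \<omega>"
      unfolding D using q0 by (subst ln_less_cancel_iff) (auto intro: add_pos_pos)
    then have lower: "- env_pot (real m) \<omega> < D \<omega>" by simp
    have Vb: "\<bar>env_pot (real m) \<omega>\<bar> \<le> lip * real m" using env_pot_bound[OF w, of "real m"] by simp
    have "env_scale (real m) \<omega> / I ?\<omega>' \<le> (real m * exp (lip * real m)) / exp (- lip)"
      using env_scale_bounds(2)[OF w m0] l(2) I0 S0 by (intro frac_le) auto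
    also have "\<dots> = real m * exp (lip * real m) * exp lip" by (simp add: exp_minus field_simps)
    finally have "env_scale (real m) \<omega> / I ?\<omega>' + exp (- env_pot (real m) \<omega>) \<le>
        real m * exp (lip * real m) * exp lip + exp (lip * real m)"
      using Vb by (intro add_mono) (auto simp: abs_le_iff)
    then have upper: "D \<omega> \<le> ln (real m * exp (lip * real m) * exp lip + exp (lip * real m))"
      unfolding D using q0 by (intro ln_mono) (auto intro: add_pos_pos)
    have "0 \<le> ln (real m * exp (lip * real m) * exp lip + exp (lip * real m))"
    proof -
      have "1 \<le> exp (lip * real m)" using lip_pos by simp
      moreover have "0 \<le> real m * exp (lip * real m) * exp lip" by simp
      ultimately show ?thesis by (intro ln_ge_zero) linarith
    qed
    moreover have "0 \<le> lip * real m" using lip_pos by simp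
    ultimately have "\<bar>D \<omega>\<bar> \<le> Bd"
      using lower upper Vb unfolding Bd_def by (auto simp: abs_le_iff)
    moreover have "- lip \<le> \<phi> \<omega>" "- lip \<le> \<phi> ?\<omega>'"
      unfolding \<phi>_def using l I0 by (auto simp: ln_ge_iff)
    ultimately show "- env_pot (real m) \<omega> < D \<omega> \<and> \<bar>D \<omega>\<bar> \<le> Bd \<and> - lip \<le> \<phi> \<omega> \<and> - lip \<le> \<phi> ?\<omega>'"
      using lower by blast
  qed
  \<comment> \<open>\<open>\<phi>\<close> is not known to be integrable, so its mean cannot be
    cancelled directly. The truncations are bounded, as \<open>\<phi>\<close> is at least
    \<open>- lip\<close>, and since \<open>min\<close> is 1-Lipschitz their differences are
    dominated by the bound on \<open>D\<close>.\<close>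
  define T where "T n \<omega> = min (\<phi> \<omega>) (real n)" for n :: nat and \<omega>
  have [measurable]: "T n \<in> borel_measurable M" for n unfolding T_def[abs_def] by measurable
  have iT: "integrable M (T n)" for n
  proof (rule integrable_const_bound[where B="lip + real n"])
    show "AE \<omega> in M. norm (T n \<omega>) \<le> lip + real n"
      using key by eventually_elim (use lip_pos in \<open>auto simp: T_def abs_le_iff min_def\<close>)
  qed measurable
  have "(\<integral>\<omega>. T n \<omega> - T n (\<tau> (real m) \<omega>) \<partial>M) = 0" for n
  proof -
    have "integrable M (\<lambda>\<omega>. T n (\<tau> (real m) \<omega>))"
      using integrable_distr[OF shift_meas[of "real m"], of "T n"] iT unfolding shift_preserving by simp
    then show ?thesis using iT integral_shift[of "T n" "real m"] by simp
  qed
  moreover have "(\<lambda>n. \<integral>\<omega>. T n \<omega> - T n (\<tau> (real m) \<omega>) \<partial>M) \<longlonglongrightarrow> (\<integral>\<omega>. D \<omega> \<partial>M)"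
  proof (rule integral_dominated_convergence[where w="\<lambda>_. Bd"])
    show "AE \<omega> in M. (\<lambda>n. T n \<omega> - T n (\<tau> (real m) \<omega>)) \<longlonglongrightarrow> D \<omega>"
    proof (rule AE_I2)
      fix \<omega>
      have "(\<lambda>n. min x (real n)) \<longlonglongrightarrow> x" for x :: real
      proof (rule tendsto_eventually)
        obtain N :: nat where "x \<le> real N" using real_arch_simple by blast
        then show "\<forall>\<^sub>F n in sequentially. min x (real n) = x"
          unfolding eventually_sequentially by (intro exI[of _ N]) auto
      qed
      then show "(\<lambda>n. T n \<omega> - T n (\<tau> (real m) \<omega>)) \<longlonglongrightarrow> D \<omega>"
        unfolding T_def D_def by (intro tendsto_diff)
    qed
    show "AE \<omega> in M. norm (T n \<omega> - T n (\<tau> (real m) \<omega>)) \<le> Bd" for n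
      using key
    proof eventually_elim
      case (elim \<omega>)
      have "\<bar>min x z - min y z\<bar> \<le> \<bar>x - y\<bar>" for x y z :: real by (auto simp: min_def)
      from this[of "\<phi> \<omega>" "real n" "\<phi> (\<tau> (real m) \<omega>)"] elim show ?case
        by (simp add: T_def D_def)
    qed
  qed auto
  ultimately have D0: "(\<integral>\<omega>. D \<omega> \<partial>M) = 0" by (simp add: LIMSEQ_const_iff)
  have iD: "integrable M D"
    by (rule integrable_const_bound[where B=Bd]) (use key in \<open>auto elim: eventually_mono\<close>)
  have iV: "integrable M (env_pot (real m))"
    by (rule integrable_bounded) (use env_pot_bound in auto)
  \<comment> \<open>Strictness survives integration: a nonnegative function of mean zero would
    vanish almost surely.\<close>
  have "(\<integral>\<omega>. D \<omega> + env_pot (real m) \<omega> \<partial>M) \<noteq> 0"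
  proof
    assume z: "(\<integral>\<omega>. D \<omega> + env_pot (real m) \<omega> \<partial>M) = 0"
    have "AE \<omega> in M. D \<omega> + env_pot (real m) \<omega> = 0"
    proof (rule integral_nonneg_eq_0_iff_AE[THEN iffD1, OF _ _ z])
      show "AE \<omega> in M. 0 \<le> D \<omega> + env_pot (real m) \<omega>" using key by eventually_elim simp
    qed (use iD iV in auto)
    with key have "AE \<omega> in M. False" by eventually_elim simp
    then show False by (simp add: AE_False)
  qed
  moreover have "0 \<le> (\<integral>\<omega>. D \<omega> + env_pot (real m) \<omega> \<partial>M)"
    by (rule integral_nonneg_AE) (use key in eventually_elim, simp)
  ultimately show ?thesis using D0 iD iV by simp
qed

subsection \<open>Annealed exit probabilities\<close>

lemma annealed_kernel:
  "(\<lambda>\<omega>. distr (P 0 \<omega>) (M \<Otimes>\<^sub>M path_space) (\<lambda>w. (\<omega>, w))) \<in> M \<rightarrow>\<^sub>M subprob_algebra (M \<Otimes>\<^sub>M path_space)"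
  by (rule measurable_distr2[where f="\<lambda>\<omega> w. (\<omega>, w)"])
     (use measurable_prob_algebraD[OF quenched_kernel] in auto)

lemma Pair_measurable_quenched:
  assumes "\<omega> \<in> space M"
  shows "(\<lambda>w. (\<omega>, w)) \<in> P 0 \<omega> \<rightarrow>\<^sub>M M \<Otimes>\<^sub>M path_space"
  using measurable_Pair1'[OF assms, of path_space]
  unfolding measurable_cong_sets[OF one_dim_diffusion.sets_N[OF quenched[OF assms]] refl] .

lemma sets_annealed: "sets (annealed M (P 0)) = sets (M \<Otimes>\<^sub>M path_space)"
  unfolding annealed_def by (rule sets_bind) (auto simp: not_empty)

lemma space_annealed: "space (annealed M (P 0)) = space (M \<Otimes>\<^sub>M path_space)"
  by (rule sets_eq_imp_space_eq[OF sets_annealed])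

lemma AE_annealed_transient:
  "(AE p in annealed M (P 0). filterlim (snd p) at_top at_top) \<longleftrightarrow>
    (AE \<omega> in M. AE w in P 0 \<omega>. filterlim w at_top at_top)"
proof -
  have [measurable]: "Measurable.pred (M \<Otimes>\<^sub>M path_space) (\<lambda>p. filterlim (snd p) at_top at_top)"
    by (rule measurable_compose[OF measurable_snd transient_sets])
  have "(AE p in annealed M (P 0). filterlim (snd p) at_top at_top) \<longleftrightarrow>
     (AE \<omega> in M. AE p in distr (P 0 \<omega>) (M \<Otimes>\<^sub>M path_space) (\<lambda>w. (\<omega>, w)). filterlim (snd p) at_top at_top)"
    unfolding annealed_def by (rule AE_bind[OF annealed_kernel]) measurable
  also have "\<dots> \<longleftrightarrow> (AE \<omega> in M. AE w in P 0 \<omega>. filterlim w at_top at_top)"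
  proof (rule AE_cong)
    fix \<omega> assume "\<omega> \<in> space M"
    from AE_distr_iff[OF Pair_measurable_quenched[OF this], of "\<lambda>p. filterlim (snd p) at_top at_top"]
    show "(AE p in distr (P 0 \<omega>) (M \<Otimes>\<^sub>M path_space) (\<lambda>w. (\<omega>, w)). filterlim (snd p) at_top at_top)
      \<longleftrightarrow> (AE w in P 0 \<omega>. filterlim w at_top at_top)" by simp
  qed
  finally show ?thesis .
qed

text \<open>By \<open>exit_probabilities\<close> this is the quenched probability of reaching
  \<open>- l\<close> before \<open>L\<close>.\<close>

definition ruin :: "real \<Rightarrow> real \<Rightarrow> 'w \<Rightarrow> real" where
  "ruin l L \<omega> = env_scale L \<omega> / (env_scale L \<omega> - env_scale (- l) \<omega>)"

lemma ruin_bounds: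
  assumes "\<omega> \<in> space M" "0 < l" "0 < L"
  shows "0 < ruin l L \<omega>" "ruin l L \<omega> < 1"
  using env_scale_pos[OF assms(1,3)] env_scale_neg[OF assms(1), of "- l"] assms(2) by (auto simp: ruin_def)

lemma ruin_measurable [measurable]: "ruin l L \<in> borel_measurable M"
  unfolding ruin_def[abs_def] by measurable

lemma ruin_integrable: "0 < l \<Longrightarrow> 0 < L \<Longrightarrow> integrable M (ruin l L)"
  by (rule integrable_bounded[where B=1]) (use ruin_bounds in \<open>auto simp: less_imp_le abs_le_iff intro: order_trans[of _ 0]\<close>)

lemma backtrack_prob_eq:
  assumes "0 < k" "0 < L"
  shows "backtrack_prob (annealed M (P 0)) k L = expectation (ruin (k * L) L)"
proof -
  have kL: "- (k * L) < 0" using assms by simp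
  have less: "- (k * L) < L" using kL assms(2) by linarith
  let ?E = "{p \<in> space (M \<Otimes>\<^sub>M path_space). hit_below (- (k * L)) (snd p) < hit_above L (snd p)}"
  have "Measurable.pred (M \<Otimes>\<^sub>M path_space) (\<lambda>p. hit_below (- (k * L)) (snd p) < hit_above L (snd p))"
    by (rule measurable_compose[OF measurable_snd hitting_times_less_sets(1)[OF less]])
  then have E: "?E \<in> sets (M \<Otimes>\<^sub>M path_space)" by (simp add: pred_def)
  have "emeasure (annealed M (P 0)) ?E =
      (\<integral>\<^sup>+\<omega>. emeasure (distr (P 0 \<omega>) (M \<Otimes>\<^sub>M path_space) (\<lambda>w. (\<omega>, w))) ?E \<partial>M)"
    unfolding annealed_def by (rule emeasure_bind[OF not_empty annealed_kernel E])
  also have "\<dots> = (\<integral>\<^sup>+\<omega>. ennreal (ruin (k * L) L \<omega>) \<partial>M)"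
  proof (rule nn_integral_cong)
    fix \<omega> assume w: "\<omega> \<in> space M"
    interpret Q: one_dim_diffusion "\<lambda>y. a y \<omega>" "\<lambda>y. b y \<omega>" K \<nu> "P 0 \<omega>" by (rule quenched[OF w])
    have "emeasure (distr (P 0 \<omega>) (M \<Otimes>\<^sub>M path_space) (\<lambda>w. (\<omega>, w))) ?E =
        emeasure (P 0 \<omega>) ((\<lambda>w. (\<omega>, w)) -` ?E \<inter> space (P 0 \<omega>))"
      by (rule emeasure_distr[OF Pair_measurable_quenched[OF w] E])
    also have "(\<lambda>w. (\<omega>, w)) -` ?E \<inter> space (P 0 \<omega>) =
        {w \<in> space (P 0 \<omega>). hit_below (- (k * L)) w < hit_above L w}"
      using w by (auto simp: space_pair_measure Q.space_N)
    also have "emeasure (P 0 \<omega>) \<dots> = ennreal (ruin (k * L) L \<omega>)"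
      unfolding Q.N.emeasure_eq_measure Q.exit_probabilities(1)[OF kL assms(2)] ruin_def env_scale_def ..
    finally show "emeasure (distr (P 0 \<omega>) (M \<Otimes>\<^sub>M path_space) (\<lambda>w. (\<omega>, w))) ?E =
        ennreal (ruin (k * L) L \<omega>)" .
  qed
  also have "\<dots> = ennreal (expectation (ruin (k * L) L))"
    using ruin_bounds(1)[of _ "k * L" L] assms
    by (intro nn_integral_eq_integral ruin_integrable AE_I2) (auto simp: less_imp_le)
  finally have "emeasure (annealed M (P 0)) ?E = ennreal (expectation (ruin (k * L) L))" .
  moreover have "0 \<le> expectation (ruin (k * L) L)"
    using ruin_bounds(1)[of _ "k * L" L] assms
    by (intro integral_nonneg_AE AE_I2) (auto simp: less_imp_le)
  ultimately show ?thesis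
    by (simp add: backtrack_prob_def space_annealed measure_def)
qed

lemma backtrack_prob_bounds:
  assumes "0 < k" "0 < L"
  shows "0 \<le> backtrack_prob (annealed M (P 0)) k L" "backtrack_prob (annealed M (P 0)) k L \<le> 1"
proof -
  show "0 \<le> backtrack_prob (annealed M (P 0)) k L" by (simp add: backtrack_prob_def)
  have kL: "0 < k * L" using assms by simp
  have "expectation (ruin (k * L) L) \<le> expectation (\<lambda>_. 1)"
    using ruin_bounds(2)[OF _ kL assms(2)] kL assms by (intro integral_mono ruin_integrable) (auto simp: less_imp_le)
  then show "backtrack_prob (annealed M (P 0)) k L \<le> 1"
    using backtrack_prob_eq[OF assms] by (simp add: prob_space)
qed

text \<open>The ratio of \<open>env_scale L\<close> to \<open>- env_scale (- l)\<close> is at most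
  the sum of the \<open>exp (e k)\<close>. To insert the power \<open>s\<close>: if some
  \<open>e k \<ge> 0\<close>, the term \<open>exp (s * e k)\<close> alone is at least
  \<open>1\<close> and hence exceeds the probability; otherwise every \<open>exp (e k)\<close> is at
  most \<open>exp (s * e k)\<close>. Measuring the potential from \<open>- l\<close> makes each term
  a shifted exponential moment at distance \<open>k + l\<close>.\<close>

lemma ruin_le_sum:
  assumes w: "\<omega> \<in> space M" and l: "1 \<le> l" and L: "0 < L" "L \<le> real n" and s: "0 < s" "s \<le> 1"
  shows "ruin l L \<omega> \<le> (\<Sum>k<n. exp (2 * lip) * exp (- s * env_pot (real k + l) (\<tau> (- l) \<omega>)))"
proof -
  \<comment> \<open>One \<open>lip\<close> comes from bounding the numerator by a sum, the other
    from bounding the denominator by its part on \<open>{- l..- l + 1}\<close>.\<close>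
  define e where "e k = 2 * lip - env_pot (real k + l) (\<tau> (- l) \<omega>)" for k :: nat
  have e: "e k = 2 * lip + env_pot (- l) \<omega> - env_pot (real k) \<omega>" for k
    using cocycle_env_pot[OF w, of "- l" "real k + l"] by (simp add: e_def)
  obtain z where z: "- l < z" "z < - l + 1" "env_scale (- l + 1) \<omega> - env_scale (- l) \<omega> = (- l + 1 - (- l)) * exp (- env_pot z \<omega>)"
    by (rule env_scale_mean_value[OF w, of "- l" "- l + 1"]) auto
  have "\<bar>env_pot z \<omega> - env_pot (- l) \<omega>\<bar> \<le> lip * \<bar>z - (- l)\<bar>" by (rule env_pot_Lipschitz[OF w])
  also have "\<dots> \<le> lip * 1" using z lip_pos by (intro mult_left_mono) auto
  finally have "exp (- lip - env_pot (- l) \<omega>) \<le> exp (- env_pot z \<omega>)" by simp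
  \<comment> \<open>\<open>1 \<le> l\<close> keeps this unit interval to the left of
    \<open>0\<close>.\<close>
  moreover have "env_scale (- l + 1) \<omega> \<le> 0"
    using env_scale_neg[OF w, of "- l + 1"] l by (cases "- l + 1 = 0") auto
  moreover have "env_scale (- l + 1) \<omega> - env_scale (- l) \<omega> = exp (- env_pot z \<omega>)" using z(3) by simp
  ultimately have den: "exp (- lip - env_pot (- l) \<omega>) \<le> - env_scale (- l) \<omega>" by linarith
  have num: "env_scale L \<omega> \<le> exp lip * (\<Sum>k<n. exp (- env_pot (real k) \<omega>))"
  proof -
    have "env_scale L \<omega> \<le> env_scale (real n) \<omega>" using env_scale_strict_mono[OF w, of L "real n"] L by (cases "L = real n") auto
    then show ?thesis using env_scale_le_sum[OF w, of n] by linarith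
  qed
  have pos: "0 < env_scale L \<omega>" "0 < - env_scale (- l) \<omega>" using env_scale_pos[OF w L(1)] env_scale_neg[OF w, of "- l"] l by auto
  have "ruin l L \<omega> \<le> (\<Sum>k<n. exp (s * e k))"
  proof (cases "\<exists>k<n. 0 \<le> e k")
    case True
    then obtain k where k: "k < n" "0 \<le> e k" by blast
    have "ruin l L \<omega> \<le> 1" using ruin_bounds(2)[OF w _ L(1), of l] l by simp
    also have "\<dots> \<le> exp (s * e k)" using k s by simp
    also have "\<dots> \<le> (\<Sum>k<n. exp (s * e k))" using k by (intro member_le_sum) auto
    finally show ?thesis .
  next
    case False
    have "ruin l L \<omega> \<le> env_scale L \<omega> / (- env_scale (- l) \<omega>)"
      unfolding ruin_def using pos by (intro frac_le) auto
    also have "\<dots> \<le> (exp lip * (\<Sum>k<n. exp (- env_pot (real k) \<omega>))) / exp (- lip - env_pot (- l) \<omega>)"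
      using num den pos by (intro frac_le) auto
    also have "\<dots> = (\<Sum>k<n. exp (e k))"
    proof -
      have "exp lip * exp (- env_pot (real k) \<omega>) / exp (- lip - env_pot (- l) \<omega>) = exp (e k)" for k
        by (simp add: e exp_diff[symmetric] mult_exp_exp algebra_simps)
      then show ?thesis by (simp add: sum_distrib_left sum_divide_distrib)
    qed
    also have "\<dots> \<le> (\<Sum>k<n. exp (s * e k))"
    proof (intro sum_mono)
      fix k assume "k \<in> {..<n}"
      then have "e k \<le> 0" using False by force
      then show "exp (e k) \<le> exp (s * e k)" using mult_right_mono_neg[OF s(2), of "e k"] by simp
    qed
    finally show ?thesis .
  qed
  also have "\<dots> \<le> (\<Sum>k<n. exp (2 * lip) * exp (- s * env_pot (real k + l) (\<tau> (- l) \<omega>)))"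
  proof (intro sum_mono)
    fix k
    have "s * (2 * lip) \<le> 2 * lip" using s lip_pos by simp
    then have "s * e k \<le> 2 * lip + - s * env_pot (real k + l) (\<tau> (- l) \<omega>)"
      by (simp add: e_def right_diff_distrib)
    then show "exp (s * e k) \<le> exp (2 * lip) * exp (- s * env_pot (real k + l) (\<tau> (- l) \<omega>))"
      by (simp only: mult_exp_exp exp_le_cancel_iff)
  qed
  finally show ?thesis .
qed

text \<open>\<open>ruin_le_sum\<close> has about \<open>L\<close> terms, each with mean at most a
  constant times \<open>exp (- \<delta> * (k * L))\<close> by stationarity and
  \<open>exponential_decay\<close>. The factor \<open>L + 1\<close> disappears in the logarithmic
  rate.\<close>

lemma condition_T_if_positive:
  assumes L0: "R \<le> L0" and pos: "0 < expectation (env_pot L0)"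
  shows "condition_T (annealed M (P 0))"
  unfolding condition_T_def
proof (intro allI impI)
  fix k :: real assume k: "0 < k"
  obtain s \<delta> C where s: "0 < s" "s \<le> 1" "0 < \<delta>" "0 < C" "\<And>y. 0 \<le> y \<Longrightarrow> moment y s \<le> C * exp (- \<delta> * y)"
    using exponential_decay[OF L0 pos] by blast
  define C' where "C' = exp (2 * lip) * C"
  have C': "0 < C'" using s by (simp add: C'_def)
  let ?p = "backtrack_prob (annealed M (P 0)) k"
  have p: "?p L \<le> (L + 1) * (C' * exp (- \<delta> * (k * L)))" if L: "0 < L" "1 \<le> k * L" for L
  proof -
    let ?l = "k * L" and ?n = "nat \<lceil>L\<rceil>"
    let ?f = "\<lambda>j \<omega>. exp (2 * lip) * exp (- s * env_pot (real j + ?l) (\<tau> (- ?l) \<omega>))"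
    have n: "L \<le> real ?n" "real ?n \<le> L + 1" using L by (auto simp: of_nat_nat)
    have i: "integrable M (\<lambda>\<omega>. exp (- s * env_pot y (\<tau> (- ?l) \<omega>)))" for y
      using integrable_distr[OF shift_meas[of "- ?l"], of "\<lambda>\<omega>. exp (- s * env_pot y \<omega>)"] moment_integrable
      unfolding shift_preserving by simp
    have f: "expectation (?f j) \<le> C' * exp (- \<delta> * ?l)" for j
    proof -
      have "expectation (?f j) = exp (2 * lip) * moment (real j + ?l) s"
        using integral_shift[of "\<lambda>\<omega>. exp (- s * env_pot (real j + ?l) \<omega>)" "- ?l"] by (simp add: moment_def)
      also have "\<dots> \<le> exp (2 * lip) * (C * exp (- \<delta> * (real j + ?l)))"
        using s(5)[of "real j + ?l"] L by (intro mult_left_mono) auto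
      also have "\<dots> \<le> exp (2 * lip) * (C * exp (- \<delta> * ?l))"
        using s by (intro mult_left_mono) auto
      finally show ?thesis by (simp add: C'_def)
    qed
    have "?p L = expectation (ruin ?l L)" by (rule backtrack_prob_eq[OF k L(1)])
    also have "\<dots> \<le> expectation (\<lambda>\<omega>. \<Sum>j<?n. ?f j \<omega>)"
    proof (rule integral_mono)
      show "integrable M (ruin ?l L)" using k L by (intro ruin_integrable) auto
      show "integrable M (\<lambda>\<omega>. \<Sum>j<?n. ?f j \<omega>)" using i by auto
      show "ruin ?l L \<omega> \<le> (\<Sum>j<?n. ?f j \<omega>)" if "\<omega> \<in> space M" for \<omega>
        by (rule ruin_le_sum[OF that L(2,1) n(1) s(1,2)])
    qed
    also have "\<dots> = (\<Sum>j<?n. expectation (?f j))" using i by (intro Bochner_Integration.integral_sum) auto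
    also have "\<dots> \<le> (\<Sum>j<?n. C' * exp (- \<delta> * ?l))" by (intro sum_mono f)
    also have "\<dots> = real ?n * (C' * exp (- \<delta> * ?l))" by simp
    also have "\<dots> \<le> (L + 1) * (C' * exp (- \<delta> * ?l))" using n C' by (intro mult_right_mono) auto
    finally show ?thesis .
  qed
  have "((\<lambda>L. 1 / L * (ln (L + 1) + ln C' - \<delta> * (k * L))) \<longlongrightarrow> - \<delta> * k) at_top"
    using s(3) k by real_asymp
  then have "\<forall>\<^sub>F L in at_top. 1 / L * (ln (L + 1) + ln C' - \<delta> * (k * L)) < - \<delta> * k / 2"
    by (rule order_tendstoD(2)) (use s(3) k in simp)
  moreover have "\<forall>\<^sub>F L in at_top. max 1 (1 / k) \<le> (L::real)" by (rule eventually_ge_at_top)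
  ultimately have "\<forall>\<^sub>F L in at_top. ereal (1 / L) * log_prob (?p L) \<le> ereal (- \<delta> * k / 2)"
  proof eventually_elim
    fix L :: real
    assume lt: "1 / L * (ln (L + 1) + ln C' - \<delta> * (k * L)) < - \<delta> * k / 2" and "max 1 (1 / k) \<le> L"
    then have L: "1 \<le> L" "1 \<le> k * L" using k by (auto simp: field_simps)
    show "ereal (1 / L) * log_prob (?p L) \<le> ereal (- \<delta> * k / 2)"
    \<comment> \<open>A zero probability has \<open>log_prob\<close> equal to
      \<open>- \<infinity>\<close> and must be separated from the computation with
      \<open>ln\<close>.\<close>
    proof (cases "?p L = 0")
      case True
      then show ?thesis using L by (simp add: log_prob_def)
    next
      case False
      then have p0: "0 < ?p L" using backtrack_prob_bounds(1)[of k L] k L by simp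
      have "ln (?p L) \<le> ln ((L + 1) * (C' * exp (- \<delta> * (k * L))))"
        using p[of L] p0 L by (intro ln_mono) auto
      also have "\<dots> = ln (L + 1) + ln C' - \<delta> * (k * L)" using L C' by (simp add: ln_mult)
      finally have "1 / L * ln (?p L) \<le> 1 / L * (ln (L + 1) + ln C' - \<delta> * (k * L))"
        using L by (intro mult_left_mono) auto
      with lt show ?thesis using False by (simp add: log_prob_def)
    qed
  qed
  then have "Limsup at_top (\<lambda>L. ereal (1 / L) * log_prob (?p L)) \<le> ereal (- \<delta> * k / 2)"
    by (rule Limsup_bounded)
  also have "\<dots> < 0" using s(3) k by simp
  finally show "Limsup at_top (\<lambda>L. ereal (1 / L) * log_prob (?p L)) < 0" .
qed

text \<open>Logarithms of probabilities are at most \<open>0\<close>, and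
  \<open>1 / L \<le> L powr - \<gamma>\<close> for \<open>L \<ge> 1\<close>, so the new factor only
  makes the quantity more negative.\<close>

lemma condition_T_imp_T':
  assumes T: "condition_T (annealed M (P 0))"
  shows "condition_T' (annealed M (P 0))"
  unfolding condition_T'_def
proof (intro allI impI)
  fix \<gamma> k :: real assume gam: "0 < \<gamma> \<and> \<gamma> < 1" and k: "0 < k"
  let ?p = "backtrack_prob (annealed M (P 0)) k"
  have "\<forall>\<^sub>F L in at_top. ereal (L powr - \<gamma>) * log_prob (?p L) \<le> ereal (1 / L) * log_prob (?p L)"
    using eventually_ge_at_top[of 1]
  proof eventually_elim
    fix L :: real assume L: "1 \<le> L"
    have "1 / L = L powr - 1" using L by (simp add: powr_minus_divide)
    also have "\<dots> \<le> L powr - \<gamma>" using L gam by (intro powr_mono) auto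
    finally have le: "1 / L \<le> L powr - \<gamma>" .
    show "ereal (L powr - \<gamma>) * log_prob (?p L) \<le> ereal (1 / L) * log_prob (?p L)"
    proof (cases "?p L = 0")
      case True
      then show ?thesis using L by (simp add: log_prob_def)
    next
      case False
      have "0 < ?p L" "?p L \<le> 1" using backtrack_prob_bounds[of k L] k L False by auto
      then have "ln (?p L) \<le> 0" by simp
      then show ?thesis using False mult_right_mono_neg[OF le, of "ln (?p L)"] by (simp add: log_prob_def)
    qed
  qed
  then have "Limsup at_top (\<lambda>L. ereal (L powr - \<gamma>) * log_prob (?p L)) \<le>
      Limsup at_top (\<lambda>L. ereal (1 / L) * log_prob (?p L))" by (rule Limsup_mono)
  also have "\<dots> < 0" using T k by (simp add: condition_T_def)
  finally show "Limsup at_top (\<lambda>L. ereal (L powr - \<gamma>) * log_prob (?p L)) < 0" .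
qed

text \<open>A bound linear in \<open>ruin L L = \<rho> / (1 + \<rho>)\<close>, so that expectations
  can be taken. For \<open>\<rho> \<ge> 1\<close> this ratio is at least \<open>1 / 2\<close>, and
  \<open>4 * lip * L\<close> times it covers the deterministic bound \<open>2 * lip * L\<close>. For
  \<open>1 / 2 \<le> \<rho> < 1\<close> it is at least \<open>1 / 3\<close>, and
  \<open>3 * ln 2\<close> times it compensates \<open>- ln 2\<close>. For smaller
  \<open>\<rho>\<close> already \<open>ln \<rho> \<le> - ln 2\<close>.\<close>

lemma ln_rho_le_ruin:
  assumes w: "\<omega> \<in> space M" and L: "0 < L"
  shows "ln (rho (P 0) L \<omega>) \<le> (4 * lip * L + 3 * ln 2) * ruin L L \<omega> - ln 2"
proof -
  define \<rho> where "\<rho> = rho (P 0) L \<omega>"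
  have \<rho>0: "0 < \<rho>" unfolding \<rho>_def by (rule rho_eq_shift(3)[OF w L])
  have r: "ruin L L \<omega> = \<rho> / (1 + \<rho>)"
    using env_scale_pos[OF w L] env_scale_neg[OF w, of "- L"] L
    unfolding \<rho>_def rho_eq[OF w L] ruin_def by (simp add: field_simps)
  have cL: "0 \<le> lip * L" using lip_pos L by simp
  have ln2: "0 < ln (2::real)" by simp
  have r0: "0 \<le> ruin L L \<omega>" using ruin_bounds(1)[OF w L L] by simp
  have ub: "ln \<rho> \<le> 2 * lip * L" using rho_eq_shift(2)[OF w L] by (simp add: \<rho>_def abs_le_iff)
  have "ln \<rho> \<le> 4 * (lip * L) * ruin L L \<omega> + ln 2 * (3 * ruin L L \<omega> - 1)"
  proof -
    consider "1 \<le> \<rho>" | "1 / 2 \<le> \<rho>" "\<rho> < 1" | "\<rho> < 1 / 2" by linarith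
    then show ?thesis
    proof cases
      case 1
      then have "1 / 2 \<le> ruin L L \<omega>" by (simp add: r field_simps)
      moreover from this have "4 * (lip * L) * (1 / 2) \<le> 4 * (lip * L) * ruin L L \<omega>"
        using cL by (intro mult_left_mono) auto
      moreover have "0 \<le> ln 2 * (3 * ruin L L \<omega> - 1)"
        using ln2 \<open>1 / 2 \<le> ruin L L \<omega>\<close> by (intro mult_nonneg_nonneg) auto
      moreover have "2 * lip * L = 4 * (lip * L) * (1 / 2)" by simp
      ultimately show ?thesis using ub by linarith
    next
      case 2
      then have "1 / 3 \<le> ruin L L \<omega>" by (simp add: r field_simps)
      then have "0 \<le> ln 2 * (3 * ruin L L \<omega> - 1)" using ln2 by (intro mult_nonneg_nonneg) auto
      moreover have "0 \<le> 4 * (lip * L) * ruin L L \<omega>" using cL r0 by simp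
      moreover have "ln \<rho> \<le> 0" using 2 \<rho>0 by simp
      ultimately show ?thesis by linarith
    next
      case 3
      then have "ln \<rho> \<le> ln (1 / 2)" using \<rho>0 by (intro ln_mono) auto
      then have "ln \<rho> \<le> - ln 2" by (simp add: ln_div)
      moreover have "0 \<le> 4 * (lip * L) * ruin L L \<omega>" using cL r0 by simp
      moreover have "0 \<le> ln 2 * (3 * ruin L L \<omega>)" using ln2 r0 by simp
      moreover have "ln 2 * (3 * ruin L L \<omega> - 1) = ln 2 * (3 * ruin L L \<omega>) - ln 2"
        by (simp add: right_diff_distrib)
      ultimately show ?thesis by linarith
    qed
  qed
  then show ?thesis by (simp add: \<rho>_def algebra_simps)
qed

text \<open>By \<open>ln_rho_le_ruin\<close> the mean is at most a multiple of \<open>L\<close>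
  times the backtracking probability, minus \<open>ln 2\<close>. A stretched exponential beats the
  linear factor; the exponent \<open>1 / 2\<close> serves as the instance, with level ratio
  \<open>1\<close> to match \<open>ruin L L\<close>.\<close>

lemma negative_if_condition_T':
  assumes T: "condition_T' (annealed M (P 0))"
  shows "\<exists>L>R. expectation (\<lambda>\<omega>. ln (rho (P 0) L \<omega>)) < 0"
proof -
  let ?p = "backtrack_prob (annealed M (P 0)) 1"
  have "Limsup at_top (\<lambda>L. ereal (L powr - (1 / 2)) * log_prob (?p L)) < 0"
    by (rule T[unfolded condition_T'_def, rule_format]) auto
  then obtain y where y: "Limsup at_top (\<lambda>L. ereal (L powr - (1 / 2)) * log_prob (?p L)) < ereal y" "ereal y < 0"
    using ereal_dense2 by blast
  define e where "e = - y"
  have e: "0 < e" using y(2) by (simp add: e_def)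
  have ev: "\<forall>\<^sub>F L in at_top. ereal (L powr - (1 / 2)) * log_prob (?p L) < ereal y"
    by (rule Limsup_lessD[OF y(1)])
  have "((\<lambda>L. (4 * lip * L + 3 * ln 2) * exp (- e * L powr (1 / 2)) - ln 2) \<longlongrightarrow> - ln 2) at_top"
    using e lip_pos by real_asymp
  then have neg: "\<forall>\<^sub>F L in at_top. (4 * lip * L + 3 * ln 2) * exp (- e * L powr (1 / 2)) - ln 2 < 0"
    by (rule order_tendstoD(2)) simp
  obtain L where L: "R < L" "1 \<le> L" "ereal (L powr - (1 / 2)) * log_prob (?p L) < ereal y"
    "(4 * lip * L + 3 * ln 2) * exp (- e * L powr (1 / 2)) - ln 2 < 0"
    using eventually_happens[OF eventually_conj[OF ev eventually_conj[OF neg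
       eventually_conj[OF eventually_gt_at_top[of R] eventually_ge_at_top[of 1]]]]] by auto
  have L0: "0 < L" using L(2) by simp
  have p: "?p L \<le> exp (- e * L powr (1 / 2))"
  proof (cases "?p L = 0")
    case False
    then have p0: "0 < ?p L" using backtrack_prob_bounds(1)[of 1 L] L0 by simp
    have "L powr - (1 / 2) * ln (?p L) < - e" using L(3) False by (simp add: log_prob_def e_def)
    then have "L powr (1 / 2) * (L powr - (1 / 2) * ln (?p L)) \<le> L powr (1 / 2) * (- e)"
      by (intro mult_left_mono) auto
    then have "ln (?p L) \<le> - e * L powr (1 / 2)"
      using L0 by (simp add: mult.assoc[symmetric] powr_add[symmetric] mult.commute)
    then show ?thesis using p0 by (simp add: ln_le_cancel_iff[symmetric])
  qed simp
  have i: "integrable M (ruin L L)" using L0 by (intro ruin_integrable)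
  have "expectation (\<lambda>\<omega>. ln (rho (P 0) L \<omega>)) \<le>
      expectation (\<lambda>\<omega>. (4 * lip * L + 3 * ln 2) * ruin L L \<omega> - ln 2)"
    using i by (intro integral_mono integral_ln_rho(1)[OF L0] ln_rho_le_ruin L0) auto
  also have "\<dots> = (4 * lip * L + 3 * ln 2) * ?p L - ln 2"
    using i backtrack_prob_eq[of 1 L] L0 by (simp add: prob_space)
  also have "\<dots> \<le> (4 * lip * L + 3 * ln 2) * exp (- e * L powr (1 / 2)) - ln 2"
    using p L0 lip_pos by (intro diff_right_mono mult_left_mono) auto
  finally show ?thesis using L by (intro exI[of _ L]) simp
qed

end

theorem proposition2p7:
  fixes M :: "'w measure"
    and \<tau> :: "real \<Rightarrow> 'w \<Rightarrow> 'w"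
    and a b :: "real \<Rightarrow> 'w \<Rightarrow> real"
    and K \<nu> R :: real
    and P :: "real \<Rightarrow> 'w \<Rightarrow> (real \<Rightarrow> real) measure"
  assumes "diffusion_in_random_environment M \<tau> a b K \<nu> R P"
  defines "\<rho> \<equiv> rho (P 0)"
    and "P0 \<equiv> annealed M (P 0)"
  defines "cond_i \<equiv> (\<exists>s L. 0 < s \<and> s \<le> 1 \<and> L > R \<and>
              integrable M (\<lambda>\<omega>. \<rho> L \<omega> powr s) \<and> (\<integral>\<omega>. \<rho> L \<omega> powr s \<partial>M) < 1)"
    and "cond_ii \<equiv> (\<exists>L. L > R \<and>
              integrable M (\<lambda>\<omega>. ln (\<rho> L \<omega>)) \<and> (\<integral>\<omega>. ln (\<rho> L \<omega>) \<partial>M) < 0)"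
    and "cond_iii \<equiv> condition_T P0"
    and "cond_iv \<equiv> condition_T' P0"
    and "cond_v \<equiv> (AE p in P0. filterlim (snd p) at_top at_top)"
  shows "(cond_i \<longleftrightarrow> cond_ii) \<and> (cond_ii \<longleftrightarrow> cond_iii) \<and>
         (cond_iii \<longleftrightarrow> cond_iv) \<and> (cond_iv \<longleftrightarrow> cond_v)"
proof -
  interpret D: diffusion_in_random_environment M \<tau> a b K \<nu> R P by fact
  have R: "0 < R" by (rule D.R_pos)
  \<comment> \<open>Condition (ii) is the hub: (i) and (v) are each equivalent to it, and (ii),
    (iii), (iv) form a cycle.\<close>
  have i_ii: cond_ii if c1: cond_i
  proof -
    obtain s L where s: "0 < s" and L: "R < L" and i: "integrable M (\<lambda>\<omega>. \<rho> L \<omega> powr s)"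
      and lt: "(\<integral>\<omega>. \<rho> L \<omega> powr s \<partial>M) < 1"
      using c1 unfolding cond_i_def by blast
    have L0: "0 < L" using L R by simp
    note iln = D.integral_ln_rho(1)[OF L0, folded \<rho>_def]
    have "s * (\<integral>\<omega>. ln (\<rho> L \<omega>) \<partial>M) = (\<integral>\<omega>. s * ln (\<rho> L \<omega>) \<partial>M)" by simp
    \<comment> \<open>Jensen's inequality in the elementary form \<open>ln x \<le> x - 1\<close>,
      with \<open>x = \<rho> L \<omega> powr s\<close>.\<close>
    also have "\<dots> \<le> (\<integral>\<omega>. \<rho> L \<omega> powr s - 1 \<partial>M)"
    proof (rule integral_mono)
      fix \<omega> assume "\<omega> \<in> space M"
      then have "0 < \<rho> L \<omega>" unfolding \<rho>_def using D.rho_eq_shift(3) L0 by blast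
      then show "s * ln (\<rho> L \<omega>) \<le> \<rho> L \<omega> powr s - 1"
        using ln_le_minus_one[of "\<rho> L \<omega> powr s"] by (simp add: ln_powr)
    qed (use iln i in auto)
    also have "\<dots> < 0" using i lt by (simp add: D.prob_space)
    finally have "(\<integral>\<omega>. ln (\<rho> L \<omega>) \<partial>M) < 0" using s by (simp add: mult_less_0_iff)
    with L iln show ?thesis unfolding cond_ii_def by blast
  qed
  have ii_i: cond_i if c2: cond_ii
  proof -
    obtain L where L: "R < L" and lt: "(\<integral>\<omega>. ln (\<rho> L \<omega>) \<partial>M) < 0"
      using c2 unfolding cond_ii_def by blast
    have L0: "0 < L" using L R by simp
    note iln = D.integral_ln_rho(1)[OF L0, folded \<rho>_def]
    have bound: "\<bar>ln (\<rho> L \<omega>)\<bar> \<le> 2 * D.lip * L" "0 < \<rho> L \<omega>" if "\<omega> \<in> space M" for \<omega>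
      unfolding \<rho>_def using D.rho_eq_shift(2,3)[OF that L0] by auto
    \<comment> \<open>The exponential moment of \<open>- ln \<rho>\<close> at \<open>s\<close> is
      the mean of \<open>\<rho> powr s\<close>.\<close>
    obtain s where s: "0 < s" "s \<le> 1" "(\<integral>\<omega>. exp (- s * - ln (\<rho> L \<omega>)) \<partial>M) < 1"
    proof (rule D.exponential_moment_less_1[of "\<lambda>\<omega>. - ln (\<rho> L \<omega>)" "max 1 (2 * D.lip * L)"])
      show "(\<lambda>\<omega>. - ln (\<rho> L \<omega>)) \<in> borel_measurable M" using iln by simp
      show "\<bar>- ln (\<rho> L \<omega>)\<bar> \<le> max 1 (2 * D.lip * L)" if "\<omega> \<in> space M" for \<omega>
        using bound(1)[OF that] by simp
      show "0 < (\<integral>\<omega>. - ln (\<rho> L \<omega>) \<partial>M)" using lt by simp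
    qed auto
    have eq: "\<rho> L \<omega> powr s = exp (- s * - ln (\<rho> L \<omega>))" if "\<omega> \<in> space M" for \<omega>
      using bound(2)[OF that] by (simp add: powr_def)
    have "integrable M (\<lambda>\<omega>. \<rho> L \<omega> powr s)"
    proof (rule D.integrable_bounded)
      show "(\<lambda>\<omega>. \<rho> L \<omega> powr s) \<in> borel_measurable M"
        using D.rho_measurable[OF L0] unfolding \<rho>_def by measurable
      fix \<omega> assume w: "\<omega> \<in> space M"
      have "s * ln (\<rho> L \<omega>) \<le> s * (2 * D.lip * L)"
        using bound(1)[OF w] s by (intro mult_left_mono) (auto simp: abs_le_iff)
      then show "\<bar>\<rho> L \<omega> powr s\<bar> \<le> exp (s * (2 * D.lip * L))" by (simp add: eq[OF w])
    qed
    moreover have "(\<integral>\<omega>. \<rho> L \<omega> powr s \<partial>M) < 1"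
      using s(3) by (subst Bochner_Integration.integral_cong[OF refl eq])
    ultimately show ?thesis unfolding cond_i_def using s L by blast
  qed
  have pos: "\<exists>L. R \<le> L \<and> 0 < (\<integral>\<omega>. D.env_pot L \<omega> \<partial>M)" if c2: cond_ii
  proof -
    obtain L where L: "R < L" "(\<integral>\<omega>. ln (\<rho> L \<omega>) \<partial>M) < 0"
      using c2 unfolding cond_ii_def by blast
    then show ?thesis using D.integral_ln_rho(2)[of L] R unfolding \<rho>_def by (intro exI[of _ L]) auto
  qed
  have ii_iii: cond_iii if cond_ii
    using pos[OF that] D.condition_T_if_positive unfolding cond_iii_def P0_def by blast
  have iii_iv: cond_iv if cond_iii
    using that D.condition_T_imp_T' unfolding cond_iii_def cond_iv_def P0_def by blast
  have iv_ii: cond_ii if c4: cond_iv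
  proof -
    obtain L where L: "R < L" "(\<integral>\<omega>. ln (\<rho> L \<omega>) \<partial>M) < 0"
      using c4 D.negative_if_condition_T' unfolding cond_iv_def P0_def \<rho>_def by blast
    then show ?thesis
      unfolding cond_ii_def \<rho>_def using D.integral_ln_rho(1)[of L] R by (intro exI[of _ L]) auto
  qed
  have ii_v: cond_v if cond_ii
    using pos[OF that] D.transient_if_positive unfolding cond_v_def P0_def D.AE_annealed_transient by blast
  have v_ii: cond_ii if cond_v
  proof -
    have "AE \<omega> in M. AE w in P 0 \<omega>. filterlim w at_top at_top"
      using that unfolding cond_v_def P0_def D.AE_annealed_transient .
    then have "AE \<omega> in M. \<exists>B. \<forall>x. D.env_scale x \<omega> \<le> B"
      using AE_space by eventually_elim (rule D.scale_bounded_if_transient)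
    \<comment> \<open>\<open>positive_if_bounded\<close> works along integers, and any of them
      beyond \<open>R\<close> can serve as the \<open>L\<close> of (ii).\<close>
    moreover obtain m :: nat where m: "R < real m" using reals_Archimedean2 by blast
    moreover have "0 < m" using m R by (cases m) auto
    ultimately have "0 < (\<integral>\<omega>. D.env_pot (real m) \<omega> \<partial>M)" by (intro D.positive_if_bounded)
    then show ?thesis
      unfolding cond_ii_def \<rho>_def using D.integral_ln_rho[of "real m"] m R by (intro exI[of _ "real m"]) auto
  qed
  show ?thesis using i_ii ii_i ii_iii iii_iv iv_ii ii_v v_ii by blast
qed

end
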